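(* Let $\lambda>0$ and $\omega\in\mathbb{R}$. For any $m\in\mathbb{Z}\setminus\{0\}$, the equation $$\partial_t u=u\times(\Delta u+\lambda u_3\widehat k),\qquad u=(u_1,u_2,u_3):\mathbb{R}^2\times\mathbb{R}\to S^2,\quad \widehat k=(0,0,1),$$ admits a solution of the form $$u(x,t)=\bigl(\sin h(r)\cos(m\theta+\omega t),\ \sin h(r)\sin(m\theta+\omega t),\ \cos h(r)\bigr)$$ with $h(0)=0$, $\lim_{r\to\infty}h(r)=\pi$ and $0<h(r)<\pi$ on $(0,\infty)$, if and only if $$0<\omega<\frac{\lambda}{|m|}.$$
   Context: $S^2=\{x\in\mathbb{R}^3:|x|=1\}$; $\times$ is the cross product in $\mathbb{R}^3$; $(r,\theta)$ are polar coordinates of $x\in\mathbb{R}^2$; $\Delta$ is the Laplacian on $\mathbb{R}^2$. For $u$ of the displayed form the equation is equivalent to the ordinary differential equation $h''+\frac1r h'-\frac{m^2}{r^2}\sin h\cos h=(\omega+\lambda\cos h)\sin h$ for $h$ on $(0,\infty)$. *)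

theory Defs
  imports "HOL-Analysis.Analysis"
begin

definition partial_deriv :: "'n::finite \<Rightarrow> (real^'n \<Rightarrow> 'b::real_normed_vector) \<Rightarrow> real^'n \<Rightarrow> 'b" where
  "partial_deriv i f x = vector_derivative (\<lambda>s. f (x + s *\<^sub>R axis i 1)) (at 0)"

text \<open>A guard for \<open>partial_deriv\<close>, which is a total function and has an unspecified value
  where the derivative does not exist.\<close>

definition partially_differentiable :: "'n::finite \<Rightarrow> (real^'n \<Rightarrow> 'b::real_normed_vector) \<Rightarrow> bool" where
  "partially_differentiable i f \<longleftrightarrow> (\<forall>x. (\<lambda>s. f (x + s *\<^sub>R axis i 1)) differentiable (at 0))"

definition laplacian :: "(real^'n::finite \<Rightarrow> 'b::real_normed_vector) \<Rightarrow> real^'n \<Rightarrow> 'b" where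
  "laplacian f x = (\<Sum>i\<in>UNIV. partial_deriv i (partial_deriv i f) x)"

text \<open>All spatial derivatives of order at most two of \<open>u(x,t)\<close> exist on all of space-time
  and are jointly continuous in \<open>(x,t)\<close>.\<close>

definition spatially_C2 :: "(real^'n::finite \<Rightarrow> real \<Rightarrow> 'b::real_normed_vector) \<Rightarrow> bool" where
  "spatially_C2 u \<longleftrightarrow>
     continuous_on UNIV (\<lambda>(x, t). u x t) \<and>
     (\<forall>i. (\<forall>t. partially_differentiable i (\<lambda>y. u y t)) \<and>
          continuous_on UNIV (\<lambda>(x, t). partial_deriv i (\<lambda>y. u y t) x)) \<and>
     (\<forall>i j. (\<forall>t. partially_differentiable j (partial_deriv i (\<lambda>y. u y t))) \<and>
          continuous_on UNIV (\<lambda>(x, t). partial_deriv j (partial_deriv i (\<lambda>y. u y t)) x))"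

text \<open>Classical (\<open>C\<^sup>2\<close> in space, \<open>C\<^sup>1\<close> in time) sphere-valued solutions. Existence
  of the time derivative is part of \<open>has_vector_derivative\<close>; its joint continuity follows from
  the equation together with \<open>spatially_C2\<close>. The equation is imposed everywhere, including
  at the spatial origin.\<close>

definition landau_lifshitz_solution :: "real \<Rightarrow> (real^2 \<Rightarrow> real \<Rightarrow> real^3) \<Rightarrow> bool" where
  "landau_lifshitz_solution lam u \<longleftrightarrow>
     (\<forall>x t. u x t \<in> sphere 0 1) \<and>
     spatially_C2 u \<and>
     (\<forall>x t. ((\<lambda>s. u x s) has_vector_derivative
        cross3 (u x t) (laplacian (\<lambda>y. u y t) x + (lam * u x t $ 3) *\<^sub>R vector [0, 0, 1])) (at t))"

text \<open>\<open>u\<close> is the \<open>m\<close>-equivariant map, rotating with angular velocity \<open>om\<close>, with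
  profile \<open>h\<close>; only the values of \<open>h\<close> on \<open>[0,\<infinity>)\<close> matter. Every point of the plane has
  polar coordinates, so \<open>u\<close> is determined by \<open>h\<close>; at the origin, where \<open>\<theta>\<close> is
  arbitrary, the condition is consistent because \<open>sin (h 0) = 0\<close> when \<open>h 0 = 0\<close>.\<close>

definition equivariant_rotating :: "int \<Rightarrow> real \<Rightarrow> (real \<Rightarrow> real) \<Rightarrow> (real^2 \<Rightarrow> real \<Rightarrow> real^3) \<Rightarrow> bool" where
  "equivariant_rotating m om h u \<longleftrightarrow>
     (\<forall>r \<theta> t. 0 \<le> r \<longrightarrow>
        u (vector [r * cos \<theta>, r * sin \<theta>]) t =
          vector [sin (h r) * cos (of_int m * \<theta> + om * t),
                  sin (h r) * sin (of_int m * \<theta> + om * t),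
                  cos (h r)])"

end

(*
For u of the given form the equation is the profile equation, which becomes the first-order system
  r h' = v,   r v' = n^2 sin h cos h + r^2 (om + lam cos h) sin h,   n = |m|.
Two quantities control it: w = v - n sin h (w = 0 is the equation of the harmonic maps
2 arctan (c r^n)) and E = (v^2 - n^2 sin^2 h) / 2, for which
  (E - lam/2 r^2 sin^2 h)' = r sin h (om v - lam sin h).

Necessity. Near the origin w > 0. If om >= lam/n, the identity shows that E cannot vanish as long as
w > 0 before; hence w > 0 forever, E stays above a positive constant, and h grows at least like
log r. If om <= 0, Pohozaev's quantity r^2 F - E with F = lam/2 sin^2 h - om (1 + cos h) increases
from 0 and then grows like r^2, so that F cannot tend to 0.

Existence. Write h = r^n k(r^2); in the variable x = r^2 the equation for k is a Volterra equation
with a kernel that is regular at 0. Fix k(0) = 2 and shoot in the factor e of both parameters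
(scaling in r removes e again). For small e the profile is close to 2 arctan (r^n), and since
om < lam/n the identity makes E negative, so that h turns back before reaching pi. For large e
(small initial slope after scaling) the dissipation rate 2 E / r^3 of the energy E/r^2 - F is too
small to stop h before pi. Both alternatives are open in e, so for some e neither happens, and then
h increases to pi.
*)

theory Submission
  imports Defs
begin

section \<open>The profile equation\<close>

text \<open>The shooting data sit at \<open>r = 0\<close>, where the system is singular. For this
  reason the estimates start from limits at 0, and the solutions come from a fixed point of an
  integral operator; the same integral form yields the regularity at the spatial origin that a
  classical solution needs. Shooting in the slope itself would place the harmonic map at infinite
  slope. With the slope fixed and the factor \<open>e\<close> in front of \<open>om\<close> and
  \<open>lam\<close>, it is the ordinary parameter value \<open>e = 0\<close>, and the dependence on
  \<open>e\<close> is Lipschitz on a compact interval. The delicate degree for turning back is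
  \<open>n = 1\<close>: along \<open>2 arctan r\<close> the quantity \<open>r^2 sin^2 h\<close> does
  not decay, and \<open>E\<close> is driven below 0 only because the integral of
  \<open>r sin^2 h\<close> diverges logarithmically. In the necessity part nothing is known about
  the regularity of \<open>h\<close>, so that the system itself has to be recovered from
  \<open>u\<close>.\<close>

lemma at_right_0_ex:
  fixes P :: "real \<Rightarrow> bool"
  assumes "eventually P (at_right 0)"
  obtains d where "0 < d" "\<And>t. 0 < t \<Longrightarrow> t < d \<Longrightarrow> P t"
  using assms unfolding eventually_at_right_field by blast

text \<open>The tool for the continuation arguments from the singular point: at 0 itself nothing is
  required, only a sign to the right of it. Several conditions are followed at once by taking
  \<open>f\<close> to be a minimum of functions.\<close>

lemma first_zero:
  fixes f :: "real \<Rightarrow> real"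
  assumes cont: "\<And>s. 0 < s \<Longrightarrow> s \<le> t \<Longrightarrow> isCont f s"
    and pos: "eventually (\<lambda>s. 0 < f s) (at_right 0)"
    and t: "0 < t" "f t \<le> 0"
  obtains c where "0 < c" "c \<le> t" "f c = 0" "\<And>s. 0 < s \<Longrightarrow> s < c \<Longrightarrow> 0 < f s"
proof -
  obtain d where d: "0 < d" "\<And>s. 0 < s \<Longrightarrow> s < d \<Longrightarrow> 0 < f s"
    using at_right_0_ex[OF pos] by blast
  \<comment> \<open>Starting inside the interval of known positivity makes \<open>Z\<close> compact
    without losing a point where \<open>f\<close> is nonpositive.\<close>
  define a where "a = min (d/2) t"
  have a: "0 < a" "a \<le> t" "a < d" using d t by (auto simp: a_def min_def)
  define Z where "Z = {s\<in>{a..t}. f s \<le> 0}"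
  have contZ: "continuous_on {a..t} f"
    using cont a by (intro continuous_at_imp_continuous_on) auto
  have "closed Z" unfolding Z_def
    by (intro closed_Collect_le continuous_on_closed_Collect_le[OF contZ]) (auto intro: continuous_intros)
  moreover have "bounded Z" unfolding Z_def by (rule bounded_subset[of "{a..t}"]) auto
  ultimately have "compact Z" by (simp add: compact_eq_bounded_closed)
  moreover have "t \<in> Z" using t a by (auto simp: Z_def)
  ultimately obtain c where c: "c \<in> Z" "\<And>s. s \<in> Z \<Longrightarrow> c \<le> s"
    using compact_attains_inf[of Z] by blast
  have c1: "a \<le> c" "c \<le> t" "f c \<le> 0" using c by (auto simp: Z_def)
  have before: "0 < f s" if "0 < s" "s < c" for s
  proof (cases "s < a")
    case True then show ?thesis using d a that by auto
  next
    case False then show ?thesis using c(2)[of s] c1 that unfolding Z_def by force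
  qed
  have "0 \<le> f c"
  proof (rule tendsto_lowerbound)
    show "(f \<longlongrightarrow> f c) (at_left c)"
      using cont[of c] c1 a unfolding isCont_def by (auto intro: filterlim_mono at_le)
    show "eventually (\<lambda>s. 0 \<le> f s) (at_left c)"
      using c1 a unfolding eventually_at_left_field
      by (intro exI[of _ 0]) (auto intro: less_imp_le before)
  qed simp
  then show thesis using that[of c] c1 a before by auto
qed

text \<open>Monotonicity anchored at the open end 0: \<open>f s \<le> f r\<close> holds for all
  small \<open>s\<close> and passes to the limit.\<close>

lemma ge_limit_at_0:
  fixes f :: "real \<Rightarrow> real"
  assumes d: "\<And>t. 0 < t \<Longrightarrow> t < r \<Longrightarrow> \<exists>y. DERIV f t :> y \<and> 0 \<le> y"
    and c: "isCont f r" and r: "0 < r" and l: "(f \<longlongrightarrow> c) (at_right 0)"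
  shows "c \<le> f r"
proof (rule tendsto_upperbound[OF l])
  have ci: "isCont f x" if "0 < x" "x \<le> r" for x
    using that c d[of x] by (cases "x = r") (auto intro: DERIV_isCont)
  show "eventually (\<lambda>s. f s \<le> f r) (at_right 0)"
    unfolding eventually_at_right_field
  proof (intro exI[of _ r] conjI allI impI r)
    fix s assume s: "0 < s" "s < r"
    show "f s \<le> f r"
    proof (rule DERIV_nonneg_imp_increasing_open[of s r f])
      show "continuous_on {s..r} f"
        using s ci by (intro continuous_at_imp_continuous_on) auto
    qed (use s d in auto)
  qed
qed simp

text \<open>The passage to the limit loses strictness; it is regained on
  \<open>{r/2..r}\<close>.\<close>

lemma gt_limit_at_0:
  fixes f :: "real \<Rightarrow> real"
  assumes d: "\<And>t. 0 < t \<Longrightarrow> t < r \<Longrightarrow> \<exists>y. DERIV f t :> y \<and> 0 < y"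
    and c: "isCont f r" and r: "0 < r" and l: "(f \<longlongrightarrow> c) (at_right 0)"
  shows "c < f r"
proof -
  have ci: "isCont f x" if "0 < x" "x \<le> r" for x
    using that c d[of x] by (cases "x = r") (auto intro: DERIV_isCont)
  have "c \<le> f (r/2)"
  proof (rule ge_limit_at_0[OF _ _ _ l])
    fix t assume "0 < t" "t < r/2"
    then show "\<exists>y. DERIV f t :> y \<and> 0 \<le> y" using d[of t] r by (auto intro: less_imp_le)
  qed (use r ci in auto)
  also have "f (r/2) < f r"
  proof (rule DERIV_pos_imp_increasing_open[of "r/2" r f])
    show "continuous_on {r/2..r} f"
      using r ci by (intro continuous_at_imp_continuous_on) auto
  qed (use r d in auto)
  finally show ?thesis .
qed

text \<open>\<open>v\<close> stands for \<open>r h'\<close>. The equation \<open>dv\<close> is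
  demanded only while \<open>0 \<le> h \<le> pi\<close>, because the profiles constructed later
  solve a clipped equation that agrees with the true one only there. Hence the continuity of
  \<open>v\<close> is a separate assumption, and the arguments have to watch the range of
  \<open>h\<close>.\<close>

locale profile =
  fixes n :: nat and lam om :: real and h v :: "real \<Rightarrow> real"
  assumes n: "1 \<le> n"
    and dh: "0 < r \<Longrightarrow> (h has_real_derivative v r / r) (at r)"
    and cv: "0 < r \<Longrightarrow> isCont v r"
    and dv: "0 < r \<Longrightarrow> 0 \<le> h r \<Longrightarrow> h r \<le> pi \<Longrightarrow>
      (v has_real_derivative (real n ^ 2 * sin (h r) * cos (h r) / r
         + r * (om + lam * cos (h r)) * sin (h r))) (at r)"
    and h_0: "(h \<longlongrightarrow> 0) (at_right 0)"
    and v_0: "(v \<longlongrightarrow> 0) (at_right 0)"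
    and h_pos_0: "eventually (\<lambda>r. 0 < h r) (at_right 0)"
begin

definition E :: "real \<Rightarrow> real" where "E r = (v r ^ 2 - real n ^ 2 * sin (h r) ^ 2) / 2"
definition w :: "real \<Rightarrow> real" where "w r = v r - real n * sin (h r)"

lemma ch: "0 < r \<Longrightarrow> isCont h r" using dh by (blast intro: DERIV_isCont)

lemma cE: "0 < r \<Longrightarrow> isCont E r" unfolding E_def by (auto intro!: continuous_intros ch cv)
lemma cw: "0 < r \<Longrightarrow> isCont w r" unfolding w_def by (intro continuous_intros ch cv) 

lemma E_0: "(E \<longlongrightarrow> 0) (at_right 0)"
  unfolding E_def by (rule tendsto_eq_intros h_0 v_0 refl | simp)+
lemma w_0: "(w \<longlongrightarrow> 0) (at_right 0)"
  unfolding w_def by (rule tendsto_eq_intros h_0 v_0 refl | simp)+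

lemma E_w: "E r = w r * (v r + real n * sin (h r)) / 2"
  unfolding E_def w_def by (simp add: algebra_simps power2_eq_square)

lemma dE: assumes "0 < r" "0 \<le> h r" "h r \<le> pi"
  shows "(E has_real_derivative r * (om + lam * cos (h r)) * sin (h r) * v r) (at r)"
  unfolding E_def using assms
  by (auto intro!: derivative_eq_intros dh dv simp: field_simps power2_eq_square)

lemma dw: assumes "0 < r" "0 \<le> h r" "h r \<le> pi"
  shows "(w has_real_derivative (r * (om + lam * cos (h r)) * sin (h r) - real n * cos (h r) * w r / r)) (at r)"
  unfolding w_def using assms
  by (auto intro!: derivative_eq_intros dh dv simp: field_simps power2_eq_square)

text \<open>In the equation of \<open>w\<close> the singular term \<open>- n cos h w / r\<close> has
  the sign of \<open>- w\<close>, which works against the claim. Multiplication by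
  \<open>sin h\<close> completes a square:
  \<open>(w sin h)' = w^2 cos h / r + r (om + lam cos h) sin^2 h\<close>, which is positive while
  \<open>h < pi / 2\<close> and the forcing is positive.\<close>

lemma w_pos_0:
  assumes "0 < om + lam"
  shows "eventually (\<lambda>r. 0 < w r) (at_right 0)"
proof -
  have "((\<lambda>r. om + lam * cos (h r)) \<longlongrightarrow> om + lam * cos 0) (at_right 0)"
    by (intro tendsto_intros h_0)
  then have "eventually (\<lambda>r. 0 < om + lam * cos (h r)) (at_right 0)"
    using assms by (auto dest: order_tendstoD)
  moreover have "eventually (\<lambda>r. h r < pi / 2) (at_right 0)"
    using h_0 by (rule order_tendstoD) auto
  ultimately have "eventually (\<lambda>r. 0 < om + lam * cos (h r) \<and> 0 < h r \<and> h r < pi/2) (at_right 0)"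
    using h_pos_0 by eventually_elim auto
  then obtain d where d: "0 < d" "\<And>t. 0 < t \<Longrightarrow> t < d \<Longrightarrow> 0 < om + lam * cos (h t) \<and> 0 < h t \<and> h t < pi/2"
    using at_right_0_ex by blast
  have "0 < w r" if r: "0 < r" "r < d" for r
  proof -
    have "0 < w r * sin (h r)"
    proof (rule gt_limit_at_0[of r "\<lambda>r. w r * sin (h r)"])
      show "isCont (\<lambda>r. w r * sin (h r)) r" using r by (intro continuous_intros cw ch)
      show "((\<lambda>r. w r * sin (h r)) \<longlongrightarrow> 0) (at_right 0)"
        by (rule tendsto_eq_intros h_0 w_0 refl | simp)+
      fix t assume t: "0 < t" "t < r"
      then have t': "0 < om + lam * cos (h t)" "0 < h t" "h t < pi/2" using d(2)[of t] r by auto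
      then have s: "0 < sin (h t)" "0 < cos (h t)" by (auto intro: sin_gt_zero cos_gt_zero)
      have "((\<lambda>r. w r * sin (h r)) has_real_derivative
         ((t * (om + lam * cos (h t)) * sin (h t) - real n * cos (h t) * w t / t) * sin (h t)
           + cos (h t) * (v t / t) * w t)) (at t)"
        using t t' pi_gt_zero by (auto intro!: derivative_eq_intros dh dw)
      moreover have "(t * (om + lam * cos (h t)) * sin (h t) - real n * cos (h t) * w t / t) * sin (h t)
           + cos (h t) * (v t / t) * w t = w t ^ 2 * cos (h t) / t + t * (om + lam * cos (h t)) * sin (h t) ^ 2"
        unfolding w_def using t by (simp add: field_simps power2_eq_square)
      moreover have "0 < w t ^ 2 * cos (h t) / t + t * (om + lam * cos (h t)) * sin (h t) ^ 2"
        using t t' s by (intro add_nonneg_pos) auto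
      ultimately show "\<exists>y. ((\<lambda>r. w r * sin (h r)) has_real_derivative y) (at t) \<and> 0 < y" by metis
    qed (use r in auto)
    moreover have "0 < sin (h r)" using d(2)[of r] r by (intro sin_gt_zero) auto
    ultimately show ?thesis by (simp add: zero_less_mult_iff)
  qed
  then show ?thesis unfolding eventually_at_right_field using d(1) by blast
qed

text \<open>Multiplying the equation of \<open>w\<close> by \<open>r ^ n\<close> replaces the coefficient \<open>cos h\<close> by \<open>cos h - 1\<close>, whose
  sign is known.\<close>

lemma w_pos:
  assumes lo: "0 < om + lam" and r: "0 < r"
    and reg: "\<And>t. 0 < t \<Longrightarrow> t \<le> r \<Longrightarrow> 0 \<le> h t \<and> h t \<le> pi \<and> 0 \<le> om + lam * cos (h t)"
  shows "0 < w r"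
proof (rule ccontr)
  assume "\<not> 0 < w r"
  then obtain c where c: "0 < c" "c \<le> r" "w c = 0" "\<And>s. 0 < s \<Longrightarrow> s < c \<Longrightarrow> 0 < w s"
    using first_zero[of r w] cw w_pos_0[OF lo] r by (metis not_less)
  have "c / 2 < c" using c by simp
  have "(c/2)^n * w (c/2) \<le> c^n * w c"
  proof (rule DERIV_nonneg_imp_increasing_open[where f = "\<lambda>r. r^n * w r"])
    show "continuous_on {c/2..c} (\<lambda>r. r^n * w r)"
      using c by (intro continuous_at_imp_continuous_on) (auto intro!: continuous_intros cw)
    fix t assume t: "c/2 < t" "t < c"
    then have t': "0 < t" "t \<le> r" "0 < w t" using c by auto
    note R = reg[OF t'(1,2)]
    have "((\<lambda>r. r^n * w r) has_real_derivative
       (real n * t^(n-1) * w t + t^n * (t * (om + lam * cos (h t)) * sin (h t) - real n * cos (h t) * w t / t))) (at t)"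
      using t' R by (auto intro!: derivative_eq_intros dw)
    moreover have "real n * t^(n-1) * w t + t^n * (t * (om + lam * cos (h t)) * sin (h t) - real n * cos (h t) * w t / t)
      = t^n * (real n * (1 - cos (h t)) * w t / t + t * (om + lam * cos (h t)) * sin (h t))"
    proof -
      have "t^n = t * t^(n-1)" using n by (cases n) auto
      then show ?thesis using t' by (simp add: field_simps)
    qed
    moreover have "0 \<le> t^n * (real n * (1 - cos (h t)) * w t / t + t * (om + lam * cos (h t)) * sin (h t))"
    proof -
      have "0 \<le> sin (h t)" using R by (auto intro: sin_ge_zero)
      then show ?thesis using t' R by (auto intro!: mult_nonneg_nonneg[OF zero_le_power] add_nonneg_nonneg mult_nonneg_nonneg[of "t * _"])
    qed
    ultimately show "\<exists>y. ((\<lambda>r. r^n * w r) has_real_derivative y) (at t) \<and> 0 \<le> y" by metis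
  qed (use c in auto)
  moreover have "0 < (c/2)^n * w (c/2)" using c by auto
  ultimately show False using c by simp
qed

end


section \<open>Monotone profiles: turning points, contact with the level \<open>pi\<close>, the
  limit at infinity\<close>

context profile
begin

lemma h_mono:
  assumes "0 < s" "s \<le> t" "\<And>x. s < x \<Longrightarrow> x < t \<Longrightarrow> 0 \<le> v x"
  shows "h s \<le> h t"
proof (rule DERIV_nonneg_imp_increasing_open[of s t h])
  show "continuous_on {s..t} h"
    using assms(1) by (intro continuous_at_imp_continuous_on) (auto intro: ch)
  fix x assume x: "s < x" "x < t"
  then show "\<exists>y. (h has_real_derivative y) (at x) \<and> 0 \<le> y"
    using dh[of x] assms by (intro exI[of _ "v x / x"]) auto
qed (use assms in auto)

text \<open>At a turning point \<open>w = - n sin h < 0\<close>, so the criterion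
  \<open>w_pos\<close> must fail. Since \<open>h\<close> has increased up to \<open>r\<close>, the
  forcing is smallest there, and it is at \<open>r\<close> that its sign must have been
  lost.\<close>

lemma turn:
  assumes lam: "0 < lam" and om: "0 < om" and r: "0 < r"
    and reg: "\<And>t. 0 < t \<Longrightarrow> t < r \<Longrightarrow> 0 < h t \<and> h t < pi \<and> 0 \<le> v t"
    and hr: "0 < h r" "h r < pi" "v r = 0"
  shows "om + lam * cos (h r) < 0"
proof (rule ccontr)
  assume "\<not> om + lam * cos (h r) < 0"
  then have fr: "0 \<le> om + lam * cos (h r)" by simp
  have "0 < w r"
  proof (rule w_pos)
    fix t assume t: "0 < t" "t \<le> r"
    have ht: "0 < h t" "h t \<le> pi" "h t \<le> h r"
      using t reg[of t] hr h_mono[of t r] reg by (cases "t = r"; fastforce)+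
    then have "lam * cos (h r) \<le> lam * cos (h t)"
      using lam hr by (intro mult_left_mono) (auto intro: cos_monotone_0_pi_le)
    then show "0 \<le> h t \<and> h t \<le> pi \<and> 0 \<le> om + lam * cos (h t)" using fr ht by auto
  qed (use lam om r in auto)
  moreover have "0 < sin (h r)" using hr by (auto intro: sin_gt_zero)
  ultimately show False using hr unfolding w_def by (simp add: mult_less_0_iff)
qed

text \<open>At an interior zero of \<open>v\<close>, \<open>turn\<close> makes the forcing negative
  and with it \<open>cos h\<close>. Both terms of \<open>v'\<close> are then negative, and
  \<open>v\<close> would be negative right afterwards.\<close>

lemma v_strict:
  assumes lam: "0 < lam" and om: "0 < om"
    and reg: "\<And>t. 0 < t \<Longrightarrow> t < r \<Longrightarrow> 0 < h t \<and> h t < pi \<and> 0 \<le> v t"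
    and t: "0 < t" "t < r"
  shows "0 < v t"
proof (rule ccontr)
  assume "\<not> 0 < v t"
  then have v0: "v t = 0" using reg[OF t] by auto
  note R = reg[OF t]
  have f: "om + lam * cos (h t) < 0"
    using reg t v0 by (intro turn[OF lam om]) auto
  then have "lam * cos (h t) < 0" using om by linarith
  then have c: "cos (h t) < 0" using lam by (simp add: mult_less_0_iff)
  have s: "0 < sin (h t)" using R by (auto intro: sin_gt_zero)
  have "real n ^ 2 * sin (h t) * cos (h t) / t + t * (om + lam * cos (h t)) * sin (h t) < 0"
    using c s t f n by (intro add_neg_neg) (auto simp: mult_less_0_iff divide_less_0_iff zero_less_mult_iff)
  from DERIV_neg_dec_right[OF dv this] R t obtain d where d: "0 < d" "\<And>x. 0 < x \<Longrightarrow> x < d \<Longrightarrow> v (t + x) < v t"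
    by auto
  define x where "x = min d (r - t) / 2"
  have "0 < x" "x < d" "t + x < r" using d(1) t by (auto simp: x_def min_def field_simps)
  then show False using d(2)[of x] reg[of "t + x"] t v0 by auto
qed

text \<open>Otherwise \<open>h\<close> and the constant solution \<open>pi\<close> would agree to first order at \<open>r\<close>.\<close>

lemma hits_pi_transversally:
  assumes r: "0 < r"
    and reg: "\<And>t. 0 < t \<Longrightarrow> t < r \<Longrightarrow> 0 < h t \<and> h t < pi \<and> 0 \<le> v t"
    and hr: "h r = pi"
  shows "0 < v r"
proof (rule ccontr)
  assume a: "\<not> 0 < v r"
  have "0 \<le> v r"
  proof (rule tendsto_lowerbound)
    show "(v \<longlongrightarrow> v r) (at_left r)"
      using cv[of r] r unfolding isCont_def by (auto intro: filterlim_mono at_le)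
    show "eventually (\<lambda>s. 0 \<le> v s) (at_left r)"
      using r reg unfolding eventually_at_left_field by (intro exI[of _ 0]) auto
  qed simp
  with a have vr: "v r = 0" by simp
  \<comment> \<open>Gronwall's argument run backwards from \<open>r\<close>: on
    \<open>{r/2..r}\<close> one has \<open>1 / t \<le> 2 / r\<close> and
    \<open>sin h \<le> pi - h\<close>, so the right-hand sides are bounded linearly by
    \<open>(pi - h, v)\<close>. With this \<open>C\<close> the weighted sum of squares
    \<open>\<Phi>\<close> is nondecreasing, and its zero at \<open>r\<close> would force a zero at
    \<open>r/2\<close>.\<close>
  define C where "C = 2 * (1/(r/2) + real n ^ 2 / (r/2) + r * (\<bar>om\<bar> + \<bar>lam\<bar>))"
  define \<Phi> where "\<Phi> t = ((pi - h t)^2 + v t ^ 2) * exp (C * t)" for t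
  have "\<Phi> (r/2) \<le> \<Phi> r"
  proof (rule DERIV_nonneg_imp_increasing_open[of "r/2" r \<Phi>])
    show "continuous_on {r/2..r} \<Phi>"
      unfolding \<Phi>_def using r by (intro continuous_at_imp_continuous_on) (auto intro!: continuous_intros ch cv)
    fix t assume t: "r/2 < t" "t < r"
    then have t0: "0 < t" using r by auto
    note R = reg[OF t0 t(2)]
    define v' where "v' = real n ^ 2 * sin (h t) * cos (h t) / t + t * (om + lam * cos (h t)) * sin (h t)"
    define g where "g = pi - h t"
    have g: "0 < g" using R by (simp add: g_def)
    have "(\<Phi> has_real_derivative (exp (C*t) * (C * (g^2 + v t^2) - 2 * g * (v t / t) + 2 * v t * v'))) (at t)"
      unfolding \<Phi>_def g_def using t0 R
      by (auto intro!: derivative_eq_intros dh dv simp: v'_def field_simps)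
    moreover have "0 \<le> exp (C*t) * (C * (g^2 + v t^2) - 2 * g * (v t / t) + 2 * v t * v')"
    proof -
      have it: "1 / t \<le> 1/(r/2)" using t r by (intro divide_left_mono) auto
      have s: "0 \<le> sin (h t)" "sin (h t) \<le> g"
        using R sin_x_le_x[of g] g by (auto simp: g_def intro: sin_ge_zero)
      have "\<bar>v'\<bar> \<le> (real n ^ 2 / (r/2) + r * (\<bar>om\<bar> + \<bar>lam\<bar>)) * sin (h t)"
      proof -
        have "v' = (real n ^ 2 * (1/t) * cos (h t) + t * (om + lam * cos (h t))) * sin (h t)"
          by (simp add: v'_def algebra_simps)
        then have "\<bar>v'\<bar> = \<bar>real n ^ 2 * (1/t) * cos (h t) + t * (om + lam * cos (h t))\<bar> * sin (h t)"
          using s by (simp add: abs_mult)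
        also have "\<dots> \<le> (real n ^ 2 * (1/(r/2)) + r * (\<bar>om\<bar> + \<bar>lam\<bar>)) * sin (h t)"
        proof (intro mult_right_mono s order_trans[OF abs_triangle_ineq] add_mono)
          show "\<bar>real n ^ 2 * (1/t) * cos (h t)\<bar> \<le> real n ^ 2 * (1/(r/2))"
          proof -
            have "(1/t) * \<bar>cos (h t)\<bar> \<le> (1/(r/2)) * 1" using it t0 r by (intro mult_mono) auto
            then have "real n ^ 2 * ((1/t) * \<bar>cos (h t)\<bar>) \<le> real n ^ 2 * (1/(r/2))"
              by (intro mult_left_mono) auto
            then show ?thesis using t0 by (simp add: abs_mult)
          qed
          have "\<bar>om + lam * cos (h t)\<bar> \<le> \<bar>om\<bar> + \<bar>lam\<bar>"
            by (intro order_trans[OF abs_triangle_ineq] add_mono) (auto simp: abs_mult mult_left_le)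
          then show "\<bar>t * (om + lam * cos (h t))\<bar> \<le> r * (\<bar>om\<bar> + \<bar>lam\<bar>)"
            using t t0 unfolding abs_mult by (intro mult_mono) auto
        qed
        finally show ?thesis by simp
      qed
      also have "\<dots> \<le> (real n ^ 2 / (r/2) + r * (\<bar>om\<bar> + \<bar>lam\<bar>)) * g"
        using s r by (intro mult_left_mono) auto
      finally have v': "\<bar>v'\<bar> \<le> (real n ^ 2 / (r/2) + r * (\<bar>om\<bar> + \<bar>lam\<bar>)) * g" .
      define a b where "a = 1/(r/2)" and "b = real n ^ 2 / (r/2) + r * (\<bar>om\<bar> + \<bar>lam\<bar>)"
      have ab: "0 \<le> a" "0 \<le> b" "C = 2 * (a + b)" using r by (auto simp: a_def b_def C_def)
      have p: "2 * \<bar>g * v t\<bar> \<le> g^2 + v t^2"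
        using sum_squares_bound[of g "v t"] sum_squares_bound[of "-g" "v t"] by (auto simp: abs_if)
      have 1: "2 * g * (v t / t) \<le> a * (g^2 + v t^2)"
      proof -
        have "2 * g * (v t / t) = (1/t) * (2 * (g * v t))" by simp
        also have "\<dots> \<le> a * (2 * \<bar>g * v t\<bar>)"
          using it R g t0 r unfolding a_def by (intro mult_mono) auto
        also have "\<dots> \<le> a * (g^2 + v t^2)" using p ab by (intro mult_left_mono) auto
        finally show ?thesis .
      qed
      have 2: "- (b * (g^2 + v t^2)) \<le> 2 * v t * v'"
      proof -
        have "\<bar>2 * v t * v'\<bar> = 2 * \<bar>v t\<bar> * \<bar>v'\<bar>" by (simp add: abs_mult)
        also have "\<dots> \<le> 2 * \<bar>v t\<bar> * (b * g)" using v' unfolding b_def by (intro mult_left_mono) auto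
        also have "\<dots> = b * (2 * \<bar>g * v t\<bar>)" using g by (simp add: abs_mult)
        also have "\<dots> \<le> b * (g^2 + v t^2)" using p ab by (intro mult_left_mono) auto
        finally show ?thesis by linarith
      qed
      have "0 \<le> (a + b) * (g^2 + v t^2)" using ab by (intro mult_nonneg_nonneg add_nonneg_nonneg) auto
      then have "0 \<le> C * (g^2 + v t^2) - 2 * g * (v t / t) + 2 * v t * v'"
        using 1 2 unfolding ab(3) by (simp add: algebra_simps)
      then show ?thesis by simp
    qed
    ultimately show "\<exists>y. (\<Phi> has_real_derivative y) (at t) \<and> 0 \<le> y" by blast
  qed (use r in auto)
  moreover have "\<Phi> r = 0" using hr vr by (simp add: \<Phi>_def)
  moreover have "0 < \<Phi> (r/2)"
    using reg[of "r/2"] r unfolding \<Phi>_def by (intro mult_pos_pos add_pos_nonneg) auto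
  ultimately show False by simp
qed

lemma no_log_growth:
  assumes r0: "0 < r0" "0 \<le> h r0" and c: "0 < c"
    and v: "\<And>t. r0 \<le> t \<Longrightarrow> c \<le> v t" and hp: "\<And>t. r0 \<le> t \<Longrightarrow> h t \<le> pi"
  shows False
proof -
  \<comment> \<open>At this radius \<open>c ln\<close> has grown by \<open>pi + 1\<close>, more than
    the range of \<open>h\<close> allows.\<close>
  define t where "t = r0 * exp ((pi + 1) / c)"
  have "1 \<le> exp ((pi + 1) / c)" using c pi_gt_zero by auto
  then have t: "r0 \<le> t" using r0 by (simp add: t_def)
  have "h r0 - c * ln r0 \<le> h t - c * ln t"
  proof (rule DERIV_nonneg_imp_nondecreasing[OF t])
    fix x assume x: "r0 \<le> x" "x \<le> t"
    have "((\<lambda>x. h x - c * ln x) has_real_derivative (v x - c) / x) (at x)"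
      using x r0 by (auto intro!: derivative_eq_intros dh simp: field_simps)
    moreover have "0 \<le> (v x - c) / x" using v[OF x(1)] x r0 by auto
    ultimately show "\<exists>y. ((\<lambda>x. h x - c * ln x) has_real_derivative y) (at x) \<and> 0 \<le> y" by blast
  qed
  moreover have "ln t = ln r0 + (pi + 1) / c" using r0 by (simp add: t_def ln_mult)
  then have "c * ln t = c * ln r0 + pi + 1" using c by (simp add: field_simps)
  ultimately show False using hp[OF t] r0 by linarith
qed

text \<open>The monotone bounded \<open>h\<close> has a limit \<open>L\<close>, and
  \<open>L < pi\<close> has to be excluded. If the forcing at \<open>L\<close> is nonnegative,
  \<open>w\<close> stays positive and \<open>v\<close> is bounded below, which forces logarithmic
  growth. If it is negative, \<open>v'\<close> is eventually below a negative constant and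
  \<open>v\<close> changes sign.\<close>

lemma tends_to_pi:
  assumes lam: "0 < lam" and om: "0 < om"
    and reg: "\<And>t. 0 < t \<Longrightarrow> 0 < h t \<and> h t < pi \<and> 0 \<le> v t"
  shows "(h \<longlongrightarrow> pi) at_top"
proof -
  define L where "L = (SUP t\<in>{0<..}. h t)"
  have bdd: "bdd_above (h ` {0<..})" using reg by (auto intro!: bdd_aboveI2[of _ _ pi] less_imp_le)
  have hL: "h t \<le> L" if "0 < t" for t
    unfolding L_def using that bdd by (intro cSUP_upper) auto
  have Lpi: "L \<le> pi" unfolding L_def using reg by (intro cSUP_least) (auto intro: less_imp_le)
  have mono: "h s \<le> h t" if "0 < s" "s \<le> t" for s t
    using that reg by (intro h_mono) auto
  have lim: "(h \<longlongrightarrow> L) at_top"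
  proof (rule order_tendstoI)
    fix a assume "a < L"
    then obtain s where s: "0 < s" "a < h s"
      unfolding L_def using less_cSUP_iff[OF _ bdd] by auto
    show "eventually (\<lambda>t. a < h t) at_top"
      unfolding eventually_at_top_linorder using s mono by (intro exI[of _ s]) (auto intro: less_le_trans)
  next
    fix a assume "L < a"
    then show "eventually (\<lambda>t. h t < a) at_top"
      unfolding eventually_at_top_linorder
    proof (intro exI[of _ 1] allI impI)
      fix t :: real assume "1 \<le> t"
      then have "h t \<le> L" by (intro hL) auto
      then show "h t < a" using \<open>L < a\<close> by simp
    qed
  qed
  have "L = pi"
  proof (rule ccontr)
    assume "L \<noteq> pi"
    then have Lp: "L < pi" using Lpi by simp
    have h1: "0 < h 1" "h 1 \<le> L" using reg[of 1] hL[of 1] by auto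
    then have sL: "0 < sin L" "0 < sin (h 1)" using Lp by (auto intro!: sin_gt_zero)
    show False
    proof (cases "0 \<le> om + lam * cos L")
      case True
      \<comment> \<open>On an interval inside \<open>[0, pi]\<close> the sine is at least the
        smaller of its two end values.\<close>
      define c where "c = min (sin (h 1)) (sin L)"
      have "c \<le> v t" if t: "1 \<le> t" for t
      proof -
        have ht: "h 1 \<le> h t" "h t \<le> L" using mono[of 1 t] hL[of t] t by auto
        have "c \<le> sin (h t)"
        proof (cases "h t \<le> pi/2")
          case True
          then have "sin (h 1) \<le> sin (h t)" using ht h1 by (intro sin_monotone_2pi_le) auto
          then show ?thesis by (simp add: c_def)
        next
          case False
          then have "sin (pi - L) \<le> sin (pi - h t)" using ht h1 Lp by (intro sin_monotone_2pi_le) auto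
          then show ?thesis by (simp add: c_def)
        qed
        also have "\<dots> \<le> real n * sin (h t)"
          using mult_right_mono[of 1 "real n" "sin (h t)"] n reg[of t] t sin_ge_zero[of "h t"] by auto
        also have "\<dots> \<le> v t"
        proof -
          have "0 < w t"
          proof (rule w_pos)
            fix s assume s: "0 < s" "s \<le> t"
            have "lam * cos L \<le> lam * cos (h s)"
              using lam hL[of s] reg[of s] Lp s by (intro mult_left_mono) (auto intro!: cos_monotone_0_pi_le)
            then show "0 \<le> h s \<and> h s \<le> pi \<and> 0 \<le> om + lam * cos (h s)" using True reg[of s] s by auto
          qed (use t lam om in auto)
          then show ?thesis by (simp add: w_def)
        qed
        finally show ?thesis .
      qed
      moreover have "0 < c" using sL by (simp add: c_def)
      ultimately show False
        using h1 reg by (intro no_log_growth[of 1 c]) (auto intro: less_imp_le)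
    next
      case False
      define f where "f = om + lam * cos L"
      have f: "f < 0" using False by (simp add: f_def)
      have "lam * cos L < 0" using f om unfolding f_def by linarith
      then have cL: "cos L < 0" using lam by (simp add: mult_less_0_iff)
      have "((\<lambda>t. om + lam * cos (h t)) \<longlongrightarrow> f) at_top" unfolding f_def by (intro tendsto_intros lim)
      then have 1: "eventually (\<lambda>t. om + lam * cos (h t) < f / 2) at_top"
        using f by (intro order_tendstoD) auto
      have "((\<lambda>t. cos (h t)) \<longlongrightarrow> cos L) at_top" by (intro tendsto_intros lim)
      then have 2: "eventually (\<lambda>t. cos (h t) < 0) at_top" using cL by (intro order_tendstoD) auto
      have "((\<lambda>t. sin (h t)) \<longlongrightarrow> sin L) at_top" by (intro tendsto_intros lim)
      then have 3: "eventually (\<lambda>t. sin L / 2 < sin (h t)) at_top" using sL by (intro order_tendstoD) auto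
      from 1 2 3 have "eventually (\<lambda>t. om + lam * cos (h t) < f / 2 \<and> cos (h t) < 0 \<and> sin L / 2 < sin (h t)) at_top"
        by eventually_elim auto
      then obtain r1 where r1: "\<And>t. r1 \<le> t \<Longrightarrow> om + lam * cos (h t) < f / 2 \<and> cos (h t) < 0 \<and> sin L / 2 < sin (h t)"
        unfolding eventually_at_top_linorder by blast
      define r0 where "r0 = max 1 r1"
      \<comment> \<open>\<open>d\<close> bounds the rate at which \<open>v\<close> decreases beyond
        \<open>r0\<close>, using \<open>r0 \<ge> 1\<close>. The point \<open>t\<close> below is
        where the line of slope \<open>- d\<close> through \<open>(r0, v r0)\<close> reaches
        -1.\<close>
      define d where "d = - f / 2 * (sin L / 2)"
      have d: "0 < d" using f sL unfolding d_def by (intro mult_pos_pos) auto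
      define t where "t = r0 + (v r0 + 1) / d"
      have r0: "0 < r0" "1 \<le> r0" "r1 \<le> r0" by (auto simp: r0_def)
      have t: "r0 \<le> t" using reg[of r0] r0 d by (auto simp: t_def)
      have "v r0 + d * r0 \<ge> v t + d * t"
      proof (rule DERIV_nonpos_imp_nonincreasing[OF t])
        fix x assume x: "r0 \<le> x" "x \<le> t"
        then have x1: "1 \<le> x" "0 < x" using r0 by auto
        have P: "om + lam * cos (h x) < f / 2" "cos (h x) < 0" "sin L / 2 < sin (h x)" using r1[of x] x r0 by auto
        have "((\<lambda>x. v x + d * x) has_real_derivative
          (real n ^ 2 * sin (h x) * cos (h x) / x + x * (om + lam * cos (h x)) * sin (h x)) + d) (at x)"
          using x1 reg[of x] by (auto intro!: derivative_eq_intros dv)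
        moreover have "(real n ^ 2 * sin (h x) * cos (h x) / x + x * (om + lam * cos (h x)) * sin (h x)) + d \<le> 0"
        proof -
          have "real n ^ 2 * sin (h x) * cos (h x) / x \<le> 0"
            using P x1 sL by (intro divide_nonpos_pos mult_nonneg_nonpos mult_nonneg_nonneg) auto
          moreover have "d \<le> x * (- (om + lam * cos (h x))) * sin (h x)"
          proof -
            have "1 * (- f / 2) * (sin L / 2) \<le> x * (- (om + lam * cos (h x))) * sin (h x)"
              using P x1 sL f by (intro mult_mono mult_nonneg_nonneg) auto
            then show ?thesis by (simp add: d_def)
          qed
          ultimately show ?thesis by (simp add: algebra_simps)
        qed
        ultimately show "\<exists>y. ((\<lambda>x. v x + d * x) has_real_derivative y) (at x) \<and> y \<le> 0" by blast
      qed
      moreover have "d * t = d * r0 + v r0 + 1" using d by (simp add: t_def field_simps)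
      ultimately have "v t < 0" by simp
      then show False using reg[of t] t r0 by auto
    qed
  qed
  then show ?thesis using lim by simp
qed

end

section \<open>Energy arguments: turning back, and nonexistence for the other values of
  \<open>om\<close>\<close>

context profile
begin

lemma v_pos_0:
  assumes "0 < om + lam"
  shows "eventually (\<lambda>r. 0 < v r) (at_right 0)"
proof -
  have "eventually (\<lambda>r. h r < pi) (at_right 0)"
    using h_0 by (rule order_tendstoD) auto
  then show ?thesis
    using w_pos_0[OF assms] h_pos_0
  proof eventually_elim
    case (elim r)
    then have "0 \<le> real n * sin (h r)" by (intro mult_nonneg_nonneg sin_ge_zero) auto
    then show ?case using elim unfolding w_def by simp
  qed
qed

text \<open>Once the forcing \<open>om + lam cos h\<close> is nonpositive, \<open>E\<close> decreases as long as \<open>h\<close> increases, whereas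
  \<open>E = v^2 / 2\<close> at the level \<open>pi\<close> and \<open>E\<close> has a nonnegative limit if \<open>h\<close> tends to \<open>pi\<close>.\<close>

lemma turns_back:
  assumes lam: "0 < lam" and om: "0 < om" and r0: "0 < r0"
    and hr: "\<And>t. 0 < t \<Longrightarrow> t \<le> r0 \<Longrightarrow> 0 < h t \<and> h t < pi"
    and Er: "E r0 < 0" and fr: "om + lam * cos (h r0) \<le> 0"
  shows "\<exists>r>0. v r < 0 \<and> (\<forall>t. 0 < t \<longrightarrow> t \<le> r \<longrightarrow> h t < pi)"
proof (rule ccontr)
  assume "\<not> ?thesis"
  then have nt: "0 \<le> v r" if "0 < r" "\<And>t. 0 < t \<Longrightarrow> t \<le> r \<Longrightarrow> h t < pi" for r
    using that by (meson not_less)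
  have inc: "E r \<le> E r0" if "r0 \<le> r" and reg: "\<And>t. 0 < t \<Longrightarrow> t < r \<Longrightarrow> 0 < h t \<and> h t < pi \<and> 0 \<le> v t" for r
  proof -
    have "- E r0 \<le> - E r"
    proof (rule DERIV_nonneg_imp_increasing_open[of r0 r "\<lambda>r. - E r"])
      show "continuous_on {r0..r} (\<lambda>r. - E r)"
        using r0 by (intro continuous_at_imp_continuous_on) (auto intro!: continuous_intros cE)
      fix t assume t: "r0 < t" "t < r"
      then have R: "0 < t" "0 < h t" "h t < pi" "0 \<le> v t" using reg[of t] r0 by auto
      have "h r0 \<le> h t" using t r0 reg by (intro h_mono) auto
      then have "lam * cos (h t) \<le> lam * cos (h r0)"
        using lam hr[of r0] r0 R by (intro mult_left_mono) (auto intro!: cos_monotone_0_pi_le)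
      then have f: "om + lam * cos (h t) \<le> 0" using fr by simp
      have s: "0 \<le> sin (h t)" using R by (intro sin_ge_zero) auto
      have "((\<lambda>r. - E r) has_real_derivative - (t * (om + lam * cos (h t)) * sin (h t) * v t)) (at t)"
        using R by (intro DERIV_minus dE) auto
      moreover have "t * (om + lam * cos (h t)) * sin (h t) * v t \<le> 0"
        using R s f by (intro mult_nonpos_nonneg mult_nonneg_nonpos) auto
      ultimately show "\<exists>y. ((\<lambda>r. - E r) has_real_derivative y) (at t) \<and> 0 \<le> y"
        by (intro exI conjI) auto
    qed (use that in auto)
    then show ?thesis by simp
  qed
  have hp: "0 < h r" if reg: "\<And>t. 0 < t \<Longrightarrow> t < r \<Longrightarrow> h t < pi" and r: "0 < r" for r
  proof (cases "r \<le> r0")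
    case True then show ?thesis using hr r by auto
  next
    case False
    then have "h r0 \<le> h r" using r0 reg by (intro h_mono nt) auto
    then show ?thesis using hr[of r0] r0 by auto
  qed
  show False
  proof (cases "\<forall>t>0. h t < pi")
    case True
    then have reg: "0 < h t \<and> h t < pi \<and> 0 \<le> v t" if "0 < t" for t
      using nt[of t] hp[of t] that by auto
    have "(h \<longlongrightarrow> pi) at_top" using reg by (intro tends_to_pi lam om) auto
    then have "((\<lambda>t. - (real n ^ 2 * sin (h t) ^ 2 / 2)) \<longlongrightarrow> - (real n ^ 2 * sin pi ^ 2 / 2)) at_top"
      by (intro tendsto_intros) auto
    then have "eventually (\<lambda>t. E r0 < - (real n ^ 2 * sin (h t) ^ 2 / 2)) at_top"
      using Er by (intro order_tendstoD(1)) auto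
    then have "eventually (\<lambda>t. E r0 < - (real n ^ 2 * sin (h t) ^ 2 / 2) \<and> r0 \<le> t) at_top"
      using eventually_ge_at_top by eventually_elim auto
    then obtain t where t: "E r0 < - (real n ^ 2 * sin (h t) ^ 2 / 2)" "r0 \<le> t"
      by (metis (no_types, lifting) eventually_at_top_linorder order_refl)
    have "E t \<le> E r0" using t reg by (intro inc) auto
    moreover have "- (real n ^ 2 * sin (h t) ^ 2 / 2) \<le> E t" unfolding E_def by (simp add: field_simps)
    ultimately show False using t by simp
  next
    case False
    then obtain t where t: "0 < t" "pi \<le> h t" by (auto simp: not_less)
    have "eventually (\<lambda>r. 0 < pi - h r) (at_right 0)"
      using h_0 pi_gt_zero by (simp add: order_tendstoD)
    then obtain c where c: "0 < c" "c \<le> t" "pi - h c = 0" "\<And>s. 0 < s \<Longrightarrow> s < c \<Longrightarrow> 0 < pi - h s"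
      using first_zero[of t "\<lambda>r. pi - h r"] t ch by (auto intro: continuous_intros)
    have reg: "0 < h s \<and> h s < pi \<and> 0 \<le> v s" if "0 < s" "s < c" for s
      using c(4)[of s] that hp[of s] nt[of s] c(4) by force
    have "r0 < c" using hr[of c] c by force
    then have "E c \<le> E r0" using reg by (intro inc) auto
    moreover have "0 \<le> E c" using c by (simp add: E_def)
    ultimately show False using Er by simp
  qed
qed

text \<open>The derivative of the subtracted term cancels the \<open>lam\<close> part of
  \<open>E'\<close>, namely \<open>lam r cos h sin h v\<close>; of the subtracted term only
  \<open>- lam r sin^2 h\<close> remains.\<close>

lemma d_reduced_energy:
  assumes "0 < r" "0 \<le> h r" "h r \<le> pi"
  shows "((\<lambda>r. E r - lam / 2 * r^2 * sin (h r)^2) has_real_derivative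
    r * (sin (h r) * (om * v r - lam * sin (h r)))) (at r)"
  by (rule DERIV_cong, (rule derivative_intros dE dh assms)+)
    (use assms in \<open>simp add: field_simps power2_eq_square\<close>)

lemma no_solution_above:
  assumes lam: "0 < lam" and om: "lam \<le> real n * om"
    and reg: "\<And>t. 0 < t \<Longrightarrow> 0 < h t \<and> h t < pi"
  shows False
proof -
  have om0: "0 < om" using lam om n by (metis less_le_trans mult_nonneg_nonpos not_less of_nat_0_le_iff)
  define Z where "Z r = E r - lam / 2 * r^2 * sin (h r)^2" for r
  have dZ: "\<exists>y. (Z has_real_derivative y) (at t) \<and> 0 < y" if t: "0 < t" and w: "0 < w t" for t
  proof (intro exI conjI)
    have s: "0 < sin (h t)" using reg[OF t] by (auto intro: sin_gt_zero)
    show "(Z has_real_derivative t * (sin (h t) * (om * v t - lam * sin (h t)))) (at t)"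
      unfolding Z_def using reg[OF t] t by (intro d_reduced_energy) auto
    \<comment> \<open>Here \<open>lam \<le> n om\<close> enters: writing
      \<open>v = w + n sin h\<close> splits the factor into a positive and a nonnegative
      term.\<close>
    have "om * v t - lam * sin (h t) = om * w t + (real n * om - lam) * sin (h t)"
      unfolding w_def by (simp add: algebra_simps)
    also have "0 < \<dots>" using s om om0 w by (intro add_pos_nonneg mult_nonneg_nonneg) auto
    finally show "0 < t * (sin (h t) * (om * v t - lam * sin (h t)))" using t s by simp
  qed
  have Zpos: "0 < Z r" if r: "0 < r" and wp: "\<And>t. 0 < t \<Longrightarrow> t < r \<Longrightarrow> 0 < w t" for r
  proof (rule gt_limit_at_0[of r Z])
    show "isCont Z r" unfolding Z_def using r by (auto intro!: continuous_intros cE ch)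
    show "(Z \<longlongrightarrow> 0) (at_right 0)"
      unfolding Z_def by (rule tendsto_eq_intros E_0 h_0 refl | simp)+
    fix t assume t: "0 < t" "t < r"
    show "\<exists>y. (Z has_real_derivative y) (at t) \<and> 0 < y" using dZ[OF t(1) wp[OF t]] .
  qed (use r in auto)
  \<comment> \<open>\<open>Z\<close> is known to increase only while \<open>w > 0\<close>. At the
    first zero of \<open>w\<close> also \<open>E = 0\<close>, hence \<open>Z \<le> 0\<close>,
    although \<open>Z\<close> has increased from 0 up to there.\<close>
  have wpos: "0 < w r" if r: "0 < r" for r
  proof (rule ccontr)
    assume "\<not> 0 < w r"
    then obtain c where c: "0 < c" "w c = 0" "\<And>s. 0 < s \<Longrightarrow> s < c \<Longrightarrow> 0 < w s"
      using first_zero[of r w] cw w_pos_0 lam om0 r by (metis add_pos_pos not_less)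
    have "0 < Z c" using c by (intro Zpos) auto
    moreover have "Z c \<le> 0" using c lam unfolding Z_def E_w by simp
    ultimately show False by simp
  qed
  have Zmono: "Z 1 \<le> Z r" if "1 \<le> r" for r
  proof (rule DERIV_nonneg_imp_nondecreasing[OF that])
    fix t :: real assume t: "1 \<le> t" "t \<le> r"
    then show "\<exists>y. (Z has_real_derivative y) (at t) \<and> 0 \<le> y"
      using dZ[of t] wpos[of t] by (auto intro: less_imp_le)
  qed
  have Z1: "0 < Z 1" by (intro Zpos wpos) auto
  \<comment> \<open>From \<open>Z 1 \<le> E \<le> v^2 / 2\<close>.\<close>
  define c where "c = sqrt (2 * Z 1)"
  have "c \<le> v r" if r: "1 \<le> r" for r
  proof (rule power2_le_imp_le)
    have "0 \<le> sin (h r)" using reg[of r] r by (intro sin_ge_zero) auto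
    then have "0 \<le> real n * sin (h r)" by simp
    then show "0 \<le> v r" using wpos[of r] r unfolding w_def by simp
    have "Z 1 \<le> E r"
    proof -
      have "0 \<le> lam / 2 * r^2 * sin (h r)^2" using lam by simp
      then show ?thesis using Zmono[OF r] by (simp add: Z_def)
    qed
    also have "\<dots> \<le> v r ^ 2 / 2" unfolding E_def by (simp add: divide_right_mono)
    finally show "c ^ 2 \<le> v r ^ 2" using Z1 by (simp add: c_def)
  qed
  then show False
    using Z1 reg by (intro no_log_growth[of 1 c]) (auto simp: c_def intro: less_imp_le)
qed

text \<open>\<open>F\<close> is the potential normalised to vanish at \<open>h = pi\<close>; for
  \<open>om \<le> 0\<close> both of its terms are nonnegative. The terms of \<open>(r^2 F)'\<close>
  and \<open>E'\<close> that contain \<open>v\<close> cancel, which leaves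
  \<open>N' = 2 r F\<close>.\<close>

lemma no_solution_below:
  assumes lam: "0 < lam" and om: "om \<le> 0"
    and reg: "\<And>t. 0 < t \<Longrightarrow> 0 < h t \<and> h t < pi"
    and lim: "(h \<longlongrightarrow> pi) at_top"
  shows False
proof -
  define F where "F r = lam / 2 * sin (h r)^2 - om * (1 + cos (h r))" for r
  define N where "N r = r^2 * F r - E r" for r
  have Fpos: "0 < F r" if "0 < r" for r
  proof -
    have "0 < sin (h r)" using reg[OF that] by (auto intro: sin_gt_zero)
    moreover have "0 \<le> - om * (1 + cos (h r))"
      by (intro mult_nonneg_nonneg) (use om cos_ge_minus_one[of "h r"] in linarith)+
    ultimately show ?thesis unfolding F_def using lam
      by (smt (verit) zero_less_power mult_pos_pos half_gt_zero mult_minus_left)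
  qed
  have dN: "(N has_real_derivative 2 * t * F t) (at t)" if t: "0 < t" for t
  proof -
    have "(N has_real_derivative (2 * t * F t + t^2 * (lam / 2 * (2 * sin (h t) * (cos (h t) * (v t / t)))
         + om * (sin (h t) * (v t / t)))
       - t * (om + lam * cos (h t)) * sin (h t) * v t)) (at t)"
      unfolding N_def F_def using reg[of t] t
      by (auto intro!: derivative_eq_intros dE dh simp: field_simps)
    moreover have "2 * t * F t + t^2 * (lam / 2 * (2 * sin (h t) * (cos (h t) * (v t / t)))
         + om * (sin (h t) * (v t / t)))
       - t * (om + lam * cos (h t)) * sin (h t) * v t = 2 * t * F t"
      using t by (simp add: field_simps power2_eq_square)
    ultimately show ?thesis by metis
  qed
  have d0: "0 < N 1"
  proof (rule gt_limit_at_0[of 1 N])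
    show "isCont N 1" using dN[of 1] by (auto intro: DERIV_isCont)
    show "(N \<longlongrightarrow> 0) (at_right 0)"
      unfolding N_def F_def by (rule tendsto_eq_intros E_0 h_0 refl | simp)+
    fix t :: real assume t: "0 < t" "t < 1"
    then show "\<exists>y. (N has_real_derivative y) (at t) \<and> 0 < y"
      using dN[of t] Fpos[of t] by (intro exI[of _ "2 * t * F t"]) auto
  qed auto
  define d where "d = N 1"
  have Nd: "d \<le> N r" if "1 \<le> r" for r
    unfolding d_def
  proof (rule DERIV_nonneg_imp_nondecreasing[OF that])
    fix t :: real assume t: "1 \<le> t" "t \<le> r"
    then show "\<exists>y. (N has_real_derivative y) (at t) \<and> 0 \<le> y"
      using dN[of t] Fpos[of t] by (intro exI[of _ "2 * t * F t"]) auto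
  qed
  have "((\<lambda>t. real n ^ 2 * sin (h t) ^ 2 / 2) \<longlongrightarrow> real n ^ 2 * sin pi ^ 2 / 2) at_top"
    by (intro tendsto_intros lim) auto
  then have "eventually (\<lambda>t. real n ^ 2 * sin (h t) ^ 2 / 2 < d / 4) at_top"
    using d0 by (intro order_tendstoD(2)) (auto simp: d_def)
  then obtain r1 where r1: "\<And>t. r1 \<le> t \<Longrightarrow> real n ^ 2 * sin (h t) ^ 2 / 2 < d / 4"
    unfolding eventually_at_top_linorder by blast
  define r0 where "r0 = max 1 r1"
  have r0: "1 \<le> r0" "r1 \<le> r0" by (auto simp: r0_def)
  \<comment> \<open>\<open>E\<close> is at least \<open>- n^2 sin^2 h / 2\<close>, which tends to 0
    as \<open>h\<close> tends to \<open>pi\<close>. The threshold \<open>d / 4\<close> is small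
    against \<open>N \<ge> d\<close>.\<close>
  have FN: "N t - d / 4 \<le> t^2 * F t" if "r0 \<le> t" for t
  proof -
    have "- (real n ^ 2 * sin (h t) ^ 2 / 2) \<le> E t" unfolding E_def by (simp add: field_simps)
    then show ?thesis using r1[of t] that r0 unfolding N_def by simp
  qed
  define c where "c = (N r0 - d / 4) / r0^2"
  have c: "0 < c" using Nd[of r0] r0 d0 unfolding c_def d_def by (intro divide_pos_pos) auto
  have cF: "c \<le> F t" if t: "r0 \<le> t" for t
  proof -
    \<comment> \<open>The derivative of this quotient has the sign of
      \<open>t^2 F - (N - d / 4)\<close>, nonnegative by \<open>FN\<close>. So \<open>N\<close>
      grows at least quadratically, and \<open>F\<close> stays above a positive constant.\<close>
    have "c \<le> (N t - d / 4) / t^2" unfolding c_def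
    proof (rule DERIV_nonneg_imp_nondecreasing[OF t])
      fix x assume x: "r0 \<le> x" "x \<le> t"
      then have x0: "0 < x" using r0 by auto
      have "((\<lambda>t. (N t - d / 4) / t^2) has_real_derivative 
         (2 * x * F x * x^2 - (N x - d/4) * (2 * x)) / (x^2 * x^2)) (at x)"
        using x0 by (auto intro!: derivative_eq_intros dN)
      moreover have "0 \<le> (2 * x * F x * x^2 - (N x - d/4) * (2 * x)) / (x^2 * x^2)"
      proof -
        have "0 \<le> 2 * x * (x^2 * F x - (N x - d/4))" using FN[OF x(1)] x0 by auto
        then show ?thesis by (intro divide_nonneg_nonneg) (auto simp: algebra_simps)
      qed
      ultimately show "\<exists>y. ((\<lambda>t. (N t - d / 4) / t^2) has_real_derivative y) (at x) \<and> 0 \<le> y" by blast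
    qed
    also have "\<dots> \<le> F t" using FN[OF t] t r0 by (simp add: field_simps)
    finally show ?thesis .
  qed
  have "(F \<longlongrightarrow> lam / 2 * sin pi ^ 2 - om * (1 + cos pi)) at_top"
    unfolding F_def by (intro tendsto_intros lim)
  then have "eventually (\<lambda>t. F t < c) at_top" using c by (intro order_tendstoD(2)) auto
  then have "eventually (\<lambda>t. F t < c \<and> r0 \<le> t) at_top"
    using eventually_ge_at_top by eventually_elim auto
  then obtain t where "F t < c" "r0 \<le> t"
    by (metis (no_types, lifting) eventually_at_top_linorder order_refl)
  then show False using cF[of t] by simp
qed

end

section \<open>From the equation to its profile: necessity\<close>

lemma vector2_line: "vector [a, b] + s *\<^sub>R axis 1 1 = (vector [a + s, b] :: real^2)"
  "vector [a, b] + s *\<^sub>R axis 2 1 = (vector [a, b + s] :: real^2)"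
  by (auto simp: vec_eq_iff forall_2 axis_def)

lemma partially_differentiable_line:
  assumes "partially_differentiable i F"
  shows "((\<lambda>s. F (x + s *\<^sub>R axis i 1)) has_vector_derivative partial_deriv i F x) (at 0)"
  using assms unfolding partially_differentiable_def partial_deriv_def
  by (simp add: vector_derivative_works)

lemma has_vector_derivative_shift:
  fixes f :: "real \<Rightarrow> 'b::real_normed_vector"
  assumes "((\<lambda>s. f (r + s)) has_vector_derivative D) (at 0)"
  shows "(f has_vector_derivative D) (at r)"
proof -
  have "((\<lambda>s. f (r + s)) has_vector_derivative D) (at (r - r))" using assms by simp
  moreover have "((\<lambda>s. s - r) has_vector_derivative 1) (at r)" by (auto intro!: derivative_eq_intros)
  ultimately have "((\<lambda>s. f (r + s)) \<circ> (\<lambda>s. s - r) has_vector_derivative 1 *\<^sub>R D) (at r)"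
    by (intro vector_diff_chain_at)
  then show ?thesis by (simp add: o_def)
qed

text \<open>No regularity of \<open>h\<close> is assumed: it is recovered from the components of
  \<open>u\<close> on the positive first axis at time 0, where \<open>u = (sin h, 0, cos h)\<close>.
  The equation is used there in its second component; the second derivative across the axis requires
  the values of \<open>u\<close> off the axis as well.\<close>

lemma necessity:
  fixes lam om :: real and m :: int and u :: "real^2 \<Rightarrow> real \<Rightarrow> real^3"
  assumes lam: "0 < lam" and m: "m \<noteq> 0" and sol: "landau_lifshitz_solution lam u"
    and eq: "equivariant_rotating m om h u" and h0: "h 0 = 0" and lim: "(h \<longlongrightarrow> pi) at_top"
    and range: "\<forall>r>0. 0 < h r \<and> h r < pi"
  shows "0 < om \<and> om < lam / \<bar>real_of_int m\<bar>"
proof -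
  define n where "n = nat \<bar>m\<bar>"
  have n: "1 \<le> n" using m by (simp add: n_def)
  have mn: "\<bar>real_of_int m\<bar> = real n" by (simp add: n_def)
  have mm: "real_of_int m ^ 2 = real n ^ 2" using mn by (metis power2_abs)
  define U where "U x = u x 0" for x
  define D where "D i = partial_deriv i U" for i
  define DD where "DD i = partial_deriv i (D i)" for i
  have C2: "spatially_C2 u" using sol by (simp add: landau_lifshitz_solution_def)
  have dU: "((\<lambda>s. U (x + s *\<^sub>R axis i 1)) has_vector_derivative D i x) (at 0)" for x i
    unfolding D_def U_def using C2 unfolding spatially_C2_def by (intro partially_differentiable_line) auto
  have dD: "((\<lambda>s. D i (x + s *\<^sub>R axis i 1)) has_vector_derivative DD i x) (at 0)" for x i
    unfolding DD_def D_def U_def using C2 unfolding spatially_C2_def by (intro partially_differentiable_line) auto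
  have cont0: "continuous_on UNIV (\<lambda>x. f x 0)" if "continuous_on UNIV (\<lambda>(x, t). f x t)" for f :: "real^2 \<Rightarrow> real \<Rightarrow> real^3"
  proof -
    have "continuous_on UNIV (\<lambda>x. (\<lambda>(x, t). f x t) (x, 0))"
      by (rule continuous_on_compose2[OF that]) (auto intro!: continuous_intros)
    then show ?thesis by simp
  qed
  have cU: "continuous_on UNIV U"
    unfolding U_def using C2 unfolding spatially_C2_def by (intro cont0) auto
  have cD: "continuous_on UNIV (D i)" for i
    using C2 cont0[of "\<lambda>x t. partial_deriv i (\<lambda>y. u y t) x"]
    unfolding spatially_C2_def D_def U_def by auto
  have X: "((\<lambda>r. U (vector [r, 0])) has_vector_derivative D 1 (vector [r, 0])) (at r)"
    "((\<lambda>r. D 1 (vector [r, 0])) has_vector_derivative DD 1 (vector [r, 0])) (at r)"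
    "((\<lambda>y. U (vector [r, y])) has_vector_derivative D 2 (vector [r, y])) (at y)"
    "((\<lambda>y. D 2 (vector [r, y])) has_vector_derivative DD 2 (vector [r, y])) (at y)" for r y
    using dU[of "vector [r, 0]" 1] dD[of 1 "vector [r, 0]"] dU[of "vector [r, y]" 2] dD[of 2 "vector [r, y]"]
    unfolding vector2_line by (auto intro: has_vector_derivative_shift)
  have comp: "((\<lambda>r. F r $ i) has_real_derivative D' $ i) (at r)" if "(F has_vector_derivative D') (at r)" for F :: "real \<Rightarrow> real^3" and D' i r
    using bounded_linear.has_vector_derivative[OF bounded_linear_vec_nth that]
    by (simp add: has_real_derivative_iff_has_vector_derivative)
  define S c S1 c1 S2 c2 where "S r = U (vector [r, 0]) $ 1" and "c r = U (vector [r, 0]) $ 3"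
    and "S1 r = D 1 (vector [r, 0]) $ 1" and "c1 r = D 1 (vector [r, 0]) $ 3"
    and "S2 r = DD 1 (vector [r, 0]) $ 1" and "c2 r = DD 1 (vector [r, 0]) $ 3" for r
  have dS: "(S has_real_derivative S1 r) (at r)" and dc: "(c has_real_derivative c1 r) (at r)"
    and dS1: "(S1 has_real_derivative S2 r) (at r)" and dc1: "(c1 has_real_derivative c2 r) (at r)" for r
    unfolding S_def[abs_def] c_def[abs_def] S1_def[abs_def] c1_def[abs_def] S2_def c2_def by (intro comp X)+
  have polar: "u (vector [r * cos \<theta>, r * sin \<theta>]) t = vector [sin (h r) * cos (of_int m * \<theta> + om * t),
      sin (h r) * sin (of_int m * \<theta> + om * t), cos (h r)]" if "0 \<le> r" for r \<theta> t
    using eq that unfolding equivariant_rotating_def by blast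
  have Sc: "S r = sin (h r)" "c r = cos (h r)" if "0 \<le> r" for r
    using polar[OF that, of 0 0] by (simp_all add: S_def c_def U_def)
  \<comment> \<open>In the half-plane \<open>r > 0\<close> the polar angle of \<open>(r, y)\<close>
    is \<open>arctan (y / r)\<close>.\<close>
  have off: "U (vector [r, y]) $ 1 = S (sqrt (r^2 + y^2)) * cos (of_int m * arctan (y / r))"
    "U (vector [r, y]) $ 3 = c (sqrt (r^2 + y^2))" if r: "0 < r" for r y
  proof -
    define \<rho> where "\<rho> = sqrt (r^2 + y^2)"
    have \<rho>: "0 < \<rho>" using r by (auto simp: \<rho>_def add_pos_nonneg)
    have "sqrt (1 + (y / r)^2) = \<rho> / r"
    proof -
      have "1 + (y / r)^2 = (r^2 + y^2) / r^2" using r by (simp add: power_divide add_divide_distrib)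
      then show ?thesis using r by (simp add: \<rho>_def real_sqrt_divide)
    qed
    then have "\<rho> * cos (arctan (y / r)) = r" "\<rho> * sin (arctan (y / r)) = y"
      using r \<rho> by (simp_all add: cos_arctan sin_arctan)
    then show "U (vector [r, y]) $ 1 = S (sqrt (r^2 + y^2)) * cos (of_int m * arctan (y / r))"
      "U (vector [r, y]) $ 3 = c (sqrt (r^2 + y^2))"
      using polar[OF less_imp_le[OF \<rho>], of "arctan (y / r)" 0] Sc[OF less_imp_le[OF \<rho>]]
      unfolding \<rho>_def[symmetric] by (simp_all add: U_def)
  qed
  have dr: "((\<lambda>y. sqrt (r^2 + y^2)) has_real_derivative y / sqrt (r^2 + y^2)) (at y)" if r: "0 < r" for r y :: real
  proof -
    have "0 < r^2 + y^2" using r by (simp add: add_pos_nonneg)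
    then show ?thesis by (auto intro!: derivative_eq_intros simp: field_simps)
  qed
  have da: "((\<lambda>y. arctan (y / r)) has_real_derivative r / (r^2 + y^2)) (at y)" if r: "0 < r" for r y :: real
  proof -
    have p: "0 < r^2 + y^2" using r by (simp add: add_pos_nonneg)
    have "((\<lambda>y. arctan (y / r)) has_real_derivative inverse (1 + (y / r)\<^sup>2) * (1 / r)) (at y)"
      using r by (auto intro!: derivative_eq_intros)
    moreover have "inverse (1 + (y / r)\<^sup>2) * (1 / r) = r / (r^2 + y^2)"
    proof -
      have "1 + (y / r)^2 = (r^2 + y^2) / r^2" using r by (simp add: power_divide add_divide_distrib)
      then show ?thesis using r p by (simp add: field_simps power2_eq_square)
    qed
    ultimately show ?thesis by metis
  qed
  have dcomp: "((\<lambda>y. f (sqrt (r^2 + y^2))) has_real_derivative f1 (sqrt (r^2 + y^2)) * (y / sqrt (r^2 + y^2))) (at y)"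
    if "0 < r" "\<And>r. (f has_real_derivative f1 r) (at r)" for f f1 :: "real \<Rightarrow> real" and r y
    by (rule DERIV_chain2[where f = f and g = "\<lambda>y. sqrt (r^2 + y^2)", OF that(2) dr[OF that(1)]])
  have D2: "D 2 (vector [r, y]) $ 1 = S1 (sqrt (r^2 + y^2)) * (y / sqrt (r^2 + y^2)) * cos (of_int m * arctan (y / r))
       - S (sqrt (r^2 + y^2)) * (sin (of_int m * arctan (y / r)) * (of_int m * (r / (r^2 + y^2))))"
    "D 2 (vector [r, y]) $ 3 = c1 (sqrt (r^2 + y^2)) * (y / sqrt (r^2 + y^2))" if r: "0 < r" for r y
  proof -
    have "((\<lambda>y. U (vector [r, y]) $ 1) has_real_derivative
      S1 (sqrt (r^2 + y^2)) * (y / sqrt (r^2 + y^2)) * cos (of_int m * arctan (y / r))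
       - S (sqrt (r^2 + y^2)) * (sin (of_int m * arctan (y / r)) * (of_int m * (r / (r^2 + y^2))))) (at y)"
      unfolding off[OF r]
      by (rule DERIV_cong[OF DERIV_mult[OF dcomp[OF r dS] DERIV_fun_cos[OF DERIV_cmult[OF da[OF r]]]]]) simp
    then show "D 2 (vector [r, y]) $ 1 = S1 (sqrt (r^2 + y^2)) * (y / sqrt (r^2 + y^2)) * cos (of_int m * arctan (y / r))
       - S (sqrt (r^2 + y^2)) * (sin (of_int m * arctan (y / r)) * (of_int m * (r / (r^2 + y^2))))"
      by (rule DERIV_unique[OF comp[OF X(3)]])
    have "((\<lambda>y. U (vector [r, y]) $ 3) has_real_derivative c1 (sqrt (r^2 + y^2)) * (y / sqrt (r^2 + y^2))) (at y)"
      unfolding off[OF r] by (rule dcomp[OF r dc])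
    then show "D 2 (vector [r, y]) $ 3 = c1 (sqrt (r^2 + y^2)) * (y / sqrt (r^2 + y^2))"
      by (rule DERIV_unique[OF comp[OF X(3)]])
  qed
  \<comment> \<open>The part of the polar Laplacian transversal to the axis: two derivatives in
    \<open>y\<close>, taken at \<open>y = 0\<close>.\<close>
  have DD2: "DD 2 (vector [r, 0]) $ 1 = S1 r / r - real n ^ 2 * S r / r^2" "DD 2 (vector [r, 0]) $ 3 = c1 r / r"
    if r: "0 < r" for r
  proof -
    have q: "((\<lambda>y. y / sqrt (r^2 + y^2)) has_real_derivative 1 / r) (at 0)"
      using r by (auto intro!: derivative_eq_intros dr[OF r] simp: field_simps power2_eq_square)
    have s0: "sqrt (r^2 + 0^2) = r" using r by simp
    have a0: "((\<lambda>y. arctan (y / r)) has_real_derivative 1 / r) (at 0)"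
      using da[OF r, of 0] r by (simp add: power2_eq_square)
    have f0: "((\<lambda>y. f (sqrt (r^2 + y^2))) has_real_derivative 0) (at 0)"
      if "\<And>r. (f has_real_derivative f1 r) (at r)" for f f1 :: "real \<Rightarrow> real"
      using dcomp[of r f f1 0, OF r that] by simp
    have b0: "((\<lambda>y. of_int m * (r / (r^2 + y^2))) has_real_derivative 0) (at 0)"
      using r by (auto intro!: derivative_eq_intros)
    have c0: "((\<lambda>y. cos (of_int m * arctan (y / r))) has_real_derivative 0) (at 0)"
      by (rule DERIV_cong[OF DERIV_fun_cos[OF DERIV_cmult[OF a0]]]) simp
    have i0: "((\<lambda>y. sin (of_int m * arctan (y / r))) has_real_derivative of_int m * (1 / r)) (at 0)"
      by (rule DERIV_cong[OF DERIV_fun_sin[OF DERIV_cmult[OF a0]]]) simp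
    have A: "((\<lambda>y. S1 (sqrt (r^2 + y^2)) * (y / sqrt (r^2 + y^2)) * cos (of_int m * arctan (y / r))
        - S (sqrt (r^2 + y^2)) * (sin (of_int m * arctan (y / r)) * (of_int m * (r / (r^2 + y^2))))) has_real_derivative
       S1 r * (1 / r) - S r * (of_int m * (1 / r) * (of_int m * (r / r^2)))) (at 0)"
      using DERIV_diff[OF DERIV_mult[OF DERIV_mult[OF f0[OF dS1] q] c0] DERIV_mult[OF f0[OF dS] DERIV_mult[OF i0 b0]]] r
      by (simp add: algebra_simps)
    have "((\<lambda>y. D 2 (vector [r, y]) $ 1) has_real_derivative
       S1 r * (1 / r) - S r * (of_int m * (1 / r) * (of_int m * (r / r^2)))) (at 0)"
      unfolding D2[OF r] by (rule A)
    then have "DD 2 (vector [r, 0]) $ 1 = S1 r * (1 / r) - S r * (of_int m * (1 / r) * (of_int m * (r / r^2)))"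
      by (rule DERIV_unique[OF comp[OF X(4)]])
    also have "\<dots> = S1 r / r - real_of_int m ^ 2 * S r / r^2" using r by (simp add: field_simps power2_eq_square)
    finally show "DD 2 (vector [r, 0]) $ 1 = S1 r / r - real n ^ 2 * S r / r^2" unfolding mm .
    have "((\<lambda>y. D 2 (vector [r, y]) $ 3) has_real_derivative c1 r / r) (at 0)"
      unfolding D2[OF r] using DERIV_mult[OF f0[OF dc1] q] r by simp
    then show "DD 2 (vector [r, 0]) $ 3 = c1 r / r"
      by (rule DERIV_unique[OF comp[OF X(4)]])
  qed
  \<comment> \<open>The second component of a cross product involves only first and third
    components, and the time derivative of \<open>sin h sin (om t)\<close> at 0 is
    \<open>om sin h\<close>.\<close>
  have ode: "cos (h r) * (S2 r + (S1 r / r - real n ^ 2 * S r / r^2)) - sin (h r) * (c2 r + c1 r / r + lam * cos (h r)) = om * sin (h r)"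
    if r: "0 < r" for r
  proof -
    define x :: "real^2" where "x = vector [r, 0]"
    have px: "u x t = vector [sin (h r) * cos (om * t), sin (h r) * sin (om * t), cos (h r)]" for t
      using polar[OF less_imp_le[OF r], of 0 t] by (simp add: x_def)
    have lap: "laplacian (\<lambda>y. u y 0) x = DD 1 x + DD 2 x"
      by (simp add: laplacian_def sum_2 DD_def D_def U_def[abs_def])
    have "((\<lambda>s. u x s) has_vector_derivative
        cross3 (u x 0) (laplacian (\<lambda>y. u y 0) x + (lam * u x 0 $ 3) *\<^sub>R vector [0, 0, 1])) (at 0)"
      using sol unfolding landau_lifshitz_solution_def by blast
    from comp[OF this, of 2]
    have "((\<lambda>s. u x s $ 2) has_real_derivative
        cross3 (u x 0) (laplacian (\<lambda>y. u y 0) x + (lam * u x 0 $ 3) *\<^sub>R vector [0, 0, 1]) $ 2) (at 0)" .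
    moreover have "((\<lambda>s. u x s $ 2) has_real_derivative om * sin (h r)) (at 0)"
      unfolding px by (auto intro!: derivative_eq_intros)
    ultimately have "cross3 (u x 0) (laplacian (\<lambda>y. u y 0) x + (lam * u x 0 $ 3) *\<^sub>R vector [0, 0, 1]) $ 2 = om * sin (h r)"
      by (rule DERIV_unique)
    then show ?thesis
      unfolding lap px[of 0] using DD2[OF r] Sc[OF less_imp_le[OF r]]
      by (simp add: cross3_def x_def S2_def c2_def)
  qed
  \<comment> \<open>\<open>r h'\<close> written in terms of the derivatives of \<open>sin h\<close>
    and \<open>cos h\<close>, available before \<open>h\<close> is known to be
    differentiable.\<close>
  define v where "v r = r * (cos (h r) * S1 r - sin (h r) * c1 r)" for r
  have orth: "sin (h r) * S1 r + cos (h r) * c1 r = 0" if r: "0 < r" for r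
  proof -
    have "((\<lambda>r. S r ^ 2 + c r ^ 2) has_real_derivative 2 * (S r * S1 r + c r * c1 r)) (at r)"
      by (auto intro!: derivative_eq_intros dS dc)
    moreover have "((\<lambda>r. S r ^ 2 + c r ^ 2) has_real_derivative 0) (at r)"
    proof (rule has_field_derivative_transform_within_open[of "\<lambda>_. 1" _ _ "{0<..}"])
      fix x :: real assume "x \<in> {0<..}"
      then show "1 = S x ^ 2 + c x ^ 2" by (simp add: Sc)
    qed (use r in auto)
    ultimately have "2 * (S r * S1 r + c r * c1 r) = 0" by (rule DERIV_unique)
    then show ?thesis using Sc[of r] r by simp
  qed
  \<comment> \<open>\<open>arccos\<close> transfers differentiability from \<open>c\<close> to
    \<open>h\<close> for \<open>r > 0\<close>, where \<open>c\<close> lies strictly between -1 and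
    1. At \<open>r = 0\<close>, where \<open>c = 1\<close>, it is only continuous, which is enough
    for \<open>h_0\<close>.\<close>
  have harc: "h r = arccos (c r)" if "0 \<le> r" for r
  proof (cases "r = 0")
    case True then show ?thesis using Sc(2)[of 0] h0 by simp
  next
    case False
    then have "0 < h r" "h r < pi" using range that by auto
    then show ?thesis using Sc(2)[OF that] by (simp add: arccos_cos)
  qed
  have dh: "(h has_real_derivative v r / r) (at r)" if r: "0 < r" for r
  proof -
    have hr: "0 < h r" "h r < pi" using range r by auto
    have s: "0 < sin (h r)" using hr by (rule sin_gt_zero)
    have cr: "c r = cos (h r)" using Sc r by simp
    have cb: "-1 < c r" "c r < 1"
    proof -
      have "c r ^ 2 + sin (h r) ^ 2 = 1" unfolding cr by simp
      then have "c r ^ 2 < 1" using s zero_less_power[OF s, of 2] by linarith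
      then show "-1 < c r" "c r < 1" by (auto simp: power2_less_1_iff abs_less_iff)
    qed
    have "sqrt (1 - c r ^ 2) = sin (h r)" unfolding cr using s by (simp add: sin_squared_eq[symmetric])
    have "((\<lambda>r. arccos (c r)) has_real_derivative inverse (- sqrt (1 - (c r)\<^sup>2)) * c1 r) (at r)"
      by (rule DERIV_chain2[where f = arccos and g = c, OF DERIV_arccos[OF cb] dc])
    moreover have "inverse (- sqrt (1 - (c r)\<^sup>2)) * c1 r = v r / r"
    proof -
      have "sin (h r) * (cos (h r) * S1 r - sin (h r) * c1 r) = cos (h r) * (sin (h r) * S1 r) - sin (h r)^2 * c1 r"
        by (simp add: algebra_simps power2_eq_square)
      also have "sin (h r) * S1 r = - cos (h r) * c1 r" using orth[OF r] by linarith
      also have "cos (h r) * (- cos (h r) * c1 r) - sin (h r)^2 * c1 r = - ((cos (h r)^2 + sin (h r)^2) * c1 r)"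
      proof -
        have "a * (- a * x) - b^2 * x = - ((a^2 + b^2) * x)" for a b x :: real
          by (simp add: algebra_simps power2_eq_square)
        then show ?thesis .
      qed
      also have "\<dots> = - c1 r" by simp
      finally have "cos (h r) * S1 r - sin (h r) * c1 r = - c1 r / sin (h r)" using s by (simp add: field_simps)
      moreover have "v r / r = cos (h r) * S1 r - sin (h r) * c1 r" using r by (simp add: v_def)
      ultimately show ?thesis unfolding \<open>sqrt (1 - c r ^ 2) = sin (h r)\<close> by (simp add: divide_inverse)
    qed
    ultimately have "((\<lambda>r. arccos (c r)) has_real_derivative v r / r) (at r)" by simp
    then show ?thesis
      by (rule has_field_derivative_transform_within_open[of _ _ _ "{0<..}"]) (use r harc in auto)
  qed
  have dv: "(v has_real_derivative (real n ^ 2 * sin (h r) * cos (h r) / r + r * (om + lam * cos (h r)) * sin (h r))) (at r)"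
    if r: "0 < r" for r
  proof -
    have "(v has_real_derivative (1 * (cos (h r) * S1 r - sin (h r) * c1 r) +
       ((- sin (h r) * (v r / r)) * S1 r + S2 r * cos (h r) - ((cos (h r) * (v r / r)) * c1 r + c2 r * sin (h r))) * r)) (at r)"
      unfolding v_def[abs_def]
      by (intro DERIV_mult DERIV_diff DERIV_ident dS1 dc1 DERIV_fun_cos[OF dh[OF r], unfolded v_def] DERIV_fun_sin[OF dh[OF r], unfolded v_def])
    \<comment> \<open>The terms that come from differentiating \<open>cos h\<close> and
      \<open>sin h\<close> combine to a multiple of the left-hand side of \<open>orth\<close> and
      drop out.\<close>
    moreover have "1 * (cos (h r) * S1 r - sin (h r) * c1 r) +
       ((- sin (h r) * (v r / r)) * S1 r + S2 r * cos (h r) - ((cos (h r) * (v r / r)) * c1 r + c2 r * sin (h r))) * r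
      = (cos (h r) * S1 r - sin (h r) * c1 r) - v r * (sin (h r) * S1 r + cos (h r) * c1 r)
        + r * (cos (h r) * S2 r - sin (h r) * c2 r)"
      using r by (simp add: field_simps)
    moreover have "\<dots> = real n ^ 2 * sin (h r) * cos (h r) / r + r * (om + lam * cos (h r)) * sin (h r)"
    proof -
      have "cos (h r) * S2 r - sin (h r) * c2 r = om * sin (h r) + lam * cos (h r) * sin (h r)
         - cos (h r) * (S1 r / r - real n ^ 2 * sin (h r) / r^2) + sin (h r) * (c1 r / r)"
        using ode[OF r] Sc(1)[of r] r by (simp add: algebra_simps)
      then have "r * (cos (h r) * S2 r - sin (h r) * c2 r) = r * (om * sin (h r) + lam * cos (h r) * sin (h r)
         - cos (h r) * (S1 r / r - real n ^ 2 * sin (h r) / r^2) + sin (h r) * (c1 r / r))" by simp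
      also have "\<dots> = r * (om + lam * cos (h r)) * sin (h r) - cos (h r) * S1 r
         + real n ^ 2 * sin (h r) * cos (h r) / r + sin (h r) * c1 r"
        using r by (simp add: field_simps power2_eq_square)
      finally show ?thesis unfolding orth[OF r] by simp
    qed
    ultimately show ?thesis by metis
  qed
  have at0: "(f \<longlongrightarrow> f 0) (at_right 0)" if "isCont f 0" for f :: "real \<Rightarrow> real"
    using that by (simp add: isCont_def filterlim_at_split)
  have h_0: "(h \<longlongrightarrow> 0) (at_right 0)"
  proof -
    have c01: "(c \<longlongrightarrow> 1) (at_right 0)" using at0[OF DERIV_isCont[OF dc]] Sc(2)[of 0] h0 by simp
    have "((\<lambda>r. arccos (c r)) \<longlongrightarrow> arccos 1) (at_right 0)"
    proof (rule continuous_on_tendsto_compose[OF continuous_on_arccos' c01])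
      show "eventually (\<lambda>r. c r \<in> {-1..1}) (at_right 0)"
        unfolding eventually_at_right_field by (intro exI[of _ 1]) (auto simp: Sc)
    qed auto
    then have "((\<lambda>r. arccos (c r)) \<longlongrightarrow> 0) (at_right 0)" by simp
    then show ?thesis
      by (rule Lim_transform_eventually) (auto simp: eventually_at_right_field harc intro!: exI[of _ 1])
  qed
  have v_0: "(v \<longlongrightarrow> 0) (at_right 0)"
  proof -
    have "((\<lambda>r. r * (cos (h r) * S1 r - sin (h r) * c1 r)) \<longlongrightarrow> 0 * (cos 0 * S1 0 - sin 0 * c1 0)) (at_right 0)"
      by (intro tendsto_intros h_0 at0[OF DERIV_isCont[OF dS1]] at0[OF DERIV_isCont[OF dc1]])
    then show ?thesis by (simp add: v_def[abs_def])
  qed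
  interpret profile n lam om h v
  proof
    show "eventually (\<lambda>r. 0 < h r) (at_right 0)"
      unfolding eventually_at_right_field using range by (intro exI[of _ 1]) auto
  qed (use n dh dv h_0 v_0 in \<open>auto intro: DERIV_isCont\<close>)
  have "0 < om" using no_solution_below[OF lam _ _ lim] range by (meson not_less)
  moreover have "real n * om < lam" using no_solution_above[OF lam] range by (meson not_less)
  ultimately show ?thesis unfolding mn using n by (simp add: field_simps)
qed

section \<open>Overshooting\<close>

context profile
begin

text \<open>\<open>D (h r)\<close> is the potential energy gained since the origin, where \<open>h = 0\<close>, and \<open>E / r^2\<close> is the energy that is left of it.
  At a turning point \<open>D\<close> exceeds \<open>om\<close> while \<open>E \<le> 0\<close>, hence \<open>loss > om\<close> there.\<close>

definition D :: "real \<Rightarrow> real" where "D x = lam / 2 * sin x ^ 2 + om * (1 - cos x)"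

definition loss :: "real \<Rightarrow> real" where "loss r = D (h r) - E r / r^2"

lemma dD: assumes "0 < r"
  shows "((\<lambda>r. D (h r)) has_real_derivative (om + lam * cos (h r)) * sin (h r) * (v r / r)) (at r)"
  unfolding D_def using assms
  by (auto intro!: derivative_eq_intros dh simp: algebra_simps power2_eq_square)

lemma D_nonneg: "0 \<le> lam \<Longrightarrow> 0 \<le> om \<Longrightarrow> 0 \<le> D x"
  unfolding D_def by (intro add_nonneg_nonneg mult_nonneg_nonneg) auto

lemma D_le_square: assumes "0 \<le> lam" "0 \<le> om"
  shows "D x \<le> (lam + om) / 2 * x^2"
proof -
  have s: "sin y ^ 2 \<le> y ^ 2" for y :: real
    using abs_sin_x_le_abs_x[of y] by (simp add: abs_le_square_iff)
  have "1 - cos x = 2 * sin (x/2) ^ 2" using cos_double_sin[of "x/2"] by simp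
  also have "\<dots> \<le> x^2 / 2" using s[of "x/2"] by (simp add: power_divide)
  finally have "om * (1 - cos x) \<le> om * (x^2 / 2)" using assms by (intro mult_left_mono) auto
  moreover have "lam / 2 * sin x ^ 2 \<le> lam / 2 * x^2" using s assms by (intro mult_left_mono) auto
  ultimately show ?thesis unfolding D_def by (simp add: algebra_simps add_divide_distrib)
qed

lemma D_h_0: "((\<lambda>r. D (h r)) \<longlongrightarrow> 0) (at_right 0)"
  unfolding D_def by (rule tendsto_eq_intros h_0 refl | simp)+

lemma cD: "0 < r \<Longrightarrow> isCont (\<lambda>r. D (h r)) r" using dD by (blast intro: DERIV_isCont)

text \<open>Pohozaev's identity with the potential normalised at \<open>h = 0\<close> instead of
  \<open>pi\<close>: \<open>(r^2 D - E)' = 2 r D \<ge> 0\<close>. In other words,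
  \<open>loss\<close> is nonnegative.\<close>

lemma E_le_D:
  assumes pos: "0 \<le> lam" "0 \<le> om" and r: "0 < r"
    and reg: "\<And>t. 0 < t \<Longrightarrow> t < r \<Longrightarrow> 0 \<le> h t \<and> h t \<le> pi"
  shows "E r \<le> r^2 * D (h r)"
proof -
  have "0 \<le> r^2 * D (h r) - E r"
  proof (rule ge_limit_at_0[of r "\<lambda>r. r^2 * D (h r) - E r"])
    show "isCont (\<lambda>r. r\<^sup>2 * D (h r) - E r) r" using r by (auto intro!: continuous_intros cE cD)
    show "((\<lambda>r. r\<^sup>2 * D (h r) - E r) \<longlongrightarrow> 0) (at_right 0)"
      by (rule tendsto_eq_intros E_0 D_h_0 refl | simp)+
    fix t assume t: "0 < t" "t < r"
    have "((\<lambda>r. r\<^sup>2 * D (h r) - E r) has_real_derivative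
       (2 * t * D (h t) + t^2 * ((om + lam * cos (h t)) * sin (h t) * (v t / t))
         - t * (om + lam * cos (h t)) * sin (h t) * v t)) (at t)"
      using t reg[of t] by (auto intro!: derivative_eq_intros dE dD)
    moreover have "2 * t * D (h t) + t^2 * ((om + lam * cos (h t)) * sin (h t) * (v t / t))
         - t * (om + lam * cos (h t)) * sin (h t) * v t = 2 * t * D (h t)"
      using t by (simp add: field_simps power2_eq_square)
    moreover have "0 \<le> 2 * t * D (h t)" using t D_nonneg[OF pos] by auto
    ultimately show "\<exists>y. ((\<lambda>r. r\<^sup>2 * D (h r) - E r) has_real_derivative y) (at t) \<and> 0 \<le> y" by metis
  qed (use r in auto)
  then show ?thesis by simp
qed

text \<open>By \<open>E_le_D\<close> and \<open>D_le_square\<close>,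
  \<open>v^2 \<le> (n^2 + c^2 r^2) h^2\<close> with \<open>c^2 = lam + om\<close>, so
  \<open>v \<le> (n + c r) h\<close>. As \<open>v = r h'\<close>, the quotient
  \<open>h / (r^n exp (c r))\<close> cannot increase from its limit \<open>a\<close>. A small
  initial slope thus keeps \<open>h\<close> small up to any prescribed radius.\<close>

lemma h_growth:
  assumes pos: "0 \<le> lam" "0 \<le> om" and r: "0 < r"
    and reg: "\<And>t. 0 < t \<Longrightarrow> t < r \<Longrightarrow> 0 \<le> h t \<and> h t \<le> pi"
    and a: "((\<lambda>r. h r / r^n) \<longlongrightarrow> a) (at_right 0)"
  shows "h r \<le> a * r^n * exp (sqrt (lam + om) * r)"
proof -
  define c where "c = sqrt (lam + om)"
  have c: "0 \<le> c" "c^2 = lam + om" using pos by (auto simp: c_def)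
  have "- a \<le> - (h r / r^n * exp (- c * r))"
  proof (rule ge_limit_at_0[of r "\<lambda>r. - (h r / r^n * exp (- c * r))"])
    show "isCont (\<lambda>r. - (h r / r^n * exp (- c * r))) r"
      using r by (auto intro!: continuous_intros ch)
    have "((\<lambda>r. - (h r / r^n * exp (- c * r))) \<longlongrightarrow> - (a * exp (- c * 0))) (at_right 0)"
      by (intro tendsto_intros a)
    then show "((\<lambda>r. - (h r / r^n * exp (- c * r))) \<longlongrightarrow> - a) (at_right 0)" by simp
    fix t assume t: "0 < t" "t < r"
    note R = reg[OF t]
    have vt: "v t \<le> (real n + c * t) * h t"
    proof (rule power2_le_imp_le)
      have "E t \<le> t^2 * D (h t)" using t reg by (intro E_le_D[OF pos]) auto
      then have "v t ^ 2 \<le> real n ^ 2 * sin (h t) ^ 2 + 2 * t^2 * D (h t)"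
        unfolding E_def by simp
      also have "\<dots> \<le> real n ^ 2 * h t ^ 2 + 2 * t^2 * ((lam + om) / 2 * h t^2)"
      proof (intro add_mono mult_left_mono D_le_square pos)
        show "sin (h t) ^ 2 \<le> h t ^ 2" using abs_sin_x_le_abs_x[of "h t"] by (simp add: abs_le_square_iff)
      qed auto
      also have "\<dots> = (real n ^ 2 + (c * t) ^ 2) * h t ^ 2"
        using c by (simp add: power_mult_distrib algebra_simps)
      also have "\<dots> \<le> (real n + c * t) ^ 2 * h t ^ 2"
        using c t by (intro mult_right_mono) (auto simp: power2_sum)
      finally show "(v t)\<^sup>2 \<le> ((real n + c * t) * h t)\<^sup>2" by (simp add: power_mult_distrib)
      show "0 \<le> (real n + c * t) * h t" using c t R by (intro mult_nonneg_nonneg add_nonneg_nonneg) auto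
    qed
    have tn: "t ^ n = t * t ^ (n - 1)" using n by (cases n) auto
    have "((\<lambda>r. - (h r / r^n * exp (- c * r))) has_real_derivative
      - ((v t / t * t^n - h t * (real n * t^(n - 1))) / (t^n * t^n) * exp (- c * t)
        + exp (- c * t) * (- c) * (h t / t^n))) (at t)"
      using t by (auto intro!: derivative_eq_intros dh simp: field_simps)
    moreover have "- ((v t / t * t^n - h t * (real n * t^(n - 1))) / (t^n * t^n) * exp (- c * t)
        + exp (- c * t) * (- c) * (h t / t^n)) = ((real n + c * t) * h t - v t) * exp (- c * t) / (t * t^n)"
      using t unfolding tn by (simp add: field_simps)
    moreover have "0 \<le> ((real n + c * t) * h t - v t) * exp (- c * t) / (t * t^n)"
      using vt t by (intro divide_nonneg_pos mult_nonneg_nonneg) auto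
    ultimately show "\<exists>y. ((\<lambda>r. - (h r / r^n * exp (- c * r))) has_real_derivative y) (at t) \<and> 0 \<le> y"
      by metis
  qed (use r in auto)
  then have "h r * exp (- c * r) \<le> a * r^n" using r by (simp add: divide_le_eq)
  then have "h r / exp (c * r) \<le> a * r^n" by (simp add: exp_minus divide_inverse)
  then show ?thesis unfolding c_def[symmetric] by (simp add: divide_le_eq)
qed

lemma d_loss: assumes "0 < r" "0 \<le> h r" "h r \<le> pi"
  shows "(loss has_real_derivative 2 * E r / r^3) (at r)"
proof -
  have "(loss has_real_derivative ((om + lam * cos (h r)) * sin (h r) * (v r / r)
    - (r * (om + lam * cos (h r)) * sin (h r) * v r * r^2 - E r * (2 * r)) / (r^2 * r^2))) (at r)"
    unfolding loss_def using assms by (auto intro!: derivative_eq_intros dE dD)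
  moreover have "(om + lam * cos (h r)) * sin (h r) * (v r / r)
    - (r * (om + lam * cos (h r)) * sin (h r) * v r * r^2 - E r * (2 * r)) / (r^2 * r^2) = 2 * E r / r^3"
    using assms by (simp add: field_simps power2_eq_square power3_eq_cube)
  ultimately show ?thesis by metis
qed

text \<open>The bound is in terms of \<open>h\<close> and not of \<open>r\<close>, since the radius
  at which \<open>h\<close> attains a given level is not controlled from above. The rate
  \<open>2 E / r^3 \<le> 2 D / r\<close> is at most \<open>2 (lam + om) sin^2 h / r\<close>. With
  \<open>sin h \<le> h\<close>, and \<open>sin h \<le> v\<close> from \<open>w > 0\<close>, this is
  below \<open>2 (lam + om) h v / r\<close>, the derivative of
  \<open>(lam + om) h^2\<close>.\<close>

lemma loss_initial:
  assumes pos: "0 < lam" "0 < om" and r: "0 < r"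
    and reg: "\<And>t. 0 < t \<Longrightarrow> t \<le> r \<Longrightarrow> 0 < h t \<and> h t \<le> pi / 2"
  shows "loss r \<le> (lam + om) * h r ^ 2"
proof -
  have hp: "pi / 2 < pi" by simp
  have reg': "0 < h t \<and> h t < pi" "h t \<le> pi/2" "0 \<le> cos (h t)" "0 < sin (h t)" if "0 < t" "t \<le> r" for t
    using reg[OF that] hp by (auto intro!: cos_ge_zero sin_gt_zero)
  have wp: "0 < w t" if t: "0 < t" "t \<le> r" for t
  proof (rule w_pos)
    fix s assume s: "0 < s" "s \<le> t"
    then have "0 \<le> lam * cos (h s)" using reg'[of s] t pos by auto
    then show "0 \<le> h s \<and> h s \<le> pi \<and> 0 \<le> om + lam * cos (h s)" using reg'[of s] s t pos by auto
  qed (use pos t in auto)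
  have El: "E t \<le> t^2 * D (h t)" if t: "0 < t" "t \<le> r" for t
    using pos t reg' by (intro E_le_D) (auto intro: less_imp_le)
  have E0: "0 \<le> E t" if t: "0 < t" "t \<le> r" for t
  proof -
    have "0 \<le> real n * sin (h t)" using reg'[OF t] by auto
    then show ?thesis unfolding E_w using wp[OF t] unfolding w_def by (intro divide_nonneg_pos mult_nonneg_nonneg) auto
  qed
  \<comment> \<open>\<open>E / r^2\<close> is of the form 0/0 at the origin;
    \<open>0 \<le> E \<le> r^2 D\<close> squeezes \<open>loss\<close> between 0 and
    \<open>D\<close>.\<close>
  have loss_0: "(loss \<longlongrightarrow> 0) (at_right 0)"
  proof (rule tendsto_sandwich)
    show "eventually (\<lambda>t. 0 \<le> loss t) (at_right 0)"
      unfolding eventually_at_right_field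
    proof (intro exI[of _ r] conjI allI impI r)
      fix t assume "0 < t" "t < r"
      then show "0 \<le> loss t" using El[of t] by (simp add: loss_def field_simps)
    qed
    show "eventually (\<lambda>t. loss t \<le> D (h t)) (at_right 0)"
      unfolding eventually_at_right_field
    proof (intro exI[of _ r] conjI allI impI r)
      fix t assume "0 < t" "t < r"
      then show "loss t \<le> D (h t)" using E0[of t] by (simp add: loss_def)
    qed
  qed (auto intro: D_h_0)
  have "0 \<le> (lam + om) * h r ^ 2 - loss r"
  proof (rule ge_limit_at_0[of r "\<lambda>r. (lam + om) * h r ^ 2 - loss r"])
    have "isCont loss r" using d_loss[of r] reg'[of r] r by (force intro: DERIV_isCont)
    then show "isCont (\<lambda>r. (lam + om) * (h r)\<^sup>2 - loss r) r"
      using r by (auto intro!: continuous_intros ch)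
    show "((\<lambda>r. (lam + om) * (h r)\<^sup>2 - loss r) \<longlongrightarrow> 0) (at_right 0)"
      by (rule tendsto_eq_intros loss_0 h_0 refl | simp)+
    fix t assume t: "0 < t" "t < r"
    note R = reg'[of t]
    have "((\<lambda>r. (lam + om) * (h r)\<^sup>2 - loss r) has_real_derivative
      (lam + om) * (2 * h t * (v t / t)) - 2 * E t / t^3) (at t)"
      using t R by (auto intro!: derivative_eq_intros dh d_loss)
    moreover have "0 \<le> (lam + om) * (2 * h t * (v t / t)) - 2 * E t / t^3"
    proof -
      have "1 - cos (h t) \<le> (1 - cos (h t)) * (1 + cos (h t))"
        using mult_left_mono[of 1 "1 + cos (h t)" "1 - cos (h t)"] R t by auto
      also have "\<dots> = sin (h t) ^ 2" by (simp add: sin_squared_eq algebra_simps power2_eq_square)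
      finally have c: "1 - cos (h t) \<le> sin (h t) ^ 2" .
      have "om * (1 - cos (h t)) \<le> om * sin (h t) ^ 2" using c pos by (intro mult_left_mono) auto
      moreover have "lam / 2 * sin (h t)^2 \<le> lam * sin (h t) ^ 2" using pos by (intro mult_right_mono) auto
      ultimately have D1: "D (h t) \<le> (lam + om) * sin (h t)^2" unfolding D_def by (simp add: algebra_simps)
      have "sin (h t) \<le> real n * sin (h t)"
        using mult_right_mono[of 1 "real n" "sin (h t)"] n R t by auto
      then have "sin (h t) \<le> v t" using wp[of t] t unfolding w_def by auto
      moreover have "sin (h t) \<le> h t" using R t by (intro sin_x_le_x) auto
      ultimately have "sin (h t) * sin (h t) \<le> h t * v t" using R t by (intro mult_mono) auto
      then have "(lam + om) * sin (h t)^2 \<le> (lam + om) * (h t * v t)"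
        unfolding power2_eq_square using pos by (intro mult_left_mono) auto
      with D1 have D2: "D (h t) \<le> (lam + om) * (h t * v t)" by simp
      have "E t \<le> t^2 * ((lam + om) * (h t * v t))"
        using order_trans[OF El[of t] mult_left_mono[OF D2, of "t^2"]] t by auto
      then have "2 * E t / t^3 \<le> 2 * (t^2 * ((lam + om) * (h t * v t))) / t^3"
        using t by (intro divide_right_mono) auto
      also have "\<dots> = (lam + om) * (2 * h t * (v t / t))"
        using t by (simp add: power2_eq_square power3_eq_cube)
      finally show ?thesis by simp
    qed
    ultimately show "\<exists>y. ((\<lambda>r. (lam + om) * (h r)\<^sup>2 - loss r) has_real_derivative y) (at t) \<and> 0 \<le> y" by blast
  qed (use r in auto)
  then show ?thesis by simp
qed

text \<open>The square root, \<open>B\<close> below, bounds \<open>h' = v / r\<close> for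
  \<open>r \<ge> 1\<close>, so the rate \<open>2 E / r^3 \<le> h'^2 / r\<close> is at most
  \<open>(B / R0) h'\<close>. It is integrated against the increase of \<open>h\<close>, which is at
  most \<open>pi\<close>, and not against \<open>r\<close>; a large \<open>R0\<close> makes it
  small.\<close>

lemma loss_later:
  assumes pos: "0 < lam" "0 < om" and R0: "1 \<le> R0" "R0 \<le> r"
    and reg: "\<And>t. 0 < t \<Longrightarrow> t < r \<Longrightarrow> 0 \<le> h t \<and> h t \<le> pi \<and> 0 \<le> v t"
    and hr: "h r \<le> pi" and h0: "0 \<le> h R0"
  shows "loss r \<le> loss R0 + sqrt (real n ^ 2 + lam + 4 * om) / R0 * pi"
proof -
  define B where "B = sqrt (real n ^ 2 + lam + 4 * om)"
  have B: "0 \<le> B" "B^2 = real n ^ 2 + lam + 4 * om" using pos by (auto simp: B_def)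
  have "B / R0 * h R0 - loss R0 \<le> B / R0 * h r - loss r"
  proof (rule DERIV_nonneg_imp_increasing_open[of R0 r "\<lambda>r. B / R0 * h r - loss r"])
    show "continuous_on {R0..r} (\<lambda>r. B / R0 * h r - loss r)"
      unfolding loss_def using R0 by (intro continuous_at_imp_continuous_on) (auto intro!: continuous_intros ch cE cD)
    fix t assume t: "R0 < t" "t < r"
    then have t0: "0 < t" "1 \<le> t" using R0 by auto
    note R = reg[OF t0(1) t(2)]
    have "((\<lambda>r. B / R0 * h r - loss r) has_real_derivative (B / R0 * (v t / t) - 2 * E t / t^3)) (at t)"
      using t0 R R0 by (auto intro!: derivative_eq_intros dh d_loss simp: field_simps)
    moreover have "0 \<le> B / R0 * (v t / t) - 2 * E t / t^3"
    proof -
      have "E t \<le> t^2 * D (h t)" using pos t0 t reg by (intro E_le_D) auto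
      then have v2: "v t ^ 2 \<le> real n ^ 2 * sin (h t) ^ 2 + 2 * t^2 * D (h t)"
        unfolding E_def by simp
      have "D (h t) \<le> lam / 2 * 1 + om * 2" unfolding D_def
        using pos cos_ge_minus_one[of "h t"] by (intro add_mono mult_left_mono) (auto simp: abs_square_le_1)
      then have "2 * t^2 * D (h t) \<le> 2 * t^2 * (lam / 2 + om * 2)" by (intro mult_left_mono) auto
      moreover have "real n ^ 2 * sin (h t) ^ 2 \<le> t^2 * real n ^ 2"
      proof -
        have "sin (h t) ^ 2 \<le> 1" by (simp add: abs_square_le_1)
        also have "1 \<le> t^2" using t0 by simp
        finally show ?thesis using mult_left_mono[of "sin (h t) ^ 2" "t^2" "real n ^ 2"] by (simp add: mult.commute)
      qed
      moreover have "t^2 * B^2 = t^2 * real n ^ 2 + 2 * t^2 * (lam / 2 + om * 2)"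
        unfolding B(2) by (simp add: algebra_simps)
      ultimately have "v t ^ 2 \<le> t^2 * B^2" using v2 by linarith
      then have "v t \<le> t * B"
        using t0 B(1) power2_le_imp_le[of "v t" "t * B"] by (simp add: power_mult_distrib)
      then have vB: "v t / t \<le> B" using t0 by (simp add: field_simps)
      have "2 * E t / t^3 \<le> v t ^ 2 / t^3"
        using t0 unfolding E_def by (intro divide_right_mono) auto
      also have "\<dots> = (v t / t) * (v t / t) / t" using t0 by (simp add: power2_eq_square power3_eq_cube)
      also have "\<dots> \<le> B * (v t / t) / R0"
        using vB t0 t R0 R B(1) by (intro frac_le mult_right_mono) auto
      finally show ?thesis by (simp add: mult.commute)
    qed
    ultimately show "\<exists>y. ((\<lambda>r. B / R0 * h r - loss r) has_real_derivative y) (at t) \<and> 0 \<le> y" by blast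
  qed (use R0 in auto)
  moreover have "0 \<le> B / R0 * h R0" using B(1) R0 h0 by auto
  moreover have "B / R0 * h r \<le> B / R0 * pi" using B(1) R0 hr by (intro mult_left_mono) auto
  ultimately show ?thesis unfolding B_def by linarith
qed

text \<open>The budget is \<open>om\<close>. By the choice of \<open>\<eta>\<close>, reaching the
  level \<open>\<eta>\<close> costs at most \<open>om / 2\<close>; by the choice of
  \<open>M\<close>, what happens beyond the radius \<open>M\<close> costs at most
  \<open>om / 2\<close>; and by \<open>small\<close> and \<open>h_growth\<close> the level
  \<open>\<eta>\<close> is reached only beyond \<open>M\<close>. A loss of at most \<open>om\<close>
  leaves no room for a turning point, nor for an \<open>h\<close> that tends to \<open>pi\<close>
  without crossing it, since \<open>D = 2 om\<close> at \<open>pi\<close>.\<close>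

lemma overshoots:
  assumes pos: "0 < lam" "0 < om"
    and a: "((\<lambda>r. h r / r^n) \<longlongrightarrow> a) (at_right 0)"
    and M: "1 \<le> M" "sqrt (real n ^ 2 + lam + 4 * om) / M * pi \<le> om / 2"
    and \<eta>: "0 < \<eta>" "\<eta> \<le> pi / 2" "(lam + om) * \<eta>^2 \<le> om / 2"
    and small: "a * M^n * exp (sqrt (lam + om) * M) < \<eta>" and a0: "0 \<le> a"
  shows "\<exists>r>0. pi < h r \<and> (\<forall>t. 0 < t \<longrightarrow> t \<le> r \<longrightarrow> 0 < v t)"
proof (rule ccontr)
  assume neg: "\<not> ?thesis"
  have hp: "pi / 2 < pi" by simp
  have loss: "loss r \<le> om" if r: "0 < r" and reg: "\<And>t. 0 < t \<Longrightarrow> t < r \<Longrightarrow> 0 < h t \<and> h t < pi \<and> 0 < v t"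
    and hr: "0 < h r" "h r \<le> pi" for r
  proof -
    have mono: "h s \<le> h t" if "0 < s" "s \<le> t" "t \<le> r" for s t
      using that reg by (intro h_mono) (auto intro: less_imp_le)
    show ?thesis
    proof (cases "h r \<le> \<eta>")
      case True
      have "loss r \<le> (lam + om) * h r ^ 2"
      proof (rule loss_initial[OF pos r])
        fix t assume t: "0 < t" "t \<le> r"
        have "0 < h t" using reg[of t] hr t by (cases "t = r") auto
        then show "0 < h t \<and> h t \<le> pi/2" using mono[of t r] t True \<eta> by auto
      qed
      also have "\<dots> \<le> (lam + om) * \<eta>^2" using True hr pos by (intro mult_left_mono power_mono) auto
      finally show ?thesis using \<eta> pos by simp
    next
      case False
      have "eventually (\<lambda>t. 0 < \<eta> - h t) (at_right 0)"
        using h_0 \<eta> by (simp add: order_tendstoD)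
      then obtain R0 where c: "0 < R0" "R0 \<le> r" "\<eta> - h R0 = 0"
        using first_zero[of r "\<lambda>t. \<eta> - h t"] r False ch by (auto intro: continuous_intros)
      have R0: "R0 < r" "h R0 = \<eta>" using c False by (auto simp: order_less_le)
      have MR: "M \<le> R0"
      proof (rule ccontr)
        assume "\<not> M \<le> R0"
        have "\<eta> \<le> a * R0^n * exp (sqrt (lam + om) * R0)"
          unfolding R0(2)[symmetric] using pos c(1) R0(1) reg by (intro h_growth a) (auto intro: less_imp_le)
        also have "\<dots> \<le> a * M^n * exp (sqrt (lam + om) * M)"
          using a0 c \<open>\<not> M \<le> R0\<close> pos M by (intro mult_mono power_mono mult_nonneg_nonneg) auto
        finally show False using small by simp
      qed
      have "loss R0 \<le> (lam + om) * h R0 ^ 2"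
      proof (rule loss_initial[OF pos c(1)])
        fix t assume t: "0 < t" "t \<le> R0"
        then show "0 < h t \<and> h t \<le> pi/2" using mono[of t R0] reg[of t] R0 \<eta> by auto
      qed
      then have 1: "loss R0 \<le> om / 2" using R0 \<eta> by simp
      have "loss r \<le> loss R0 + sqrt (real n ^ 2 + lam + 4 * om) / R0 * pi"
        using M MR R0 reg hr \<eta> by (intro loss_later pos) (auto intro: less_imp_le)
      also have "sqrt (real n ^ 2 + lam + 4 * om) / R0 * pi \<le> sqrt (real n ^ 2 + lam + 4 * om) / M * pi"
        using M MR pos by (intro mult_right_mono divide_left_mono) auto
      finally show ?thesis using 1 M by linarith
    qed
  qed
  have Elow: "r^2 * (D (h r) - om) \<le> E r" if r: "0 < r" and reg: "\<And>t. 0 < t \<Longrightarrow> t < r \<Longrightarrow> 0 < h t \<and> h t < pi \<and> 0 < v t"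
    and hr: "0 < h r" "h r \<le> pi" for r
  proof -
    have "D (h r) - om \<le> E r / r^2" using loss[OF that] unfolding loss_def by simp
    then show ?thesis using r by (simp add: field_simps)
  qed
  have hpos: "0 < h r" if "0 < r" "\<And>t. 0 < t \<Longrightarrow> t < r \<Longrightarrow> 0 < h t \<and> 0 \<le> v t" for r
  proof -
    have "h (r/2) \<le> h r" using that by (intro h_mono) auto
    then show ?thesis using that(1) that(2)[of "r/2"] by auto
  qed
  show False
  proof (cases "\<forall>t>0. h t < pi \<and> 0 < v t")
    case True
    have hp0: "0 < h t" if "0 < t" for t
    proof -
      obtain d where d: "0 < d" "\<And>t. 0 < t \<Longrightarrow> t < d \<Longrightarrow> 0 < h t"
        using at_right_0_ex[OF h_pos_0] by blast
      define s where "s = min (d/2) t"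
      have "0 < s" "s < d" "s \<le> t" using d(1) that by (auto simp: s_def)
      moreover from this have "h s \<le> h t" using True by (intro h_mono) (auto intro: less_imp_le)
      ultimately show ?thesis using d(2)[of s] by auto
    qed
    then have reg: "0 < h t \<and> h t < pi \<and> 0 < v t" if "0 < t" for t using True that by auto
    have lim: "(h \<longlongrightarrow> pi) at_top" using reg pos by (intro tends_to_pi) (auto intro: less_imp_le)
    \<comment> \<open>The limit is \<open>2 om\<close>. The threshold \<open>3/2 om\<close> lies
      between it and the bound \<open>om\<close> of the loss, so that
      \<open>E \<ge> r^2 om / 2\<close> far out and \<open>v\<close> stays away from 0.\<close>
    have "((\<lambda>t. D (h t)) \<longlongrightarrow> lam / 2 * sin pi ^ 2 + om * (1 - cos pi)) at_top"
      unfolding D_def by (intro tendsto_intros lim)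
    then have "eventually (\<lambda>t. 3/2 * om < D (h t)) at_top"
      using pos by (intro order_tendstoD(1)) auto
    then obtain r1 where r1: "\<And>t. r1 \<le> t \<Longrightarrow> 3/2 * om < D (h t)"
      unfolding eventually_at_top_linorder by blast
    define r0 where "r0 = max 1 r1"
    have r0: "1 \<le> r0" "r1 \<le> r0" by (auto simp: r0_def)
    have "sqrt om \<le> v t" if t: "r0 \<le> t" for t
    proof (rule power2_le_imp_le)
      have t1: "1 \<le> t" "0 < t" using t r0 by auto
      have "om / 2 \<le> D (h t) - om" using r1[of t] t r0 by auto
      then have "1 * (om / 2) \<le> t^2 * (D (h t) - om)" using t1 pos by (intro mult_mono) auto
      also have "\<dots> \<le> E t" using t1 reg by (intro Elow) (auto intro: less_imp_le)
      also have "\<dots> \<le> v t ^ 2 / 2" unfolding E_def by (simp add: divide_right_mono)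
      finally show "(sqrt om)\<^sup>2 \<le> v t ^ 2" using pos by simp
      show "0 \<le> v t" using reg[of t] t1 by auto
    qed
    then show False
      using r0 pos reg by (intro no_log_growth[of r0 "sqrt om"]) (auto intro: less_imp_le)
  next
    case False
    then obtain t where t: "0 < t" "min (pi - h t) (v t) \<le> 0" by (auto simp: min_def not_less)
    have "eventually (\<lambda>r. h r < pi) (at_right 0)"
      using h_0 by (rule order_tendstoD) auto
    then have ev: "eventually (\<lambda>r. 0 < min (pi - h r) (min (h r) (v r))) (at_right 0)"
      using v_pos_0[OF add_pos_pos[OF pos(2,1)]] h_pos_0 by eventually_elim auto
    have ci: "isCont (\<lambda>r. min (pi - h r) (min (h r) (v r))) s" if "0 < s" for s
      by (intro continuous_min continuous_intros ch cv that)
    have "min (pi - h t) (min (h t) (v t)) \<le> 0" using t by auto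
    \<comment> \<open>The first point where one of three conditions fails; \<open>hc\<close> rules
      out \<open>h = 0\<close>, which leaves \<open>h = pi\<close> and \<open>v = 0\<close>.\<close>
    then obtain c where c: "0 < c" "min (pi - h c) (min (h c) (v c)) = 0"
       "\<And>s. 0 < s \<Longrightarrow> s < c \<Longrightarrow> 0 < min (pi - h s) (min (h s) (v s))"
      using first_zero[OF ci ev t(1)] by metis
    have reg: "0 < h s \<and> h s < pi \<and> 0 < v s" if "0 < s" "s < c" for s using c(3)[OF that] by auto
    have hc: "0 < h c" using reg c(1) by (intro hpos) (auto intro: less_imp_le)
    have hc': "h c \<le> pi" "0 \<le> v c" using c(2) by linarith+
    have El: "c^2 * (D (h c) - om) \<le> E c" using c(1) reg hc hc' by (intro Elow) auto
    show False
    proof (cases "h c = pi")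
      case True
      then have "0 < c^2 * (D (h c) - om)" using c(1) pos by (simp add: D_def)
      with El have "0 < E c" by linarith
      then have "v c \<noteq> 0" by (auto simp: E_def True)
      then have vc: "0 < v c" using hc' by (simp add: order_less_le)
      obtain d where d: "0 < d" "\<And>x. \<bar>x - c\<bar> < d \<Longrightarrow> 0 < v x"
        using cv[OF c(1)] vc unfolding isCont_def LIM_def
        by (smt (verit, best) dist_real_def zero_less_norm_iff real_norm_def dist_commute)
      have "0 < v c / c" using vc c(1) by simp
      from DERIV_pos_inc_right[OF dh[OF c(1)] this] obtain e where
        e: "0 < e" "\<And>x. 0 < x \<Longrightarrow> x < e \<Longrightarrow> h c < h (c + x)" by auto
      define x where "x = min d e / 2"
      have x: "0 < x" "x < d" "x < e" using d(1) e(1) by (auto simp: x_def)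
      have "\<exists>r>0. pi < h r \<and> (\<forall>t. 0 < t \<longrightarrow> t \<le> r \<longrightarrow> 0 < v t)"
      proof (intro exI[of _ "c + x"] conjI allI impI)
        fix t assume t: "0 < t" "t \<le> c + x"
        then show "0 < v t" using reg[of t] d(2)[of t] x by (cases "t < c") auto
      qed (use e(2)[of x] x c(1) True in auto)
      then show False using neg by blast
    next
      case False
      then have h: "h c < pi" "v c = 0" using hc' hc c(2) by (auto simp: min_def split: if_splits)
      \<comment> \<open>At a turning point \<open>cos h < 0\<close>, so \<open>D > om\<close>; the
        bound on the loss then makes \<open>E\<close> positive although
        \<open>v = 0\<close>.\<close>
      have "om + lam * cos (h c) < 0"
        using c(1) reg hc h pos by (intro turn) (auto intro: less_imp_le)
      then have "lam * cos (h c) < 0" using pos by linarith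
      then have cc: "cos (h c) < 0" using pos by (simp add: mult_less_0_iff)
      have "0 \<le> lam / 2 * sin (h c)^2" using pos by simp
      moreover have "om * cos (h c) < 0" using cc pos by (simp add: mult_less_0_iff)
      ultimately have "0 < D (h c) - om" unfolding D_def by (simp add: algebra_simps)
      then have "0 < c^2 * (D (h c) - om)" using c(1) by simp
      then have "0 < E c" using El by simp
      moreover have "E c \<le> 0" using h by (simp add: E_def)
      ultimately show False by simp
    qed
  qed
qed

end

section \<open>A singular Volterra equation\<close>

lemma deriv_comparison:
  fixes f g f' g' :: "real \<Rightarrow> real"
  assumes ab: "a \<le> b"
    and f: "\<And>x. a < x \<Longrightarrow> x < b \<Longrightarrow> DERIV f x :> f' x" and g: "\<And>x. a < x \<Longrightarrow> x < b \<Longrightarrow> DERIV g x :> g' x"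
    and le: "\<And>x. a < x \<Longrightarrow> x < b \<Longrightarrow> \<bar>f' x\<bar> \<le> g' x"
    and c: "continuous_on {a..b} f" "continuous_on {a..b} g"
  shows "\<bar>f b - f a\<bar> \<le> g b - g a"
proof -
  have "g a - f a \<le> g b - f b"
  proof (rule DERIV_nonneg_imp_increasing_open[OF ab, of "\<lambda>x. g x - f x"])
    fix x assume x: "a < x" "x < b"
    show "\<exists>y. ((\<lambda>x. g x - f x) has_real_derivative y) (at x) \<and> 0 \<le> y"
      using le[OF x] by (intro exI[of _ "g' x - f' x"] conjI DERIV_diff f g x) auto
  qed (intro continuous_intros c)
  moreover have "g a + f a \<le> g b + f b"
  proof (rule DERIV_nonneg_imp_increasing_open[OF ab, of "\<lambda>x. g x + f x"])
    fix x assume x: "a < x" "x < b"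
    show "\<exists>y. ((\<lambda>x. g x + f x) has_real_derivative y) (at x) \<and> 0 \<le> y"
      using le[OF x] by (intro exI[of _ "g' x + f' x"] conjI DERIV_add f g x) auto
  qed (intro continuous_intros c)
  ultimately show ?thesis by auto
qed

lemma integral_from_DERIV:
  fixes f :: "real \<Rightarrow> real"
  assumes "continuous_on {c..} f" "c < x"
  shows "((\<lambda>x. integral {c..x} f) has_real_derivative f x) (at x)"
proof -
  have "((\<lambda>x. integral {c..x} f) has_real_derivative f x) (at x within {c..x+1})"
    using assms by (intro integral_has_real_derivative continuous_on_subset[OF assms(1)]) auto
  moreover have "at x within {c..x+1} = at x" using assms by (intro at_within_interior) auto
  ultimately show ?thesis by simp
qed

text \<open>The solution operator of \<open>x p' + (n + 1) p = g\<close> with \<open>p\<close> bounded at 0. The values for \<open>x < 0\<close> only serve to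
  have two-sided derivatives at 0.\<close>

definition weighted_avg :: "nat \<Rightarrow> (real \<Rightarrow> real) \<Rightarrow> real \<Rightarrow> real" where
  "weighted_avg n g x = (if x \<le> 0 then g 0 / real (n + 1) else integral {0..x} (\<lambda>s. s ^ n * g s) / x ^ (n + 1))"

lemma integral_monomial: "0 \<le> x \<Longrightarrow> integral {0..x} (\<lambda>s. s ^ n * B) = B * x ^ (n + 1) / real (n + 1)" for x B :: real
proof -
  assume x: "0 \<le> x"
  have "((\<lambda>s. s ^ n * B) has_integral (B * x ^ (n + 1) / real (n + 1) - B * 0 ^ (n + 1) / real (n + 1))) {0..x}"
    by (rule fundamental_theorem_of_calculus[OF x])
       (auto intro!: derivative_eq_intros simp: has_real_derivative_iff_has_vector_derivative[symmetric] simp del: power_Suc of_nat_Suc)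
  then have "((\<lambda>s. s ^ n * B) has_integral B * x ^ (n + 1) / real (n + 1)) {0..x}" by simp
  then show ?thesis by (rule integral_unique)
qed

lemma weighted_avg_integrable:
  fixes g :: "real \<Rightarrow> real"
  shows "continuous_on {0..} g \<Longrightarrow> (\<lambda>s. s ^ n * g s) integrable_on {0..x}"
  by (intro integrable_continuous_real continuous_intros) (auto elim: continuous_on_subset)

text \<open>The kernel \<open>s^n / x^(n + 1)\<close> has total mass
  \<open>1 / (n + 1) \<le> 1\<close> on \<open>[0, x]\<close>.\<close>

lemma weighted_avg_le:
  assumes g: "continuous_on {0..} g" and le: "\<And>s. 0 \<le> s \<Longrightarrow> s \<le> x \<Longrightarrow> g s \<le> B" and B: "0 \<le> B" and x: "0 \<le> x"
  shows "weighted_avg n g x \<le> B"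
proof -
  have Bn: "B / real (n + 1) \<le> B" using B by (simp add: divide_le_eq mult_le_cancel_left1)
  show ?thesis
  proof (cases "x \<le> 0")
    case True
    then have "g 0 / real (n + 1) \<le> B / real (n + 1)" using le[of 0] x by (intro divide_right_mono) auto
    then show ?thesis using True Bn by (simp add: weighted_avg_def)
  next
    case False
    have "integral {0..x} (\<lambda>s. s ^ n * g s) \<le> integral {0..x} (\<lambda>s. s ^ n * B)"
      using le by (intro integral_le weighted_avg_integrable g) (auto intro!: mult_left_mono continuous_intros)
    also have "\<dots> = B / real (n + 1) * x ^ (n + 1)" using x by (subst integral_monomial) auto
    finally have "integral {0..x} (\<lambda>s. s ^ n * g s) / x ^ (n + 1) \<le> B / real (n + 1)"
      using False by (simp add: divide_le_eq del: power_Suc)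
    then show ?thesis using False Bn by (simp add: weighted_avg_def del: power_Suc)
  qed
qed

lemma weighted_avg_diff:
  assumes "continuous_on {0..} f" "continuous_on {0..} g"
  shows "weighted_avg n (\<lambda>s. f s - g s) x = weighted_avg n f x - weighted_avg n g x"
  using integral_diff[OF weighted_avg_integrable[OF assms(1), of n x] weighted_avg_integrable[OF assms(2), of n x]]
  by (simp add: weighted_avg_def diff_divide_distrib right_diff_distrib del: power_Suc)

lemma weighted_avg_diff_le:
  assumes c: "continuous_on {0..} f" "continuous_on {0..} g"
    and le: "\<And>s. 0 \<le> s \<Longrightarrow> s \<le> x \<Longrightarrow> \<bar>f s - g s\<bar> \<le> B" and x: "0 \<le> x"
  shows "\<bar>weighted_avg n f x - weighted_avg n g x\<bar> \<le> B"
proof -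
  have B: "0 \<le> B" using le[of 0] x by linarith
  have "weighted_avg n (\<lambda>s. f s - g s) x \<le> B"
    using le B x by (intro weighted_avg_le continuous_intros c) (auto simp: abs_le_iff)
  moreover have "weighted_avg n (\<lambda>s. g s - f s) x \<le> B"
    using le B x by (intro weighted_avg_le continuous_intros c) (force simp: abs_le_iff)+
  ultimately show ?thesis using weighted_avg_diff[OF c] weighted_avg_diff[OF c(2,1)] by (simp add: abs_le_iff)
qed

lemma weighted_avg_abs_le:
  assumes c: "continuous_on {0..} f" and le: "\<And>s. 0 \<le> s \<Longrightarrow> s \<le> x \<Longrightarrow> \<bar>f s\<bar> \<le> B" and x: "0 \<le> x"
  shows "\<bar>weighted_avg n f x\<bar> \<le> B"
proof -
  have "weighted_avg n (\<lambda>_. 0) x = 0" by (simp add: weighted_avg_def)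
  then show ?thesis using weighted_avg_diff_le[of f "\<lambda>_. 0" x B n] assms by simp
qed

lemma weighted_avg_cong: "(\<And>s. 0 \<le> s \<Longrightarrow> f s = g s) \<Longrightarrow> weighted_avg n f x = weighted_avg n g x"
  unfolding weighted_avg_def by (auto intro!: arg_cong[where f = "\<lambda>y. y / _"] integral_cong)

lemma weighted_avg_DERIV:
  assumes c: "continuous_on {0..} g" and x: "0 < x"
  shows "(weighted_avg n g has_real_derivative (g x - real (n + 1) * weighted_avg n g x) / x) (at x)"
proof -
  let ?I = "\<lambda>x. integral {0..x} (\<lambda>s. s ^ n * g s)"
  have "((\<lambda>x. ?I x / x ^ (n + 1)) has_real_derivative
     (x ^ n * g x * x ^ (n + 1) - ?I x * (real (n + 1) * x ^ n)) / (x ^ (n + 1) * x ^ (n + 1))) (at x)"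
    using x by (intro DERIV_divide integral_from_DERIV[of 0 "\<lambda>s. s ^ n * g s"])
      (auto intro!: continuous_intros c derivative_eq_intros simp del: power_Suc)
  moreover have "(x ^ n * g x * x ^ (n + 1) - ?I x * (real (n + 1) * x ^ n)) / (x ^ (n + 1) * x ^ (n + 1))
      = (g x - real (n + 1) * (?I x / x ^ (n + 1))) / x"
    using x by (simp add: field_simps)
  ultimately have "((\<lambda>x. ?I x / x ^ (n + 1)) has_real_derivative (g x - real (n + 1) * weighted_avg n g x) / x) (at x)"
    using x by (simp add: weighted_avg_def del: power_Suc)
  then show ?thesis
    by (rule has_field_derivative_transform_within_open[of _ _ _ "{0<..}"]) (use x in \<open>auto simp: weighted_avg_def\<close>)
qed

text \<open>At 0 the quotient is of the form 0/0. By l'Hopital's rule it behaves like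
  \<open>x^n g x / ((n + 1) x^n)\<close>, whose limit is the value that the definition prescribes
  for \<open>x \<le> 0\<close>.\<close>

lemma weighted_avg_isCont:
  assumes c: "continuous_on {0..} g"
  shows "isCont (weighted_avg n g) x"
proof -
  consider "x < 0" | "x = 0" | "0 < x" by linarith
  then show ?thesis
  proof cases
    case 1
    have "isCont (\<lambda>_. g 0 / real (n + 1)) x" by simp
    moreover have "eventually (\<lambda>y. y < 0) (nhds x)" using 1 by (intro eventually_nhds_in_open[of "{..<0}", simplified]) auto
    then have "eventually (\<lambda>y. weighted_avg n g y = g 0 / real (n + 1)) (nhds x)"
      by eventually_elim (simp add: weighted_avg_def)
    ultimately show ?thesis by (simp add: isCont_cong)
  next
    case 3 then show ?thesis using weighted_avg_DERIV[OF c] by (blast intro: DERIV_isCont)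
  next
    case 2
    let ?I = "\<lambda>x. integral {0..x} (\<lambda>s. s ^ n * g s)"
    have gr: "(g \<longlongrightarrow> g 0) (at_right 0)"
      using c[unfolded continuous_on_def, rule_format, of 0] by (simp add: at_within_Ici_at_right)
    have ci: "continuous_on {0..1} ?I" by (intro indefinite_integral_continuous_1 weighted_avg_integrable c)
    then have I0: "(?I \<longlongrightarrow> 0) (at_right 0)"
      by (auto simp: continuous_on_def at_within_Icc_at_right dest!: bspec[of _ _ 0])
    have "((\<lambda>x. ?I x / x ^ (n + 1)) \<longlongrightarrow> g 0 / real (n + 1)) (at_right 0)"
    proof (rule lhopital_right_0[OF I0])
      show "((\<lambda>x::real. x ^ (n + 1)) \<longlongrightarrow> 0) (at_right 0)"
        by (rule tendsto_eq_intros refl | simp)+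
      show "eventually (\<lambda>x::real. x ^ (n + 1) \<noteq> 0) (at_right 0)"
        by (auto simp: eventually_at_right_field intro!: exI[of _ 1])
      show "eventually (\<lambda>x::real. real (n + 1) * x ^ n \<noteq> 0) (at_right 0)"
        unfolding eventually_at_right_field by (intro exI[of _ 1]) auto
      show "eventually (\<lambda>x. DERIV ?I x :> x ^ n * g x) (at_right 0)"
        unfolding eventually_at_right_field
        by (intro exI[of _ 1]) (auto intro!: integral_from_DERIV[of 0 "\<lambda>s. s ^ n * g s"] continuous_intros c)
      show "eventually (\<lambda>x::real. DERIV (\<lambda>x. x ^ (n + 1)) x :> real (n + 1) * x ^ n) (at_right 0)"
        by (intro always_eventually allI) (auto intro!: derivative_eq_intros simp del: power_Suc)
      have "((\<lambda>x. g x / real (n + 1)) \<longlongrightarrow> g 0 / real (n + 1)) (at_right 0)"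
        by (intro tendsto_intros gr) auto
      moreover have "eventually (\<lambda>x. g x / real (n + 1) = x ^ n * g x / (real (n + 1) * x ^ n)) (at_right 0)"
        by (auto simp: eventually_at_right_field intro!: exI[of _ 1])
      ultimately show "((\<lambda>x. x ^ n * g x / (real (n + 1) * x ^ n)) \<longlongrightarrow> g 0 / real (n + 1)) (at_right 0)"
        by (rule Lim_transform_eventually)
    qed
    moreover have "eventually (\<lambda>x. ?I x / x ^ (n + 1) = weighted_avg n g x) (at_right 0)"
      by (auto simp: eventually_at_right_field weighted_avg_def intro!: exI[of _ 1])
    ultimately have "(weighted_avg n g \<longlongrightarrow> g 0 / real (n + 1)) (at_right 0)"
      by (rule Lim_transform_eventually)
    moreover have "(weighted_avg n g \<longlongrightarrow> g 0 / real (n + 1)) (at_left 0)"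
    proof (rule Lim_transform_eventually[OF tendsto_const])
      show "eventually (\<lambda>x. g 0 / real (n + 1) = weighted_avg n g x) (at_left 0)"
        by (auto simp: eventually_at_left_field weighted_avg_def intro!: exI[of _ "-1"])
    qed
    ultimately show ?thesis unfolding isCont_def 2 by (auto simp: filterlim_at_split weighted_avg_def)
  qed
qed

lemma weighted_avg_continuous_on: "continuous_on {0..} g \<Longrightarrow> continuous_on S (weighted_avg n g)"
  by (intro continuous_at_imp_continuous_on ballI) (rule weighted_avg_isCont)

text \<open>The integrated form of \<open>x k'' + (n + 1) k' = G x (k x)\<close> with
  \<open>k 0 = a\<close>, where \<open>p\<close> stands for \<open>k'\<close>. The equation is
  imposed for \<open>x \<ge> 0\<close>; the larger domain \<open>x > -1\<close> gives
  \<open>k\<close> a two-sided derivative at 0.\<close>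

definition volterra_solution :: "nat \<Rightarrow> (real \<Rightarrow> real \<Rightarrow> real) \<Rightarrow> real \<Rightarrow> (real \<Rightarrow> real) \<Rightarrow> (real \<Rightarrow> real) \<Rightarrow> bool" where
  "volterra_solution n G a k p \<longleftrightarrow> k 0 = a \<and> (\<forall>x>-1. (k has_real_derivative p x) (at x)) \<and> (\<forall>x. isCont p x) \<and>
     (\<forall>x\<ge>0. p x = weighted_avg n (\<lambda>s. G s (k s)) x)"

lemma volterra_solution_continuous_k: "volterra_solution n G a k p \<Longrightarrow> S \<subseteq> {0..} \<Longrightarrow> continuous_on S k"
  unfolding volterra_solution_def by (intro continuous_at_imp_continuous_on) (force intro: DERIV_isCont)

lemma volterra_solution_continuous_G:
  assumes G: "continuous_on ({0..} \<times> UNIV) (\<lambda>(s, y). G s y)" and s: "volterra_solution n G a k p"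
  shows "continuous_on {0..} (\<lambda>s. G s (k s))"
proof -
  have "continuous_on {0..} (\<lambda>s. (\<lambda>(s, y). G s y) (s, k s))"
    by (rule continuous_on_compose2[OF G]) (auto intro!: continuous_intros volterra_solution_continuous_k[OF s])
  then show ?thesis by simp
qed

text \<open>Banach's fixed point theorem in the supremum norm weighted by
  \<open>exp (- M x)\<close>: with \<open>M = 2 L\<close> the operator is a contraction on the whole
  half-line at once, without continuation from short intervals. The bound on \<open>G\<close> limits
  the iterates to linear growth, hence to the weighted space.\<close>

lemma volterra_solution_exists:
  assumes G: "continuous_on ({0..} \<times> UNIV) (\<lambda>(s, y). G s y)"
    and lip: "\<And>s x y. 0 \<le> s \<Longrightarrow> \<bar>G s x - G s y\<bar> \<le> L * \<bar>x - y\<bar>" and L: "0 < L"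
    and bnd: "\<And>s x. 0 \<le> s \<Longrightarrow> \<bar>G s x\<bar> \<le> B"
  shows "\<exists>k p. volterra_solution n G a k p"
proof -
  define M where "M = 2 * L"
  have M: "0 < M" using L by (simp add: M_def)
  \<comment> \<open>The unknown is \<open>y x = exp (- M x) * k x\<close>; this turns the weighted
    norm into the norm of bounded continuous functions.\<close>
  define g where "g y s = G s (exp (M * s) * apply_bcontfun y s)" for y :: "real \<Rightarrow>\<^sub>C real" and s
  \<comment> \<open>Integrating from -1 and subtracting the value at 0 makes \<open>P\<close>
    differentiable from both sides at 0.\<close>
  define P where "P y x = integral {-1..x} (weighted_avg n (g y)) - integral {-1..0} (weighted_avg n (g y))" for y x
  have gc: "continuous_on {0..} (g y)" for y
  proof -
    have "continuous_on {0..} (\<lambda>s. (\<lambda>(s, y). G s y) (s, exp (M * s) * apply_bcontfun y s))"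
      by (rule continuous_on_compose2[OF G]) (auto intro!: continuous_intros)
    then show ?thesis by (simp add: g_def)
  qed
  have dP: "(P y has_real_derivative weighted_avg n (g y) x) (at x)" if "-1 < x" for x y
    unfolding P_def using that
    by (auto intro!: derivative_eq_intros integral_from_DERIV[of "-1"] weighted_avg_continuous_on gc)
  have cP: "continuous_on S (P y)" if "S \<subseteq> {0..}" for S y
    using that dP[of _ y] by (intro continuous_at_imp_continuous_on) (force intro: DERIV_isCont)
  have P0: "P y 0 = 0" for y by (simp add: P_def)
  \<comment> \<open>Bounded continuous functions live on the whole line; \<open>max 0 x\<close>
    extends the values on the half-line by a constant.\<close>
  define Q where "Q y x = exp (- M * max 0 x) * (a + P y (max 0 x))" for y x
  have Pb: "\<bar>P y x\<bar> \<le> B * x" if x: "0 \<le> x" for y x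
  proof -
    have "\<bar>P y x - P y 0\<bar> \<le> B * x - B * 0"
    proof (rule deriv_comparison[OF x, of "P y" "weighted_avg n (g y)" "\<lambda>x. B * x" "\<lambda>_. B"])
      fix s assume "0 < s" "s < x"
      then show "\<bar>weighted_avg n (g y) s\<bar> \<le> B"
        using bnd by (intro weighted_avg_abs_le gc) (auto simp: g_def)
    qed (auto intro!: dP cP continuous_intros derivative_eq_intros)
    then show ?thesis by (simp add: P0)
  qed
  have Qb: "Q y \<in> bcontfun" for y
  proof -
    have B0: "0 \<le> B" using bnd[of 0 0] by simp
    have "\<bar>Q y x\<bar> \<le> \<bar>a\<bar> + B / M" for x
    proof -
      define t where "t = max 0 x"
      have t: "0 \<le> t" by (simp add: t_def)
      have "M * t \<le> exp (M * t)" using exp_ge_add_one_self[of "M * t"] by linarith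
      then have et: "exp (- M * t) * t \<le> 1 / M" using M by (simp add: exp_minus field_simps)
      have e1: "exp (- M * t) \<le> 1" using M t by simp
      have "\<bar>Q y x\<bar> = exp (- M * t) * \<bar>a + P y t\<bar>" by (simp add: Q_def t_def abs_mult)
      also have "\<dots> \<le> exp (- M * t) * (\<bar>a\<bar> + B * t)"
        using Pb[OF t, of y] by (intro mult_left_mono) auto
      also have "\<dots> = exp (- M * t) * \<bar>a\<bar> + B * (exp (- M * t) * t)" by (simp add: algebra_simps)
      also have "\<dots> \<le> 1 * \<bar>a\<bar> + B * (1 / M)"
        using e1 et B0 by (intro add_mono mult_left_mono mult_right_mono) auto
      finally show ?thesis by simp
    qed
    then have "bounded (range (Q y))" by (auto simp: bounded_iff)
    moreover have m: "0 \<le> max 0 x" for x :: real by simp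
    moreover have "continuous_on UNIV (\<lambda>x. P y (max 0 x))"
    proof (rule continuous_on_compose2[OF cP[of "{0..}"]])
      show "continuous_on UNIV (\<lambda>x::real. max 0 x)" by (intro continuous_intros)
      show "(\<lambda>x::real. max 0 x) ` UNIV \<subseteq> {0..}" using m by blast
    qed simp
    then have "continuous_on UNIV (Q y)" unfolding Q_def
      by (intro continuous_intros)
    ultimately show ?thesis by (simp add: bcontfun_def)
  qed
  define \<Psi> where "\<Psi> y = Bcontfun (Q y)" for y
  have \<Psi>: "apply_bcontfun (\<Psi> y) = Q y" for y unfolding \<Psi>_def by (simp add: Bcontfun_inverse Qb)
  have "\<exists>!y. \<Psi> y = y"
  proof (rule banach_fix_type[of "1/2"], simp, simp, intro allI, rule dist_bound)
    fix y z :: "real \<Rightarrow>\<^sub>C real" and x :: real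
    define t where "t = max 0 x"
    have t: "0 \<le> t" by (simp add: t_def)
    define d where "d = dist y z"
    have d0: "0 \<le> d" by (simp add: d_def)
    \<comment> \<open>\<open>L d exp (M s)\<close> integrates to at most
      \<open>(L / M) d exp (M t)\<close>, and \<open>L / M = 1 / 2\<close>.\<close>
    have "\<bar>(P y t - P z t) - (P y 0 - P z 0)\<bar> \<le> d / 2 * exp (M * t) - d / 2 * exp (M * 0)"
    proof (rule deriv_comparison[OF t, where f = "\<lambda>x. P y x - P z x" and f' = "\<lambda>s. weighted_avg n (g y) s - weighted_avg n (g z) s"
        and g = "\<lambda>t. d / 2 * exp (M * t)" and g' = "\<lambda>s. L * d * exp (M * s)"])
      fix s assume s: "0 < s" "s < t"
      show "\<bar>weighted_avg n (g y) s - weighted_avg n (g z) s\<bar> \<le> L * d * exp (M * s)"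
      proof (intro weighted_avg_diff_le gc)
        fix r assume r: "0 \<le> r" "r \<le> s"
        have "\<bar>g y r - g z r\<bar> \<le> L * \<bar>exp (M * r) * apply_bcontfun y r - exp (M * r) * apply_bcontfun z r\<bar>"
          unfolding g_def by (rule lip[OF r(1)])
        also have "\<bar>exp (M * r) * apply_bcontfun y r - exp (M * r) * apply_bcontfun z r\<bar>
            = exp (M * r) * dist (apply_bcontfun y r) (apply_bcontfun z r)"
          by (simp add: dist_real_def abs_mult flip: right_diff_distrib)
        also have "\<dots> \<le> exp (M * s) * d"
          unfolding d_def using r M by (intro mult_mono dist_bounded) auto
        finally show "\<bar>g y r - g z r\<bar> \<le> L * d * exp (M * s)" using L by (simp add: algebra_simps)
      qed (use s in auto)
    qed (auto intro!: derivative_eq_intros continuous_intros dP cP simp: M_def)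
    then have "\<bar>P y t - P z t\<bar> \<le> d / 2 * exp (M * t)"
      using d0 unfolding P0 by simp
    then have "exp (- M * t) * \<bar>P y t - P z t\<bar> \<le> exp (- M * t) * (d / 2 * exp (M * t))"
      by (intro mult_left_mono) auto
    also have "\<dots> = 1/2 * d" by (simp add: exp_minus)
    finally show "dist (apply_bcontfun (\<Psi> y) x) (apply_bcontfun (\<Psi> z) x) \<le> 1/2 * dist y z"
      unfolding \<Psi> Q_def dist_real_def t_def[symmetric] d_def[symmetric]
      by (simp add: abs_mult flip: right_diff_distrib)
  qed
  then obtain y where y: "\<Psi> y = y" by auto
  define k where "k x = a + P y x" for x
  have k: "exp (M * x) * apply_bcontfun y x = k x" if "0 \<le> x" for x
  proof -
    have "apply_bcontfun y x = Q y x" by (metis \<Psi> y)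
    then show ?thesis using that by (simp add: Q_def k_def exp_minus)
  qed
  have "volterra_solution n G a k (weighted_avg n (g y))"
    unfolding volterra_solution_def
  proof (intro conjI allI impI)
    show "k 0 = a" by (simp add: k_def P0)
    show "(k has_real_derivative weighted_avg n (g y) x) (at x)" if "-1 < x" for x
      unfolding k_def using that by (auto intro!: derivative_eq_intros dP)
    show "isCont (weighted_avg n (g y)) x" for x by (intro weighted_avg_isCont gc)
    show "weighted_avg n (g y) x = weighted_avg n (\<lambda>s. G s (k s)) x" if "0 \<le> x" for x
      by (rule weighted_avg_cong) (simp add: g_def k)
  qed
  then show ?thesis by blast
qed

text \<open>The contraction estimate again, for the maximum \<open>d\<close> of
  \<open>exp (- M t) |k t - l t|\<close> over \<open>[0, R]\<close>, attained at \<open>c\<close>.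
  Integrating the difference of the slopes gives
  \<open>d exp (M c) \<le> (d / 2) exp (M c) + \<delta> R\<close>, hence
  \<open>d \<le> 2 \<delta> R\<close>.\<close>

lemma volterra_solution_stable:
  assumes G: "continuous_on ({0..} \<times> UNIV) (\<lambda>(s, y). G s y)" "continuous_on ({0..} \<times> UNIV) (\<lambda>(s, y). H s y)"
    and lip: "\<And>s x y. 0 \<le> s \<Longrightarrow> \<bar>G s x - G s y\<bar> \<le> L * \<bar>x - y\<bar>" and L: "0 < L"
    and close: "\<And>s x. 0 \<le> s \<Longrightarrow> \<bar>G s x - H s x\<bar> \<le> \<delta>"
    and s1: "volterra_solution n G a k p" and s2: "volterra_solution n H a l q"
    and x: "0 \<le> x" "x \<le> R"
  shows "\<bar>k x - l x\<bar> \<le> \<delta> * (2 * R * exp (2 * L * R))"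
    and "\<bar>p x - q x\<bar> \<le> \<delta> * (L * (2 * R * exp (2 * L * R)) + 1)"
proof -
  have R: "0 \<le> R" using x by simp
  have \<delta>: "0 \<le> \<delta>" using close[of 0 0] by simp
  define M where "M = 2 * L"
  have M: "0 < M" using L by (simp add: M_def)
  define \<phi> where "\<phi> t = exp (- M * t) * \<bar>k t - l t\<bar>" for t
  have ck: "continuous_on {0..R} k" "continuous_on {0..R} l"
    by (rule volterra_solution_continuous_k[OF s1], simp, rule volterra_solution_continuous_k[OF s2], simp)
  have "continuous_on {0..R} \<phi>" unfolding \<phi>_def by (intro continuous_intros ck)
  then obtain c where c: "0 \<le> c" "c \<le> R" "\<And>t. 0 \<le> t \<Longrightarrow> t \<le> R \<Longrightarrow> \<phi> t \<le> \<phi> c"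
    using continuous_attains_sup[of "{0..R}" \<phi>] R by auto
  define d where "d = \<phi> c"
  have d0: "0 \<le> d" by (simp add: d_def \<phi>_def)
  have kd: "\<bar>k t - l t\<bar> \<le> d * exp (M * t)" if "0 \<le> t" "t \<le> R" for t
    using c(3)[OF that] unfolding d_def by (simp add: \<phi>_def exp_minus field_simps)
  have pd: "\<bar>p t - q t\<bar> \<le> L * d * exp (M * t) + \<delta>" if t: "0 \<le> t" "t \<le> R" for t
  proof -
    have "\<bar>weighted_avg n (\<lambda>s. G s (k s)) t - weighted_avg n (\<lambda>s. H s (l s)) t\<bar> \<le> L * d * exp (M * t) + \<delta>"
    proof (intro weighted_avg_diff_le volterra_solution_continuous_G[OF G(1) s1] volterra_solution_continuous_G[OF G(2) s2])
      fix r assume r: "0 \<le> r" "r \<le> t"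
      have "\<bar>G r (k r) - H r (l r)\<bar> \<le> L * \<bar>k r - l r\<bar> + \<delta>"
        using lip[OF r(1), of "k r" "l r"] close[OF r(1), of "l r"] by linarith
      also have "\<bar>k r - l r\<bar> \<le> d * exp (M * r)" using kd[of r] r t by auto
      also have "\<dots> \<le> d * exp (M * t)" using r M d0 by (intro mult_left_mono) auto
      finally show "\<bar>G r (k r) - H r (l r)\<bar> \<le> L * d * exp (M * t) + \<delta>" using L by (simp add: mult.assoc)
    qed (use t in auto)
    then show ?thesis using s1 s2 t unfolding volterra_solution_def by simp
  qed
  have "\<bar>(k c - l c) - (k 0 - l 0)\<bar> \<le> (d / 2 * exp (M * c) + \<delta> * c) - (d / 2 * exp (M * 0) + \<delta> * 0)"
  proof (rule deriv_comparison[OF c(1), where f = "\<lambda>t. k t - l t" and f' = "\<lambda>t. p t - q t"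
      and g = "\<lambda>t. d / 2 * exp (M * t) + \<delta> * t" and g' = "\<lambda>t. L * d * exp (M * t) + \<delta>"])
    show "continuous_on {0..c} (\<lambda>t. k t - l t)"
      using c by (intro continuous_intros continuous_on_subset[OF ck(1)] continuous_on_subset[OF ck(2)]) auto
  qed (use s1 s2 pd c in \<open>auto simp: volterra_solution_def M_def intro!: derivative_eq_intros continuous_intros\<close>)
  moreover have "k 0 = l 0" using s1 s2 by (simp add: volterra_solution_def)
  moreover have "\<delta> * c \<le> \<delta> * R" using \<delta> c by (intro mult_left_mono) auto
  ultimately have "\<bar>k c - l c\<bar> \<le> d / 2 * exp (M * c) + \<delta> * R" using d0 by simp
  moreover have "d * exp (M * c) = \<bar>k c - l c\<bar>" by (simp add: d_def \<phi>_def exp_minus)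
  ultimately have "d / 2 * exp (M * c) \<le> \<delta> * R" by simp
  moreover have "d / 2 * 1 \<le> d / 2 * exp (M * c)" using d0 M c by (intro mult_left_mono) auto
  ultimately have d: "d \<le> 2 * (\<delta> * R)" by simp
  have e: "d * exp (M * x) \<le> 2 * (\<delta> * R) * exp (M * R)"
    using d d0 x M by (intro mult_mono) auto
  then show "\<bar>k x - l x\<bar> \<le> \<delta> * (2 * R * exp (2 * L * R))"
    using kd[OF x] unfolding M_def by (simp add: mult_ac)
  have "L * (d * exp (M * x)) \<le> L * (2 * (\<delta> * R) * exp (M * R))"
    using e L by (intro mult_left_mono) auto
  then show "\<bar>p x - q x\<bar> \<le> \<delta> * (L * (2 * R * exp (2 * L * R)) + 1)"
    using pd[OF x] unfolding M_def by (simp add: algebra_simps)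
qed

section \<open>The profile equation as a Volterra equation\<close>

text \<open>\<open>cos (sqrt z)\<close> and \<open>sin (sqrt z) / sqrt z\<close> are needed as
  smooth functions of \<open>z\<close>, across 0 and for negative \<open>z\<close> as well;
  everywhere convergent power series provide this together with all derivatives.\<close>

definition power_series :: "(nat \<Rightarrow> real) \<Rightarrow> real \<Rightarrow> real" where "power_series c x = (\<Sum>i. c i * x ^ i)"

definition entire :: "(nat \<Rightarrow> real) \<Rightarrow> bool" where "entire c \<longleftrightarrow> (\<forall>x. summable (\<lambda>i. c i * x ^ i))"

lemma entire_diffs: "entire c \<Longrightarrow> entire (diffs c)"
  unfolding entire_def by (intro allI termdiff_converges_all) blast

lemma power_series_DERIV: "entire c \<Longrightarrow> (power_series c has_real_derivative power_series (diffs c) x) (at x)"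
  using termdiffs_strong_converges_everywhere[of c x] unfolding entire_def power_series_def by blast

lemma power_series_continuous: "entire c \<Longrightarrow> continuous_on S (power_series c)"
  using power_series_DERIV by (blast intro: DERIV_isCont continuous_at_imp_continuous_on)

lemma entire_bounded:
  assumes "\<And>i. \<bar>c i\<bar> \<le> 1 / fact i"
  shows "entire c"
  unfolding entire_def
proof
  fix x :: real
  show "summable (\<lambda>i. c i * x ^ i)"
  proof (rule summable_comparison_test'[OF summable_exp[of "\<bar>x\<bar>"]])
    fix i :: nat
    show "norm (c i * x ^ i) \<le> inverse (fact i) * \<bar>x\<bar> ^ i"
      using mult_right_mono[OF assms[of i], of "\<bar>x\<bar> ^ i"] by (simp add: abs_mult power_abs inverse_eq_divide)
  qed
qed

definition cos_c :: "nat \<Rightarrow> real" where "cos_c i = (-1) ^ i / fact (2 * i)"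
definition sin_c :: "nat \<Rightarrow> real" where "sin_c i = (-1) ^ i / fact (2 * i + 1)"

lemma entire_cos_c: "entire cos_c"
  by (rule entire_bounded) (auto simp: cos_c_def abs_mult intro!: divide_left_mono fact_mono)

lemma entire_sin_c: "entire sin_c"
proof (rule entire_bounded)
  fix i :: nat
  have "fact i \<le> (fact (2 * i + 1) :: real)" by (rule fact_mono) simp
  then show "\<bar>sin_c i\<bar> \<le> 1 / fact i"
    by (auto simp: sin_c_def abs_mult simp del: fact_Suc intro!: divide_left_mono)
qed

lemma entire_sin_c_Suc: "entire (\<lambda>i. sin_c (Suc i))"
proof (rule entire_bounded)
  fix i :: nat
  have "fact i \<le> (fact (2 * Suc i + 1) :: real)" by (rule fact_mono) simp
  then show "\<bar>sin_c (Suc i)\<bar> \<le> 1 / fact i"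
    by (auto simp: sin_c_def abs_mult simp del: fact_Suc intro!: divide_left_mono)
qed

lemma power_series_cos: "power_series cos_c (y ^ 2) = cos y"
  using sums_unique[OF cos_paired[of y]] by (simp add: power_series_def cos_c_def power_mult)

lemma power_series_sin: "y * power_series sin_c (y ^ 2) = sin y"
proof -
  have "(\<lambda>i. y * (sin_c i * (y ^ 2) ^ i)) sums (y * power_series sin_c (y ^ 2))"
    using entire_sin_c unfolding entire_def power_series_def by (intro sums_mult summable_sums) blast
  moreover have "(\<lambda>i. y * (sin_c i * (y ^ 2) ^ i)) = (\<lambda>i. (- 1) ^ i / fact (2 * i + 1) * y ^ (2 * i + 1))"
    by (auto simp: fun_eq_iff sin_c_def power_mult simp del: fact_Suc)
  ultimately show ?thesis using sums_unique2[OF sin_paired[of y]] by metis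
qed

lemma power_series_sin_Suc: "power_series sin_c x = 1 + x * power_series (\<lambda>i. sin_c (Suc i)) x"
proof -
  have "summable (\<lambda>i. sin_c i * x ^ i)" using entire_sin_c unfolding entire_def by blast
  from powser_split_head(1)[OF this] show ?thesis unfolding power_series_def by (simp add: sin_c_def mult.commute)
qed

text \<open>Up to the factor \<open>1/4\<close>, this is the right-hand side of the equation \<open>x k'' + (n + 1) k' = g\<close> that \<open>h = r ^ n * k (r^2)\<close>
  satisfies, where \<open>x = r^2\<close>. The power series are those of \<open>cos (sqrt z)\<close>, \<open>sin (sqrt z) / sqrt z\<close> and
  \<open>(sin (sqrt z) / sqrt z - 1) / z\<close>.\<close>

definition nonlinearity :: "nat \<Rightarrow> real \<Rightarrow> real \<Rightarrow> real \<Rightarrow> real \<Rightarrow> real \<Rightarrow> real" where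
  "nonlinearity n lam om eps x y = eps * ((om + lam * power_series cos_c (x ^ n * y ^ 2)) * (y * power_series sin_c (x ^ n * y ^ 2)))
     + real n ^ 2 * (4 * x ^ (n - 1) * y ^ 3 * power_series (\<lambda>i. sin_c (Suc i)) (4 * (x ^ n * y ^ 2)))"

lemma forcing_trig:
  assumes "0 < r"
  shows "r ^ n * ((om + lam * power_series cos_c ((r^2) ^ n * y ^ 2)) * (y * power_series sin_c ((r^2) ^ n * y ^ 2)))
    = (om + lam * cos (r ^ n * y)) * sin (r ^ n * y)"
proof -
  have *: "(r^2) ^ n * y ^ 2 = (r ^ n * y) ^ 2" by (simp add: power_mult_distrib power_mult[symmetric] mult.commute)
  show ?thesis unfolding * power_series_cos power_series_sin[of "r ^ n * y", symmetric] by (simp add: algebra_simps)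
qed

text \<open>\<open>sin h cos h - h = (sin (2 h) - 2 h) / 2\<close> is \<open>h^3\<close> times an
  entire function of \<open>h^2\<close>. With \<open>h = r^n y\<close>, division by
  \<open>r^(n + 2)\<close> leaves \<open>r^(2 n - 2) = x^(n - 1)\<close>, a nonnegative power of
  \<open>x\<close> because \<open>n \<ge> 1\<close>: this is why the nonlinearity is regular at
  0.\<close>

lemma nonlinearity_trig:
  assumes r: "0 < r" and n: "1 \<le> n"
  shows "r ^ (n + 2) * nonlinearity n lam om eps (r^2) y
    = eps * r^2 * (om + lam * cos (r ^ n * y)) * sin (r ^ n * y)
      + real n ^ 2 * (sin (r ^ n * y) * cos (r ^ n * y) - r ^ n * y)"
proof -
  define h where "h = r ^ n * y"
  have *: "(r^2) ^ n * y ^ 2 = h ^ 2" by (simp add: h_def power_mult_distrib power_mult[symmetric] mult.commute)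
  have "h + 4 * h ^ 3 * power_series (\<lambda>i. sin_c (Suc i)) (4 * h^2) = h * power_series sin_c (4 * h ^ 2)"
    unfolding power_series_sin_Suc by (simp add: algebra_simps power2_eq_square power3_eq_cube)
  also have "\<dots> = sin (2 * h) / 2" using power_series_sin[of "2 * h"] by (simp add: power_mult_distrib)
  also have "\<dots> = sin h * cos h" by (simp add: sin_double)
  finally have t: "4 * h ^ 3 * power_series (\<lambda>i. sin_c (Suc i)) (4 * h^2) = sin h * cos h - h" by simp
  obtain m where m: "n = Suc m" using n by (cases n) auto
  have "r ^ (n + 2) * (4 * (r^2) ^ (n - 1) * y ^ 3) = 4 * h ^ 3"
    unfolding h_def m by (simp add: power_mult_distrib power_mult[symmetric] power2_eq_square power3_eq_cube power_mult algebra_simps)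
  then have 2: "r ^ (n + 2) * (4 * (r^2) ^ (n - 1) * y ^ 3 * power_series (\<lambda>i. sin_c (Suc i)) (4 * h^2)) = sin h * cos h - h"
    unfolding t[symmetric] by (simp only: mult.assoc[symmetric])
  define F where "F = (om + lam * power_series cos_c (h^2)) * (y * power_series sin_c (h^2))"
  have F: "r ^ n * F = (om + lam * cos h) * sin h"
    using forcing_trig[OF r, of n om lam y] unfolding * h_def[symmetric] F_def .
  have "r ^ (n + 2) * (eps * F) = eps * r^2 * (r ^ n * F)" by (simp add: power_add power2_eq_square mult_ac)
  then have 1: "r ^ (n + 2) * (eps * F) = eps * r^2 * (om + lam * cos h) * sin h" unfolding F by (simp only: mult.assoc)
  have "r ^ (n + 2) * (eps * F + real n ^ 2 * (4 * (r^2) ^ (n - 1) * y ^ 3 * power_series (\<lambda>i. sin_c (Suc i)) (4 * h^2)))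
    = r ^ (n + 2) * (eps * F) + real n ^ 2 * (r ^ (n + 2) * (4 * (r^2) ^ (n - 1) * y ^ 3 * power_series (\<lambda>i. sin_c (Suc i)) (4 * h^2)))"
    by (simp only: distrib_left mult.left_commute)
  then show ?thesis unfolding nonlinearity_def * h_def[symmetric] F_def[symmetric] 1 2 .
qed

lemma nonlinearity_continuous:
  assumes "continuous_on S f" "continuous_on S g"
  shows "continuous_on S (\<lambda>x. nonlinearity n lam om eps (f x) (g x))"
  unfolding nonlinearity_def
  by (intro continuous_intros assms continuous_on_compose2[OF power_series_continuous[OF entire_cos_c, of UNIV]]
    continuous_on_compose2[OF power_series_continuous[OF entire_sin_c, of UNIV]]
    continuous_on_compose2[OF power_series_continuous[OF entire_sin_c_Suc, of UNIV]]) auto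

lemma le_at_0:
  fixes f :: "real \<Rightarrow> real"
  assumes c: "continuous_on {0..} f" and le: "\<And>x. 0 < x \<Longrightarrow> f x \<le> B" and x: "0 \<le> x"
  shows "f x \<le> B"
proof (cases "x = 0")
  case True
  have "(f \<longlongrightarrow> f 0) (at_right 0)"
    using c[unfolded continuous_on_def, rule_format, of 0] by (simp add: at_within_Ici_at_right)
  then have "f 0 \<le> B"
    by (rule tendsto_upperbound) (auto simp: eventually_at_right_field intro!: exI[of _ 1] le)
  then show ?thesis using True by simp
qed (use le x in auto)

text \<open>The constant must not depend on \<open>x\<close>. For \<open>x > 0\<close> the
  trigonometric form is differentiated in \<open>y\<close>; after division by
  \<open>r^(n + 2)\<close> the critical term is \<open>2 n^2 sin^2 (r^n y) / r^2\<close>, and there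
  the bound \<open>K\<close> on \<open>y\<close> enters. The point \<open>x = 0\<close> follows by
  continuity.\<close>

lemma nonlinearity_lipschitz:
  assumes n: "1 \<le> n" and pos: "0 \<le> lam" "0 \<le> om" "0 \<le> eps" and x: "0 \<le> x"
    and y: "y \<in> {0..K}" "z \<in> {0..K}"
  shows "\<bar>nonlinearity n lam om eps x y - nonlinearity n lam om eps x z\<bar> \<le> (eps * (om + lam) + 2 * real n ^ 2 * (1 + K^2)) * \<bar>y - z\<bar>"
proof (rule le_at_0[OF _ _ x, where f = "\<lambda>x. \<bar>nonlinearity n lam om eps x y - nonlinearity n lam om eps x z\<bar>"])
  show "continuous_on {0..} (\<lambda>x. \<bar>nonlinearity n lam om eps x y - nonlinearity n lam om eps x z\<bar>)"
    by (intro continuous_intros nonlinearity_continuous)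
  fix x :: real assume "0 < x"
  define L where "L = eps * (om + lam) + 2 * real n ^ 2 * (1 + K^2)"
  have *: "\<bar>nonlinearity n lam om eps x b - nonlinearity n lam om eps x a\<bar> \<le> L * (b - a)"
    if ab: "a \<le> b" "0 \<le> a" "b \<le> K" for a b
  proof -
    define r where "r = sqrt x"
    have r: "0 < r" "x = r^2" using \<open>0 < x\<close> by (auto simp: r_def)
    define f where "f y = eps * r^2 * (om + lam * cos (r ^ n * y)) * sin (r ^ n * y)
      + real n ^ 2 * (sin (r ^ n * y) * cos (r ^ n * y) - r ^ n * y)" for y
    define f' where "f' y = eps * r^2 * (r ^ n * (om * cos (r ^ n * y) + lam * (cos (r ^ n * y)^2 - sin (r ^ n * y) ^ 2)))
      + real n ^ 2 * (r ^ n * (cos (r ^ n * y)^2 - sin (r ^ n * y) ^ 2 - 1))" for y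
    have df: "(f has_real_derivative f' y) (at y)" for y
    proof -
      have "(f has_real_derivative
         (eps * r^2 * ((om + lam * cos (r ^ n * y)) * (cos (r ^ n * y) * r ^ n) + (lam * (- sin (r ^ n * y) * r ^ n)) * sin (r ^ n * y))
          + real n ^ 2 * ((sin (r ^ n * y) * (- sin (r ^ n * y) * r ^ n) + (cos (r ^ n * y) * r ^ n) * cos (r ^ n * y)) - r ^ n))) (at y)"
        unfolding f_def by (auto intro!: derivative_eq_intros simp: algebra_simps)
      moreover have "(eps * r^2 * ((om + lam * cos (r ^ n * y)) * (cos (r ^ n * y) * r ^ n) + (lam * (- sin (r ^ n * y) * r ^ n)) * sin (r ^ n * y))
          + real n ^ 2 * ((sin (r ^ n * y) * (- sin (r ^ n * y) * r ^ n) + (cos (r ^ n * y) * r ^ n) * cos (r ^ n * y)) - r ^ n)) = f' y"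
        unfolding f'_def power2_eq_square by (simp add: algebra_simps)
      ultimately show ?thesis by metis
    qed
    define q where "q = r ^ (n + 2)"
    have q: "0 < q" using r by (simp add: q_def)
    have "\<bar>f b - f a\<bar> \<le> q * L * b - q * L * a"
    proof (rule deriv_comparison[OF ab(1), where f = f and f' = f' and g = "\<lambda>y. q * L * y" and g' = "\<lambda>_. q * L"])
      fix y assume y: "a < y" "y < b"
      define s c where "s = sin (r ^ n * y)" and "c = cos (r ^ n * y)"
      have sc: "\<bar>s\<bar> \<le> 1" "\<bar>c\<bar> \<le> 1" "s^2 \<le> 1" "c^2 \<le> 1" by (auto simp: s_def c_def abs_square_le_1)
      \<comment> \<open>For \<open>r \<ge> 1\<close> because \<open>s^2 \<le> 1\<close>, for
        \<open>r < 1\<close> because \<open>s^2 \<le> r^(2 n) K^2 \<le> r^2 K^2\<close>.\<close>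
      have "s^2 \<le> r^2 * (1 + K^2)"
      proof (cases "1 \<le> r")
        case True
        then have "1 * 1 \<le> r^2 * (1 + K^2)" by (intro mult_mono) auto
        then show ?thesis using sc by simp
      next
        case False
        have "s^2 \<le> (r ^ n * y)^2" using abs_sin_x_le_abs_x[of "r ^ n * y"] unfolding s_def by (simp add: abs_le_square_iff)
        also have "\<dots> = (r ^ n)^2 * y^2" by (simp add: power_mult_distrib)
        also have "\<dots> \<le> r^2 * K^2"
          using r False n y ab power_decreasing[of 1 n r] by (intro mult_mono power_mono) auto
        finally show ?thesis by (simp add: algebra_simps add_increasing)
      qed
      then have 1: "real n ^ 2 * (r ^ n * (2 * s^2)) \<le> real n ^ 2 * (r ^ n * (2 * (r^2 * (1 + K^2))))"
        using r by (intro mult_left_mono) auto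
      have "0 \<le> s^2" "0 \<le> c^2" by simp_all
      then have sc2: "\<bar>c^2 - s^2\<bar> \<le> 1" using sc by linarith
      have "\<bar>om * c\<bar> \<le> om * 1" "\<bar>lam * (c^2 - s^2)\<bar> \<le> lam * 1"
        unfolding abs_mult using pos sc sc2 by (auto intro!: mult_left_le)
      then have "\<bar>om * c + lam * (c^2 - s^2)\<bar> \<le> om * 1 + lam * 1" by linarith
      then have "eps * r^2 * (r ^ n * \<bar>om * c + lam * (c^2 - s^2)\<bar>) \<le> eps * r^2 * (r ^ n * (om + lam))"
        using r pos by (intro mult_left_mono) auto
      then have 2: "\<bar>eps * r^2 * (r ^ n * (om * c + lam * (c^2 - s^2)))\<bar> \<le> eps * r^2 * (r ^ n * (om + lam))"
        using r pos by (simp add: abs_mult)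
      have "\<bar>f' y\<bar> \<le> eps * r^2 * (r ^ n * (om + lam)) + real n ^ 2 * (r ^ n * (2 * s^2))"
      proof -
        have cs: "c^2 - s^2 - 1 = - (2 * s^2)" by (simp add: c_def s_def cos_squared_eq)
        have "f' y = eps * r^2 * (r ^ n * (om * c + lam * (c^2 - s^2))) - real n ^ 2 * (r ^ n * (2 * s^2))"
          unfolding f'_def s_def[symmetric] c_def[symmetric] cs by simp
        moreover have "\<bar>real n ^ 2 * (r ^ n * (2 * s^2))\<bar> = real n ^ 2 * (r ^ n * (2 * s^2))"
          using r by simp
        ultimately show ?thesis using 2 by linarith
      qed
      also have "\<dots> \<le> q * L" using 1 unfolding q_def L_def by (simp add: algebra_simps power_add power2_eq_square)
      finally show "\<bar>f' y\<bar> \<le> q * L" .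
      show "((\<lambda>y. q * L * y) has_real_derivative q * L) (at y)"
        by (auto intro!: derivative_eq_intros)
      show "(f has_real_derivative f' y) (at y)" by (rule df)
    next
      show "continuous_on {a..b} f" "continuous_on {a..b} (\<lambda>y. q * L * y)"
        using df by (auto intro!: continuous_at_imp_continuous_on continuous_intros intro: DERIV_isCont)
    qed
    moreover have "f y = q * nonlinearity n lam om eps x y" for y
      unfolding f_def r(2) q_def by (rule nonlinearity_trig[OF r(1) n, symmetric])
    ultimately have "\<bar>q * (nonlinearity n lam om eps x b - nonlinearity n lam om eps x a)\<bar> \<le> q * (L * (b - a))"
      by (simp add: algebra_simps)
    then have "q * \<bar>nonlinearity n lam om eps x b - nonlinearity n lam om eps x a\<bar> \<le> q * (L * (b - a))"
      using q by (simp add: abs_mult)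
    then show ?thesis by (rule mult_left_le_imp_le[OF _ q])
  qed
  have "\<bar>nonlinearity n lam om eps x y - nonlinearity n lam om eps x z\<bar> \<le> L * \<bar>y - z\<bar>"
  proof (cases "y \<le> z")
    case True
    have "\<bar>nonlinearity n lam om eps x z - nonlinearity n lam om eps x y\<bar> \<le> L * (z - y)"
      using y True by (intro *) auto
    also have "z - y = \<bar>y - z\<bar>" using True by simp
    finally show ?thesis by (subst abs_minus_commute)
  next
    case False
    have "\<bar>nonlinearity n lam om eps x y - nonlinearity n lam om eps x z\<bar> \<le> L * (y - z)"
      using y False by (intro *) auto
    also have "y - z = \<bar>y - z\<bar>" using False by simp
    finally show ?thesis .
  qed
  from this[unfolded L_def] show "\<bar>nonlinearity n lam om eps x y - nonlinearity n lam om eps x z\<bar>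
    \<le> (eps * (om + lam) + 2 * real n ^ 2 * (1 + K^2)) * \<bar>y - z\<bar>" .
qed

text \<open>The \<open>n^2\<close> part is nonpositive because \<open>sin h cos h \<le> h\<close>.
  Being one-sided, the bound avoids the quadratic dependence of the Lipschitz constant on
  \<open>K\<close>; the clipping level can therefore be chosen without circularity.\<close>

lemma nonlinearity_le:
  assumes n: "1 \<le> n" and pos: "0 \<le> lam" "0 \<le> om" "0 \<le> eps" and x: "0 \<le> x" and y: "0 \<le> y"
  shows "nonlinearity n lam om eps x y \<le> eps * (om + lam) * y"
proof (rule le_at_0[OF _ _ x, where f = "\<lambda>x. nonlinearity n lam om eps x y"])
  show "continuous_on {0..} (\<lambda>x. nonlinearity n lam om eps x y)" by (intro continuous_intros nonlinearity_continuous)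
  fix x :: real assume x: "0 < x"
  define r where "r = sqrt x"
  have r: "0 < r" "x = r^2" using x by (auto simp: r_def)
  define h where "h = r ^ n * y"
  have h: "0 \<le> h" using r y by (simp add: h_def)
  have "\<bar>om + lam * cos h\<bar> \<le> om + lam"
    using pos by (intro order_trans[OF abs_triangle_ineq] add_mono) (auto simp: abs_mult mult_left_le)
  then have "\<bar>om + lam * cos h\<bar> * \<bar>sin h\<bar> \<le> (om + lam) * h"
    using abs_sin_x_le_abs_x[of h] h pos by (intro mult_mono) auto
  then have "(om + lam * cos h) * sin h \<le> (om + lam) * h" by (simp flip: abs_mult add: abs_le_iff)
  then have 1: "eps * r^2 * ((om + lam * cos h) * sin h) \<le> eps * r^2 * ((om + lam) * h)"
    using pos by (intro mult_left_mono) auto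
  have "sin h * cos h = sin (2 * h) / 2" by (simp add: sin_double)
  also have "\<dots> \<le> h" using sin_x_le_x[of "2 * h"] h by simp
  finally have "real n ^ 2 * (sin h * cos h - h) \<le> 0" by (intro mult_nonneg_nonpos) auto
  define q where "q = r ^ (n + 2)"
  have q: "0 < q" using r by (simp add: q_def)
  from \<open>real n ^ 2 * (sin h * cos h - h) \<le> 0\<close> have "q * nonlinearity n lam om eps x y \<le> eps * r^2 * ((om + lam) * h)"
    using 1 unfolding r(2) q_def nonlinearity_trig[OF r(1) n] h_def[symmetric] by (simp add: mult.assoc)
  also have "\<dots> = q * (eps * (om + lam) * y)" by (simp add: q_def h_def power_add power2_eq_square algebra_simps)
  finally show "nonlinearity n lam om eps x y \<le> eps * (om + lam) * y"
    by (rule mult_left_le_imp_le[OF _ q])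
qed

lemma nonlinearity_eps:
  assumes pos: "0 \<le> lam" "0 \<le> om" and x: "0 \<le> x" and y: "0 \<le> y" "y \<le> K"
  shows "\<bar>nonlinearity n lam om eps x y - nonlinearity n lam om eps' x y\<bar> \<le> \<bar>eps - eps'\<bar> * ((om + lam) * K)"
proof (rule le_at_0[OF _ _ x, where f = "\<lambda>x. \<bar>nonlinearity n lam om eps x y - nonlinearity n lam om eps' x y\<bar>"])
  show "continuous_on {0..} (\<lambda>x. \<bar>nonlinearity n lam om eps x y - nonlinearity n lam om eps' x y\<bar>)"
    by (intro continuous_intros nonlinearity_continuous)
  fix x :: real assume x: "0 < x"
  define r where "r = sqrt x"
  have r: "0 < r" "x = r^2" using x by (auto simp: r_def)
  define h where "h = r ^ n * y"
  have h: "0 \<le> h" using r y by (simp add: h_def)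
  define f where "f = (om + lam * power_series cos_c (x ^ n * y ^ 2)) * (y * power_series sin_c (x ^ n * y ^ 2))"
  have "\<bar>om + lam * cos h\<bar> \<le> om + lam"
    using pos by (intro order_trans[OF abs_triangle_ineq] add_mono) (auto simp: abs_mult mult_left_le)
  then have "\<bar>om + lam * cos h\<bar> * \<bar>sin h\<bar> \<le> (om + lam) * h"
    using abs_sin_x_le_abs_x[of h] h pos by (intro mult_mono) auto
  moreover have "r ^ n * f = (om + lam * cos h) * sin h" unfolding f_def r(2) h_def by (rule forcing_trig[OF r(1)])
  ultimately have "\<bar>r ^ n * f\<bar> \<le> (om + lam) * h" by (simp only: abs_mult)
  also have "(om + lam) * h = r ^ n * ((om + lam) * y)" by (simp add: h_def)
  finally have "\<bar>r ^ n * f\<bar> \<le> r ^ n * ((om + lam) * y)" .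
  then have "r ^ n * \<bar>f\<bar> \<le> r ^ n * ((om + lam) * y)" using r by (simp add: abs_mult)
  then have "\<bar>f\<bar> \<le> (om + lam) * y" by (rule mult_left_le_imp_le) (use r in simp)
  also have "\<dots> \<le> (om + lam) * K" using pos y by (intro mult_left_mono) auto
  finally have f: "\<bar>f\<bar> \<le> (om + lam) * K" .
  have "nonlinearity n lam om eps x y - nonlinearity n lam om eps' x y = (eps - eps') * f"
    unfolding nonlinearity_def f_def by (simp add: algebra_simps)
  then show "\<bar>nonlinearity n lam om eps x y - nonlinearity n lam om eps' x y\<bar> \<le> \<bar>eps - eps'\<bar> * ((om + lam) * K)"
    using mult_left_mono[OF f, of "\<bar>eps - eps'\<bar>"] by (simp only: abs_mult abs_ge_zero)
qed

lemma isCont_at_right: "isCont f a \<Longrightarrow> (f \<longlongrightarrow> f a) (at_right a)" for f :: "real \<Rightarrow> real"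
  by (simp add: isCont_def filterlim_at_split)

section \<open>The ansatz for the profile and the clipped equation\<close>

definition ansatz :: "nat \<Rightarrow> (real \<Rightarrow> real) \<Rightarrow> real \<Rightarrow> real" where "ansatz n k r = r ^ n * k (r^2)"
definition ansatz_slope :: "nat \<Rightarrow> (real \<Rightarrow> real) \<Rightarrow> (real \<Rightarrow> real) \<Rightarrow> real \<Rightarrow> real" where
  "ansatz_slope n k p r = r ^ n * (real n * k (r^2) + 2 * r^2 * p (r^2))"

text \<open>The derivative of \<open>p\<close> may be unbounded at 0. The condition
  \<open>p 0 = g 0 / (n + 1)\<close> makes \<open>x p' = g - (n + 1) p\<close> tend to 0, which is
  what the second derivatives of \<open>k (|x|^2)\<close> at the spatial origin require.\<close>

definition regular :: "nat \<Rightarrow> (real \<Rightarrow> real) \<Rightarrow> (real \<Rightarrow> real) \<Rightarrow> bool" where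
  "regular n k p \<longleftrightarrow> (\<forall>x>-1. (k has_real_derivative p x) (at x)) \<and> (\<forall>x. isCont p x) \<and>
     (\<exists>g. continuous_on {0..} g \<and> p 0 = g 0 / real (n + 1) \<and>
        (\<forall>x>0. (p has_real_derivative (g x - real (n + 1) * p x) / x) (at x)))"

text \<open>Clipping makes the nonlinearity globally Lipschitz. It is inactive as long as \<open>0 \<le> h \<le> pi\<close>: for large
  \<open>r\<close> because \<open>k = h / r ^ n\<close>, for small \<open>r\<close> because \<open>k\<close> has not had the time to grow.\<close>

definition clip :: "real \<Rightarrow> real \<Rightarrow> real" where "clip K y = max 0 (min y K)"

definition clipped :: "nat \<Rightarrow> real \<Rightarrow> real \<Rightarrow> real \<Rightarrow> real \<Rightarrow> real \<Rightarrow> real \<Rightarrow> real" where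
  "clipped n lam om K eps x y = nonlinearity n lam om eps x (clip K y) / 4"

lemma clip: "0 \<le> K \<Longrightarrow> clip K y \<in> {0..K}" "0 \<le> y \<Longrightarrow> y \<le> K \<Longrightarrow> clip K y = y"
  "\<bar>clip K x - clip K y\<bar> \<le> \<bar>x - y\<bar>"
  by (auto simp: clip_def max_def min_def)

lemma clipped_continuous: "continuous_on S (\<lambda>(s, y). clipped n lam om K eps s y)"
  unfolding clipped_def clip_def split_beta by (intro continuous_intros nonlinearity_continuous) auto

context
  fixes n :: nat and lam om e1 K L :: real
  assumes n: "1 \<le> n" and lam: "0 < lam" and om: "0 < om" and e1: "0 < e1" and K: "0 < K"
    and L: "L = e1 * (om + lam) + 2 * real n ^ 2 * (1 + K^2)"
begin

lemma L_pos: "0 < L" unfolding L using lam om e1 by (intro add_pos_nonneg mult_pos_pos) auto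

lemma clipped_lipschitz:
  assumes s: "0 \<le> s" and eps: "0 \<le> eps" "eps \<le> e1"
  shows "\<bar>clipped n lam om K eps s x - clipped n lam om K eps s y\<bar> \<le> L * \<bar>x - y\<bar>"
proof -
  have "\<bar>nonlinearity n lam om eps s (clip K x) - nonlinearity n lam om eps s (clip K y)\<bar>
    \<le> (eps * (om + lam) + 2 * real n ^ 2 * (1 + K^2)) * \<bar>clip K x - clip K y\<bar>"
    using K lam om eps s by (intro nonlinearity_lipschitz n clip) auto
  also have "\<dots> \<le> L * \<bar>x - y\<bar>"
    unfolding L using lam om eps clip(3)[of K x y]
    by (intro mult_mono add_mono mult_right_mono) auto
  finally show ?thesis using L_pos unfolding clipped_def by (simp flip: diff_divide_distrib)
qed

lemma clipped_bounded:
  assumes s: "0 \<le> s" and eps: "0 \<le> eps" "eps \<le> e1"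
  shows "\<bar>clipped n lam om K eps s x\<bar> \<le> L * K"
proof -
  have c0: "clip K 0 = 0" "\<bar>clip K x\<bar> \<le> K" "clip K (clip K x) = clip K x" using K by (auto simp: clip_def)
  have "clipped n lam om K eps s 0 = 0" unfolding clipped_def c0 by (simp add: nonlinearity_def)
  moreover have "clipped n lam om K eps s (clip K x) = clipped n lam om K eps s x" unfolding clipped_def c0 ..
  ultimately have "\<bar>clipped n lam om K eps s x\<bar> \<le> L * \<bar>clip K x\<bar>"
    using clipped_lipschitz[OF s eps, of "clip K x" 0] by simp
  also have "\<dots> \<le> L * K" using L_pos c0 by (intro mult_left_mono) auto
  finally show ?thesis .
qed

lemma clipped_le:
  assumes s: "0 \<le> s" and eps: "0 \<le> eps" "eps \<le> e1"
  shows "clipped n lam om K eps s x \<le> e1 * (om + lam) * K / 4"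
proof -
  have c: "0 \<le> clip K x" "clip K x \<le> K" using clip(1)[of K x] K by auto
  have "nonlinearity n lam om eps s (clip K x) \<le> eps * (om + lam) * clip K x"
    using lam om eps s c by (intro nonlinearity_le n) auto
  also have "\<dots> \<le> e1 * (om + lam) * K"
    using lam om eps c e1 by (intro mult_mono mult_nonneg_nonneg) auto
  finally show ?thesis unfolding clipped_def by simp
qed

lemma solution_regular:
  assumes eps: "0 \<le> eps" "eps \<le> e1" and s: "volterra_solution n (clipped n lam om K eps) 2 k p"
  shows "regular n k p"
  unfolding regular_def
proof (intro conjI allI impI exI[of _ "\<lambda>s. clipped n lam om K eps s (k s)"])
  let ?g = "\<lambda>s. clipped n lam om K eps s (k s)"
  show gc: "continuous_on {0..} ?g" by (rule volterra_solution_continuous_G[OF clipped_continuous s])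
  show "p 0 = ?g 0 / real (n + 1)" using s unfolding volterra_solution_def by (simp add: weighted_avg_def)
  fix x :: real assume x: "0 < x"
  have pa: "p y = weighted_avg n ?g y" if "0 \<le> y" for y using s that unfolding volterra_solution_def by blast
  have "(weighted_avg n ?g has_real_derivative (?g x - real (n + 1) * p x) / x) (at x)"
    using weighted_avg_DERIV[OF gc x, of n] pa[of x] x by simp
  then show "(p has_real_derivative (?g x - real (n + 1) * p x) / x) (at x)"
    by (rule has_field_derivative_transform_within_open[of _ _ _ "{0<..}"]) (use x pa in auto)
qed (use s in \<open>auto simp: volterra_solution_def\<close>)

lemma solution_profile:
  assumes eps: "0 \<le> eps" "eps \<le> e1" and s: "volterra_solution n (clipped n lam om K eps) 2 k p"
    and K_def: "K = 4 + 4 / sqrt (1 / (e1 * (om + lam) + 1)) ^ n"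
  shows "profile n (eps * lam) (eps * om) (ansatz n k) (ansatz_slope n k p)"
    and "((\<lambda>r. ansatz n k r / r ^ n) \<longlongrightarrow> 2) (at_right 0)"
    and "eventually (\<lambda>r. 0 < ansatz_slope n k p r) (at_right 0)"
proof -
  let ?g = "\<lambda>s. clipped n lam om K eps s (k s)"
  have gc: "continuous_on {0..} ?g" by (rule volterra_solution_continuous_G[OF clipped_continuous s])
  have k0: "k 0 = 2" and dk: "\<And>x. -1 < x \<Longrightarrow> (k has_real_derivative p x) (at x)" and cp: "\<And>x. isCont p x"
    and pa: "\<And>y. 0 \<le> y \<Longrightarrow> p y = weighted_avg n ?g y"
    using s unfolding volterra_solution_def by blast+
  have ck: "isCont k x" if "-1 < x" for x using dk[OF that] by (rule DERIV_isCont)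
  have dk2: "((\<lambda>r. k (r^2)) has_real_derivative p (r^2) * (2 * r)) (at r)" for r
  proof -
    have "-1 < r^2" by (rule less_le_trans[of _ 0]) auto
    then show ?thesis
      by (intro DERIV_chain2[where f = k and g = "\<lambda>r. r^2"] dk) (auto intro!: derivative_eq_intros)
  qed
  have ck2: "isCont (\<lambda>r. k (r^2)) r" for r using dk2 by (rule DERIV_isCont)
  have cp2: "isCont (\<lambda>r. p (r^2)) r" for r :: real
    by (rule isCont_o2[of _ "\<lambda>r. r^2" p]) (auto intro: cp)
  have dp: "(p has_real_derivative (?g x - real (n + 1) * p x) / x) (at x)" if x: "0 < x" for x
  proof -
    have "(weighted_avg n ?g has_real_derivative (?g x - real (n + 1) * p x) / x) (at x)"
      using weighted_avg_DERIV[OF gc x, of n] pa[of x] x by simp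
    then show ?thesis
      by (rule has_field_derivative_transform_within_open[of _ _ _ "{0<..}"]) (use x pa in auto)
  qed
  obtain m where m: "n = Suc m" using n by (cases n) auto
  have dh: "(ansatz n k has_real_derivative ansatz_slope n k p r / r) (at r)" if r: "0 < r" for r
  proof -
    have "(ansatz n k has_real_derivative (real n * r ^ (n - 1) * k (r^2) + (p (r^2) * (2 * r)) * r ^ n)) (at r)"
      unfolding ansatz_def by (auto intro!: derivative_eq_intros dk2)
    moreover have "real n * r ^ (n - 1) * k (r^2) + (p (r^2) * (2 * r)) * r ^ n = ansatz_slope n k p r / r"
      unfolding ansatz_slope_def m using r by (simp add: field_simps power2_eq_square)
    ultimately show ?thesis by metis
  qed
  \<comment> \<open>\<open>x0\<close> separates the two reasons why \<open>k\<close> stays below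
    \<open>K\<close>, one for each summand of \<open>K\<close>. Up to \<open>x0\<close> the slope of
    \<open>k\<close> is at most \<open>e1 (om + lam) K / 4\<close>, so
    \<open>k \<le> 2 + K / 4 \<le> K\<close>; beyond \<open>x0\<close> one has
    \<open>k = h / r^n \<le> 4 / sqrt x0 ^ n\<close>.\<close>
  define x0 where "x0 = 1 / (e1 * (om + lam) + 1)"
  have e: "0 \<le> e1 * (om + lam)" using e1 om lam by simp
  have x0: "0 < x0" "e1 * (om + lam) * x0 \<le> 1" using e by (auto simp: x0_def divide_le_eq)
  have kK: "k (r^2) \<le> K" if r: "0 < r" "ansatz n k r \<le> pi" for r
  proof (cases "r^2 \<le> x0")
    case True
    define B where "B = e1 * (om + lam) * K / 4"
    have B: "0 \<le> B" using e K by (simp add: B_def)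
    have "B * 0 - k 0 \<le> B * r^2 - k (r^2)"
    proof (rule DERIV_nonneg_imp_nondecreasing[of 0 "r^2" "\<lambda>x. B * x - k x"])
      fix x assume x: "0 \<le> x" "x \<le> r^2"
      have "p x \<le> B" unfolding pa[OF x(1)] B_def[symmetric] using B x clipped_le[OF _ eps]
        by (intro weighted_avg_le gc) (auto simp: B_def)
      moreover have "((\<lambda>x. B * x - k x) has_real_derivative B - p x) (at x)"
        using x by (auto intro!: derivative_eq_intros dk)
      ultimately show "\<exists>y. ((\<lambda>x. B * x - k x) has_real_derivative y) (at x) \<and> 0 \<le> y" by force
    qed auto
    then have "k (r^2) \<le> 2 + B * r^2" using k0 by simp
    also have "B * r^2 \<le> B * x0" using True B by (intro mult_left_mono) auto
    also have "B * x0 = e1 * (om + lam) * x0 * (K / 4)" by (simp add: B_def)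
    also have "\<dots> \<le> 1 * (K / 4)" using x0 K by (intro mult_right_mono) auto
    finally have "k (r^2) \<le> 2 + K / 4" by simp
    moreover have "4 \<le> K" unfolding K_def using e by simp
    ultimately show ?thesis by simp
  next
    case False
    then have "sqrt x0 \<le> r" using r by (simp add: real_le_lsqrt)
    then have "sqrt x0 ^ n \<le> r ^ n" using x0 by (intro power_mono) auto
    moreover have "k (r^2) = ansatz n k r / r ^ n" using r by (simp add: ansatz_def)
    moreover have "ansatz n k r / r ^ n \<le> 4 / r ^ n" using r pi_less_4 by (intro divide_right_mono) auto
    moreover have "4 / r ^ n \<le> 4 / sqrt x0 ^ n" using calculation(1) x0 r by (intro divide_left_mono) auto
    ultimately show ?thesis unfolding K_def x0_def[symmetric] by linarith
  qed
  have vc: "isCont (ansatz_slope n k p) r" for r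
    unfolding ansatz_slope_def by (intro continuous_intros ck2 cp2)
  have hc: "isCont (ansatz n k) r" for r
    unfolding ansatz_def by (intro continuous_intros ck2)
  have q0: "((\<lambda>r. k (r^2)) \<longlongrightarrow> 2) (at_right 0)"
    using isCont_at_right[OF ck2[of 0]] k0 by simp
  show "((\<lambda>r. ansatz n k r / r ^ n) \<longlongrightarrow> 2) (at_right 0)"
    by (rule Lim_transform_eventually[OF q0]) (auto simp: eventually_at_right_field ansatz_def intro!: exI[of _ 1])
  have kpos: "eventually (\<lambda>r. 0 < k (r^2)) (at_right 0)" using q0 by (rule order_tendstoD) simp
  have r0: "eventually (\<lambda>r. 0 < r) (at_right (0::real))" by (simp add: eventually_at_right_less)
  have "((\<lambda>r. real n * k (r^2) + 2 * r^2 * p (r^2)) \<longlongrightarrow> real n * k (0^2) + 2 * 0^2 * p (0^2)) (at_right 0)"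
  proof -
    have "isCont (\<lambda>r. real n * k (r^2) + 2 * r^2 * p (r^2)) 0" by (intro continuous_intros ck2 cp2)
    then show ?thesis by (rule isCont_at_right)
  qed
  then have "eventually (\<lambda>r. 0 < real n * k (r^2) + 2 * r^2 * p (r^2)) (at_right 0)"
    by (rule order_tendstoD) (use n k0 in simp)
  then show "eventually (\<lambda>r. 0 < ansatz_slope n k p r) (at_right 0)"
    using r0 by eventually_elim (auto simp: ansatz_slope_def)
  show "profile n (eps * lam) (eps * om) (ansatz n k) (ansatz_slope n k p)"
  proof
    show "1 \<le> n" by (rule n)
    show "(ansatz n k \<longlongrightarrow> 0) (at_right 0)"
      using isCont_at_right[OF hc[of 0]] n by (simp add: ansatz_def[of n k 0] power_0_left)
    show "(ansatz_slope n k p \<longlongrightarrow> 0) (at_right 0)"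
      using isCont_at_right[OF vc[of 0]] n by (simp add: ansatz_slope_def[of n k p 0] power_0_left)
    show "eventually (\<lambda>r. 0 < ansatz n k r) (at_right 0)"
      using kpos r0 by eventually_elim (auto simp: ansatz_def)
    fix r :: real assume r: "0 < r"
    show "(ansatz n k has_real_derivative ansatz_slope n k p r / r) (at r)" by (rule dh[OF r])
    show "isCont (ansatz_slope n k p) r" by (rule vc)
    assume h: "0 \<le> ansatz n k r" "ansatz n k r \<le> pi"
    define h' where "h' = ansatz n k r"
    have "0 \<le> k (r^2)" using h(1) r mult_pos_neg[of "r ^ n" "k (r^2)"] by (force simp: ansatz_def)
    then have cl: "clip K (k (r^2)) = k (r^2)" using kK[OF r h(2)] by (intro clip)
    have dp2: "((\<lambda>r. p (r^2)) has_real_derivative ((?g (r^2) - real (n + 1) * p (r^2)) / r^2) * (2 * r)) (at r)"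
    proof -
      have "0 < r^2" using r by simp
      then show ?thesis
        by (intro DERIV_chain2[where f = p and g = "\<lambda>r. r^2"] dp) (auto intro!: derivative_eq_intros)
    qed
    have "(ansatz_slope n k p has_real_derivative
       (real n * r ^ (n - 1) * (real n * k (r^2) + 2 * r^2 * p (r^2))
        + (real n * (p (r^2) * (2 * r)) + (2 * (2 * r) * p (r^2) + ((?g (r^2) - real (n + 1) * p (r^2)) / r^2) * (2 * r) * (2 * r^2))) * r ^ n)) (at r)"
      unfolding ansatz_slope_def using r by (auto intro!: derivative_eq_intros dk2 dp2)
    moreover have "real n * r ^ (n - 1) * (real n * k (r^2) + 2 * r^2 * p (r^2))
        + (real n * (p (r^2) * (2 * r)) + (2 * (2 * r) * p (r^2) + ((?g (r^2) - real (n + 1) * p (r^2)) / r^2) * (2 * r) * (2 * r^2))) * r ^ n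
       = real n ^ 2 * h' / r + r ^ (n + 1) * (4 * ?g (r^2))"
      unfolding h'_def ansatz_def m using r by (simp add: field_simps power2_eq_square)
    moreover have "real n ^ 2 * h' / r + r ^ (n + 1) * (4 * ?g (r^2))
      = real n ^ 2 * sin h' * cos h' / r + r * (eps * om + eps * lam * cos h') * sin h'"
    proof -
      have "r * (r ^ (n + 1) * (4 * ?g (r^2))) = r ^ (n + 2) * nonlinearity n lam om eps (r^2) (k (r^2))"
        unfolding clipped_def cl by simp
      also have "\<dots> = eps * r^2 * (om + lam * cos h') * sin h' + real n ^ 2 * (sin h' * cos h' - h')"
        unfolding nonlinearity_trig[OF r n] h'_def ansatz_def ..
      finally have *: "r ^ (n + 1) * (4 * ?g (r^2)) = (eps * r^2 * (om + lam * cos h') * sin h' + real n ^ 2 * (sin h' * cos h' - h')) / r"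
        using r by (simp add: field_simps del: power_Suc)
      show ?thesis unfolding * using r by (simp add: field_simps power2_eq_square)
    qed
    ultimately show "(ansatz_slope n k p has_real_derivative
      (real n ^ 2 * sin (ansatz n k r) * cos (ansatz n k r) / r + r * (eps * om + eps * lam * cos (ansatz n k r)) * sin (ansatz n k r))) (at r)"
      unfolding h'_def by metis
  qed
qed

end

text \<open>The value \<open>k e 0 = 2\<close> is the limit of \<open>2 arctan (r^n) / r^n\<close>,
  the quotient for \<open>e = 0\<close>. The last clause, Lipschitz dependence on \<open>e\<close>
  on bounded sets, serves both the comparison with \<open>e = 0\<close> and the openness of the two
  alternatives.\<close>

lemma profile_family:
  assumes n: "1 \<le> n" and lam: "0 < lam" and om: "0 < om" and e1: "0 < e1"
  obtains k p :: "real \<Rightarrow> real \<Rightarrow> real" where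
    "\<And>e. 0 \<le> e \<Longrightarrow> e \<le> e1 \<Longrightarrow> regular n (k e) (p e)"
    "\<And>e. 0 \<le> e \<Longrightarrow> e \<le> e1 \<Longrightarrow> k e 0 = 2"
    "\<And>e. 0 \<le> e \<Longrightarrow> e \<le> e1 \<Longrightarrow> profile n (e * lam) (e * om) (ansatz n (k e)) (ansatz_slope n (k e) (p e))"
    "\<And>e. 0 \<le> e \<Longrightarrow> e \<le> e1 \<Longrightarrow> ((\<lambda>r. ansatz n (k e) r / r ^ n) \<longlongrightarrow> 2) (at_right 0)"
    "\<And>e. 0 \<le> e \<Longrightarrow> e \<le> e1 \<Longrightarrow> eventually (\<lambda>r. 0 < ansatz_slope n (k e) (p e) r) (at_right 0)"
    "\<And>R. 0 \<le> R \<Longrightarrow> \<exists>C>0. \<forall>e e' x. 0 \<le> e \<longrightarrow> e \<le> e1 \<longrightarrow> 0 \<le> e' \<longrightarrow> e' \<le> e1 \<longrightarrow> 0 \<le> x \<longrightarrow> x \<le> R \<longrightarrow>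
      \<bar>k e x - k e' x\<bar> \<le> C * \<bar>e - e'\<bar> \<and> \<bar>p e x - p e' x\<bar> \<le> C * \<bar>e - e'\<bar>"
proof -
  define K where "K = 4 + 4 / sqrt (1 / (e1 * (om + lam) + 1)) ^ n"
  have "0 \<le> e1 * (om + lam)" using e1 om lam by simp
  then have K: "0 < K" unfolding K_def by (intro add_pos_nonneg) auto
  define L where "L = e1 * (om + lam) + 2 * real n ^ 2 * (1 + K^2)"
  note facts = n lam om e1 K L_def
  have Lp: "0 < L" by (rule L_pos[OF facts])
  have "\<exists>k p. volterra_solution n (clipped n lam om K e) 2 k p" if "0 \<le> e" "e \<le> e1" for e
    using that by (intro volterra_solution_exists[where L = L and B = "L * K"] clipped_continuous clipped_lipschitz[OF facts] clipped_bounded[OF facts] Lp)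
  then obtain k p where kp: "\<And>e. 0 \<le> e \<Longrightarrow> e \<le> e1 \<Longrightarrow> volterra_solution n (clipped n lam om K e) 2 (k e) (p e)" by metis
  show thesis
  proof (rule that[of k p])
    fix e assume e: "0 \<le> e" "e \<le> e1"
    show "k e 0 = 2" using kp[OF e] by (simp add: volterra_solution_def)
    show "regular n (k e) (p e)" by (rule solution_regular[OF facts e kp[OF e]])
    note S = solution_profile[OF facts e kp[OF e] K_def]
    show "profile n (e * lam) (e * om) (ansatz n (k e)) (ansatz_slope n (k e) (p e))" by (rule S)
    show "((\<lambda>r. ansatz n (k e) r / r ^ n) \<longlongrightarrow> 2) (at_right 0)" by (rule S)
    show "eventually (\<lambda>r. 0 < ansatz_slope n (k e) (p e) r) (at_right 0)" by (rule S)
  next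
    fix R :: real assume R: "0 \<le> R"
    define A where "A = 2 * R * exp (2 * L * R)"
    have A: "0 \<le> A" using R by (simp add: A_def)
    define C where "C = (om + lam) * K * (A + L * A + 1)"
    have omK: "0 < (om + lam) * K" using om lam K by simp
    have C: "0 < C" unfolding C_def using A Lp by (intro mult_pos_pos[OF omK] add_nonneg_pos) auto
    have "\<bar>k e x - k e' x\<bar> \<le> C * \<bar>e - e'\<bar> \<and> \<bar>p e x - p e' x\<bar> \<le> C * \<bar>e - e'\<bar>"
      if e: "0 \<le> e" "e \<le> e1" and e': "0 \<le> e'" "e' \<le> e1" and x: "0 \<le> x" "x \<le> R" for e e' x
    proof -
      define \<delta> where "\<delta> = \<bar>e - e'\<bar> * ((om + lam) * K)"
      have d: "0 \<le> \<delta>" using omK by (simp add: \<delta>_def)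
      have close: "\<bar>clipped n lam om K e s y - clipped n lam om K e' s y\<bar> \<le> \<delta>" if s: "0 \<le> s" for s y
      proof -
        have "\<bar>nonlinearity n lam om e s (clip K y) - nonlinearity n lam om e' s (clip K y)\<bar> \<le> \<delta>"
          unfolding \<delta>_def using clip(1)[of K y] K lam om s by (intro nonlinearity_eps) auto
        then show ?thesis using d unfolding clipped_def by (simp flip: diff_divide_distrib)
      qed
      note st = volterra_solution_stable[OF clipped_continuous clipped_continuous clipped_lipschitz[OF facts _ e] Lp close kp[OF e] kp[OF e'] x]
      have "\<delta> * A \<le> \<delta> * (A + L * A + 1)" "\<delta> * (L * A + 1) \<le> \<delta> * (A + L * A + 1)"
        using d A Lp by (auto intro!: mult_left_mono)
      moreover have "\<delta> * (A + L * A + 1) = C * \<bar>e - e'\<bar>" by (simp add: \<delta>_def C_def)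
      ultimately show ?thesis using st unfolding A_def[symmetric] by linarith
    qed
    then show "\<exists>C>0. \<forall>e e' x. 0 \<le> e \<longrightarrow> e \<le> e1 \<longrightarrow> 0 \<le> e' \<longrightarrow> e' \<le> e1 \<longrightarrow> 0 \<le> x \<longrightarrow> x \<le> R \<longrightarrow>
      \<bar>k e x - k e' x\<bar> \<le> C * \<bar>e - e'\<bar> \<and> \<bar>p e x - p e' x\<bar> \<le> C * \<bar>e - e'\<bar>"
      using C by blast
  qed
qed

section \<open>Shooting\<close>

lemma sin_2arctan: "sin (2 * arctan x) = 2 * x / (1 + x^2)"
proof -
  have p: "0 < 1 + x^2" by (rule add_pos_nonneg) auto
  have "sin (2 * arctan x) = 2 * (x / sqrt (1 + x^2)) * (1 / sqrt (1 + x^2))"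
    by (simp add: sin_double sin_arctan cos_arctan)
  also have "\<dots> = 2 * x / (sqrt (1 + x^2))^2" by (simp add: power2_eq_square)
  finally show ?thesis using p by simp
qed

lemma tan_over_x: "((\<lambda>x::real. tan x / x) \<longlongrightarrow> 1) (at 0)"
proof -
  have "(tan has_real_derivative inverse ((cos 0)\<^sup>2)) (at (0::real))" by (rule DERIV_tan) simp
  then show ?thesis by (simp add: DERIV_def)
qed

context profile
begin

lemma E_zero:
  assumes z: "lam = 0" "om = 0" and c: "0 < c" and reg: "\<And>t. 0 < t \<Longrightarrow> t < c \<Longrightarrow> 0 < h t \<and> h t < pi"
  shows "E c = 0"
proof (rule antisym)
  have dE0: "(E has_real_derivative 0) (at x)" if "0 < x" "x < c" for x
    using dE[of x] reg[of x] that by (simp add: z)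
  show "0 \<le> E c" by (rule ge_limit_at_0[OF _ cE[OF c] c E_0]) (use dE0 in force)
  have "0 \<le> - E c"
  proof (rule ge_limit_at_0[of c "\<lambda>r. - E r"])
    show "((\<lambda>r. - E r) \<longlongrightarrow> 0) (at_right 0)" using tendsto_minus[OF E_0] by simp
    fix x assume "0 < x" "x < c"
    then show "\<exists>y. ((\<lambda>r. - E r) has_real_derivative y) (at x) \<and> 0 \<le> y"
      using dE0[of x] by (force intro!: derivative_eq_intros)
  qed (use c in \<open>auto intro!: continuous_intros cE\<close>)
  then show "E c \<le> 0" by simp
qed

text \<open>Without forcing \<open>E\<close> is constant, hence 0, and \<open>v = n sin h\<close>,
  the sign being that of \<open>v > 0\<close>. Then \<open>tan (h / 2) / r^n\<close> is constant,
  and its value 1 is read off from the limit of \<open>h / r^n\<close>. The range of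
  \<open>h\<close> and the sign of \<open>v\<close> are known only near 0 and are carried along by
  continuation.\<close>

lemma zero_forcing:
  assumes z: "lam = 0" "om = 0" and lim: "((\<lambda>r. h r / r ^ n) \<longlongrightarrow> 2) (at_right 0)"
    and vp: "eventually (\<lambda>r. 0 < v r) (at_right 0)" and r: "0 < r"
  shows "h r = 2 * arctan (r ^ n) \<and> v r = real n * sin (h r) \<and> 0 < h r \<and> h r < pi"
proof -
  have limq: "((\<lambda>r. tan (h r / 2) / r ^ n) \<longlongrightarrow> 1) (at_right 0)"
  proof -
    have "filterlim (\<lambda>r. h r / 2) (at 0) (at_right 0)"
    proof (rule filterlim_atI)
      show "((\<lambda>r. h r / 2) \<longlongrightarrow> 0) (at_right 0)" by (rule tendsto_eq_intros h_0 refl | simp)+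
      show "eventually (\<lambda>r. h r / 2 \<noteq> 0) (at_right 0)" using h_pos_0 by eventually_elim auto
    qed
    from filterlim_compose[OF tan_over_x this]
    have "((\<lambda>r. tan (h r / 2) / (h r / 2)) \<longlongrightarrow> 1) (at_right 0)" .
    from tendsto_mult[OF this tendsto_divide[OF lim tendsto_const[of 2]]]
    have "((\<lambda>r. tan (h r / 2) / (h r / 2) * (h r / r ^ n / 2)) \<longlongrightarrow> 1) (at_right 0)" by simp
    then show ?thesis
      by (rule Lim_transform_eventually) (use h_pos_0 in \<open>eventually_elim, auto\<close>)
  qed
  \<comment> \<open>The strict bounds are assumed on the open interval only, so this applies at the
    first point where one of them could fail and excludes the failure there.\<close>
  have concl: "h c = 2 * arctan (c ^ n) \<and> v c = real n * sin (h c) \<and> 0 < h c \<and> h c < pi"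
    if c: "0 < c" and reg: "\<And>t. 0 < t \<Longrightarrow> t < c \<Longrightarrow> 0 < h t \<and> h t < pi \<and> 0 < v t" and vc: "0 \<le> v c" for c
  proof -
    have h: "h t = 2 * arctan (t ^ n)" if t: "0 < t" "t < c" for t
    proof -
      define q where "q t = tan (h t / 2) / t ^ n" for t
      have dq: "(q has_real_derivative 0) (at s)" if s: "0 < s" "s < c" for s
      proof -
        have R: "0 < h s" "h s < pi" "0 < v s" using reg[OF s] by auto
        have E0: "E s = 0" using s reg by (intro E_zero[OF z]) auto
        have sp: "0 < sin (h s)" using R by (auto intro: sin_gt_zero)
        have "v s ^ 2 = (real n * sin (h s))^2" using E0 unfolding E_def by (simp add: power_mult_distrib)
        then have vs: "v s = real n * sin (h s)" using R sp by (simp add: power2_eq_iff_nonneg)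
        have cp: "cos (h s / 2) \<noteq> 0" using R by (intro less_imp_neq[THEN not_sym] cos_gt_zero) auto
        obtain m where m: "n = Suc m" using n by (cases n) auto
        have "(q has_real_derivative
          ((v s / s / 2 * inverse ((cos (h s / 2))\<^sup>2)) * s ^ n - tan (h s / 2) * (real n * s ^ (n - 1))) / (s ^ n * s ^ n)) (at s)"
          unfolding q_def using s cp by (auto intro!: derivative_eq_intros dh simp: mult_ac)
        moreover have "(v s / s / 2 * inverse ((cos (h s / 2))\<^sup>2)) * s ^ n - tan (h s / 2) * (real n * s ^ (n - 1)) = 0"
        proof -
          have "sin (h s) = 2 * sin (h s / 2) * cos (h s / 2)" using sin_double[of "h s / 2"] by simp
          then have "v s / 2 = real n * (sin (h s / 2) * cos (h s / 2))" unfolding vs by simp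
          then have "v s / s / 2 * inverse ((cos (h s / 2))\<^sup>2) = real n * (sin (h s / 2) / cos (h s / 2)) / s"
            using cp s by (simp add: field_simps power2_eq_square)
          then show ?thesis using s unfolding m by (simp add: tan_def)
        qed
        ultimately show ?thesis by simp
      qed
      have "q t = 1"
      proof (rule antisym)
        have cq: "isCont q t" using dq[OF t] by (rule DERIV_isCont)
        show "1 \<le> q t"
          by (rule ge_limit_at_0[OF _ cq t(1) limq[folded q_def]]) (use dq t in force)
        have "- 1 \<le> - q t"
        proof (rule ge_limit_at_0[of t "\<lambda>r. - q r"])
          show "((\<lambda>r. - q r) \<longlongrightarrow> - 1) (at_right 0)" using tendsto_minus[OF limq] by (simp add: q_def)
          fix x assume "0 < x" "x < t"
          then show "\<exists>y. ((\<lambda>r. - q r) has_real_derivative y) (at x) \<and> 0 \<le> y"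
            using dq[of x] t by (intro exI[of _ 0]) (auto intro!: derivative_eq_intros)
        qed (use t cq in \<open>auto intro!: continuous_intros\<close>)
        then show "q t \<le> 1" by simp
      qed
      then have "tan (h t / 2) = t ^ n" using t by (simp add: q_def)
      moreover have "arctan (tan (h t / 2)) = h t / 2" using reg[OF t] by (intro arctan_tan) auto
      ultimately show ?thesis by simp
    qed
    have hc: "h c = 2 * arctan (c ^ n)"
    proof (rule tendsto_unique[of "at_left c"])
      show "(h \<longlongrightarrow> h c) (at_left c)"
        using ch[OF c] by (simp add: isCont_def filterlim_at_split)
      have "isCont (\<lambda>t. 2 * arctan (t ^ n)) c" by (intro continuous_intros)
      then have "((\<lambda>t. 2 * arctan (t ^ n)) \<longlongrightarrow> 2 * arctan (c ^ n)) (at_left c)"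
        by (simp add: isCont_def filterlim_at_split)
      then show "(h \<longlongrightarrow> 2 * arctan (c ^ n)) (at_left c)"
      proof (rule Lim_transform_eventually)
        show "eventually (\<lambda>t. 2 * arctan (t ^ n) = h t) (at_left c)"
          using c h unfolding eventually_at_left_field by (intro exI[of _ 0]) auto
      qed
    qed simp
    have hp: "0 < h c" "h c < pi" using hc c arctan_ubound[of "c ^ n"] by auto
    have E0: "E c = 0" using c reg by (intro E_zero[OF z]) auto
    have sp: "0 < sin (h c)" using hp by (auto intro: sin_gt_zero)
    have "v c ^ 2 = (real n * sin (h c))^2" using E0 unfolding E_def by (simp add: power_mult_distrib)
    then have "v c = real n * sin (h c)" using vc sp by (simp add: power2_eq_iff_nonneg)
    then show ?thesis using hc hp by simp
  qed
  have "eventually (\<lambda>r. h r < pi) (at_right 0)"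
    using h_0 by (rule order_tendstoD) auto
  then have ev: "eventually (\<lambda>r. 0 < min (pi - h r) (min (h r) (v r))) (at_right 0)"
    using vp h_pos_0 by eventually_elim auto
  have ci: "isCont (\<lambda>r. min (pi - h r) (min (h r) (v r))) s" if "0 < s" for s
    by (intro continuous_min continuous_intros ch cv that)
  have pos: "0 < min (pi - h t) (min (h t) (v t))" if t: "0 < t" for t
  proof (rule ccontr)
    assume "\<not> ?thesis"
    then obtain c where c: "0 < c" "min (pi - h c) (min (h c) (v c)) = 0"
       "\<And>s. 0 < s \<Longrightarrow> s < c \<Longrightarrow> 0 < min (pi - h s) (min (h s) (v s))"
      using first_zero[OF ci ev t] by (metis not_less)
    have reg: "0 < h s \<and> h s < pi \<and> 0 < v s" if "0 < s" "s < c" for s using c(3)[OF that] by auto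
    have "0 \<le> v c" using c(2) by linarith
    note C = concl[OF c(1) reg this]
    then have "0 < sin (h c)" by (auto intro: sin_gt_zero)
    then have "0 < v c" using C n by auto
    then show False using C c(2) by linarith
  qed
  have "0 \<le> v r" using pos[OF r] by auto
  then show ?thesis using pos by (intro concl r) force+
qed

text \<open>Along \<open>2 arctan (r^n)\<close> the derivative of \<open>Z\<close> is
  \<open>- (lam - n om) r S^2\<close>, and \<open>r S^2 \<ge> \<kappa> / r\<close> for
  \<open>1 \<le> r \<le> R\<close>. By \<open>big\<close>, \<open>Z R\<close> is at most
  \<open>- 3 lam \<kappa>\<close> up to errors. The difference
  \<open>E - Z = (lam / 2) R^2 sin^2 h\<close> is at most \<open>2 lam \<kappa>\<close> up to
  errors. One \<open>lam \<kappa>\<close> is left to absorb the errors, which are of size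
  \<open>d\<close>; this is the condition \<open>small\<close>.\<close>

lemma E_negative:
  assumes pos: "0 < lam" "0 < om" and R: "1 \<le> R" and d: "0 \<le> d" "d \<le> 1"
    and close: "\<And>t. 0 < t \<Longrightarrow> t \<le> R \<Longrightarrow> \<bar>sin (h t) - sin (2 * arctan (t ^ n))\<bar> \<le> d \<and>
       \<bar>v t - real n * sin (2 * arctan (t ^ n))\<bar> \<le> d"
    and reg: "\<And>t. 0 < t \<Longrightarrow> t \<le> R \<Longrightarrow> 0 < h t \<and> h t < pi"
    and big: "3 * lam \<le> (lam - real n * om) * ln R"
    and small: "d * (R^2 * (om * (real n + 1) + 4 * lam)) < lam / (R ^ (n - 1))^2"
    and sub: "real n * om < lam"
  shows "E R < 0"
proof -
  obtain m where m: "n = Suc m" using n by (cases n) auto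
  define S where "S t = sin (2 * arctan (t ^ n))" for t
  define c where "c = lam - real n * om"
  define B where "B = om * (real n + 1) + 2 * lam"
  define \<kappa> where "\<kappa> = 1 / (R ^ m)^2"
  have c: "0 < c" using sub by (simp add: c_def)
  have B: "0 \<le> B" using pos by (simp add: B_def)
  have S: "0 \<le> S t" "S t \<le> 1" if "0 < t" for t
  proof -
    show "0 \<le> S t" unfolding S_def sin_2arctan using that by (intro divide_nonneg_nonneg add_nonneg_nonneg) auto
  qed (simp add: S_def)
  define Z where "Z r = E r - lam / 2 * r^2 * sin (h r)^2" for r
  have cZ: "isCont Z r" if "0 < r" for r unfolding Z_def using that by (auto intro!: continuous_intros cE ch)
  have Z0: "(Z \<longlongrightarrow> 0) (at_right 0)"
    unfolding Z_def by (rule tendsto_eq_intros E_0 h_0 refl | simp)+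
  \<comment> \<open>\<open>c S^2\<close> is the rate along the unperturbed profile,
    \<open>B d\<close> bounds the effect of the distance \<open>d\<close> to it.\<close>
  have dZ: "\<exists>y. (Z has_real_derivative y) (at t) \<and> y \<le> t * (B * d - c * S t ^ 2)" if t: "0 < t" "t \<le> R" for t
  proof -
    have "(Z has_real_derivative t * (sin (h t) * (om * v t - lam * sin (h t)))) (at t)"
      unfolding Z_def using reg[OF t] t by (intro d_reduced_energy) auto
    moreover have "sin (h t) * (om * v t - lam * sin (h t)) \<le> B * d - c * S t ^ 2"
    proof -
      define s where "s = sin (h t)"
      define b where "b = om * v t - lam * s"
      define b0 where "b0 = om * (real n * S t) - lam * S t"
      have ds: "\<bar>s - S t\<bar> \<le> d" "\<bar>v t - real n * S t\<bar> \<le> d" using close[OF t] by (auto simp: s_def S_def)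
      have "\<bar>om * (v t - real n * S t)\<bar> \<le> om * d" "\<bar>lam * (s - S t)\<bar> \<le> lam * d"
        using ds pos by (auto simp: abs_mult)
      then have db: "\<bar>b - b0\<bar> \<le> (om + lam) * d" unfolding b_def b0_def by (simp add: algebra_simps abs_le_iff)
      have "\<bar>om * (real n * S t)\<bar> \<le> om * real n" "\<bar>lam * S t\<bar> \<le> lam"
        using S[OF t(1)] pos by (auto simp: abs_mult intro!: mult_left_le)
      then have b0: "\<bar>b0\<bar> \<le> om * real n + lam" unfolding b0_def by linarith
      have "s * b - S t * b0 = s * (b - b0) + (s - S t) * b0" by (simp add: algebra_simps)
      also have "\<dots> \<le> \<bar>s\<bar> * \<bar>b - b0\<bar> + \<bar>s - S t\<bar> * \<bar>b0\<bar>" by (simp add: abs_le_iff flip: abs_mult)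
      also have "\<dots> \<le> 1 * ((om + lam) * d) + d * (om * real n + lam)"
        using db b0 ds d by (intro add_mono mult_mono) (auto simp: s_def)
      also have "\<dots> = B * d" by (simp add: B_def algebra_simps)
      finally have "s * b \<le> S t * b0 + B * d" by simp
      also have "S t * b0 = - (c * S t ^ 2)" by (simp add: b0_def c_def algebra_simps power2_eq_square)
      finally show ?thesis by (simp add: s_def b_def)
    qed
    then have "t * (sin (h t) * (om * v t - lam * sin (h t))) \<le> t * (B * d - c * S t ^ 2)"
      using t by (intro mult_left_mono) auto
    ultimately show ?thesis by metis
  qed
  \<comment> \<open>On \<open>(0, 1]\<close> the negative term is simply dropped; the logarithm is
    collected from 1 on.\<close>
  have Z1: "Z 1 \<le> R * B * d"
  proof -
    have "0 \<le> R * B * d * 1 - Z 1"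
    proof (rule ge_limit_at_0[of 1 "\<lambda>t. R * B * d * t - Z t"])
      show "((\<lambda>t. R * B * d * t - Z t) \<longlongrightarrow> 0) (at_right 0)"
        by (rule tendsto_eq_intros Z0 refl | simp)+
      show "isCont (\<lambda>t. R * B * d * t - Z t) 1" by (intro continuous_intros cZ) auto
      fix t :: real assume t: "0 < t" "t < 1"
      obtain y where y: "(Z has_real_derivative y) (at t)" "y \<le> t * (B * d - c * S t ^ 2)" using dZ[of t] t R by auto
      have "t * (B * d - c * S t ^ 2) \<le> t * (B * d)" using t c by (intro mult_left_mono) auto
      also have "\<dots> \<le> R * (B * d)" using t R B d by (intro mult_right_mono) auto
      finally show "\<exists>y. ((\<lambda>t. R * B * d * t - Z t) has_real_derivative y) (at t) \<and> 0 \<le> y"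
        using y by (intro exI[of _ "R * B * d - y"]) (auto intro!: derivative_eq_intros)
    qed simp
    then show ?thesis by simp
  qed
  have "(R * B * d * 1 - c * \<kappa> * ln 1) - Z 1 \<le> (R * B * d * R - c * \<kappa> * ln R) - Z R"
  proof (rule DERIV_nonneg_imp_nondecreasing[OF R, of "\<lambda>t. (R * B * d * t - c * \<kappa> * ln t) - Z t"])
    fix t assume t: "1 \<le> t" "t \<le> R"
    obtain y where y: "(Z has_real_derivative y) (at t)" "y \<le> t * (B * d - c * S t ^ 2)" using dZ[of t] t by auto
    have tn: "1 \<le> t ^ n" using t by simp
    have "1 / x \<le> 2 * x / (1 + x^2)" if x: "1 \<le> x" for x :: real
    proof -
      have "1 \<le> x^2" using x by simp
      then have "1 / x * (1 + x^2) \<le> 2 * x" using x by (simp add: pos_divide_le_eq power2_eq_square)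
      moreover have "0 < 1 + x^2" by (rule add_pos_nonneg) auto
      ultimately show ?thesis by (simp only: pos_le_divide_eq)
    qed
    then have "1 / t ^ n \<le> S t" unfolding S_def sin_2arctan using tn by blast
    then have "(1 / t ^ n)^2 \<le> S t ^ 2" using tn by (intro power_mono) auto
    then have "c * (t * (1 / t ^ n)^2) \<le> c * (t * S t ^ 2)" using c t by (intro mult_left_mono) auto
    \<comment> \<open>\<open>t^(1 - 2 n) = t^(- 2 m) / t\<close> and \<open>t \<le> R\<close>: this
      treats every degree like the borderline degree \<open>n = 1\<close>.\<close>
    moreover have "\<kappa> / t \<le> t * (1 / t ^ n)^2"
    proof -
      have "(t ^ m)^2 \<le> (R ^ m)^2" using t by (intro power_mono) auto
      then have "\<kappa> \<le> 1 / (t ^ m)^2" unfolding \<kappa>_def using t by (intro divide_left_mono) auto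
      then have "\<kappa> / t \<le> 1 / (t ^ m)^2 / t" using t by (intro divide_right_mono) auto
      also have "\<dots> = t * (1 / t ^ n)^2" using t unfolding m by (simp add: field_simps power2_eq_square)
      finally show ?thesis .
    qed
    then have "c * (\<kappa> / t) \<le> c * (t * (1 / t ^ n)^2)" using c by (intro mult_left_mono) auto
    moreover have "t * (B * d) \<le> R * (B * d)" using t B d by (intro mult_right_mono) auto
    ultimately have "y \<le> R * B * d - c * \<kappa> * (1 / t)" using y(2) by (simp add: algebra_simps)
    then show "\<exists>y. ((\<lambda>t. (R * B * d * t - c * \<kappa> * ln t) - Z t) has_real_derivative y) (at t) \<and> 0 \<le> y"
      using t y by (intro exI[of _ "(R * B * d - c * \<kappa> * (1 / t)) - y"]) (auto intro!: derivative_eq_intros)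
  qed
  then have ZR: "Z R \<le> R * R * B * d - \<kappa> * (c * ln R)" using Z1 by (simp add: algebra_simps)
  have \<kappa>: "0 < \<kappa>" using R by (simp add: \<kappa>_def)
  have "\<kappa> * (3 * lam) \<le> \<kappa> * (c * ln R)" using big \<kappa> unfolding c_def by (intro mult_left_mono) auto
  then have 1: "Z R \<le> R * R * B * d - 3 * lam * \<kappa>" using ZR by (simp add: algebra_simps)
  have sR: "R^2 * sin (h R)^2 \<le> 4 * \<kappa> + 3 * R^2 * d"
  proof -
    have R0: "0 < R" using R by simp
    have SR: "S R \<le> 2 / R ^ n"
    proof -
      have "2 * R ^ n * R ^ n \<le> 2 * (1 + (R ^ n)^2)" by (simp add: power2_eq_square)
      moreover have "0 < 1 + (R ^ n)^2" by (rule add_pos_nonneg) auto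
      ultimately show ?thesis unfolding S_def sin_2arctan using R0 by (simp add: field_simps)
    qed
    have hs: "0 \<le> sin (h R)" using reg[of R] R0 by (intro sin_ge_zero) auto
    have "sin (h R) \<le> S R + d" using close[of R] R0 by (auto simp: S_def abs_le_iff)
    then have "sin (h R)^2 \<le> (S R + d)^2" using hs by (intro power_mono) auto
    also have "\<dots> = S R ^ 2 + 2 * (S R * d) + d * d" by (simp add: power2_eq_square algebra_simps)
    also have "\<dots> \<le> S R ^ 2 + 2 * (1 * d) + 1 * d"
      using S[OF R0] d by (intro add_mono mult_left_mono mult_right_mono) auto
    finally have "R^2 * sin (h R)^2 \<le> R^2 * (S R ^ 2 + 3 * d)" by (intro mult_left_mono) auto
    moreover have "R^2 * S R ^ 2 \<le> 4 * \<kappa>"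
    proof -
      have "R^2 * S R ^ 2 \<le> R^2 * (2 / R ^ n)^2" using SR S[OF R0] by (intro mult_left_mono power_mono) auto
      also have "\<dots> = 4 * \<kappa>" using R0 unfolding m \<kappa>_def by (simp add: field_simps power2_eq_square)
      finally show ?thesis .
    qed
    ultimately show ?thesis by (simp add: algebra_simps)
  qed
  have "E R = Z R + lam / 2 * (R^2 * sin (h R)^2)" by (simp add: Z_def)
  also have "\<dots> \<le> (R * R * B * d - 3 * lam * \<kappa>) + lam / 2 * (4 * \<kappa> + 3 * R^2 * d)"
    using 1 sR pos by (intro add_mono mult_left_mono) auto
  also have "\<dots> \<le> d * (R^2 * (om * (real n + 1) + 4 * lam)) - lam * \<kappa>"
  proof -
    have "0 \<le> lam * (R^2 * d)" using pos d by auto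
    then show ?thesis unfolding B_def by (simp add: algebra_simps power2_eq_square)
  qed
  also have "\<dots> < 0" using small by (simp add: m \<kappa>_def)
  finally show ?thesis .
qed

end

text \<open>\<open>om\<close> and \<open>lam\<close> enter the system only through
  \<open>r^2 om\<close> and \<open>r^2 lam\<close>, while \<open>v = r h'\<close> and the remaining
  terms are invariant under scaling of \<open>r\<close>.\<close>

lemma profile_scale:
  assumes p: "profile n (e * lam) (e * om) h v" and e: "0 < e"
  shows "profile n lam om (\<lambda>r. h (r / sqrt e)) (\<lambda>r. v (r / sqrt e))"
proof -
  interpret p: profile n "e * lam" "e * om" h v by (rule p)
  define c where "c = 1 / sqrt e"
  have c: "0 < c" "e * c^2 = 1" using e by (auto simp: c_def power_divide)
  have at: "filterlim (\<lambda>r. c * r) (at_right 0) (at_right 0)"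
    unfolding filterlim_at
  proof
    show "eventually (\<lambda>r. c * r \<in> {0<..} \<and> c * r \<noteq> 0) (at_right 0)"
      using c(1) unfolding eventually_at_right_field by (intro exI[of _ 1]) auto
  qed (auto intro!: tendsto_eq_intros)
  have "profile n lam om (\<lambda>r. h (c * r)) (\<lambda>r. v (c * r))"
  proof
    show "1 \<le> n" by (rule p.n)
    show "((\<lambda>r. h (c * r)) \<longlongrightarrow> 0) (at_right 0)" by (rule filterlim_compose[OF p.h_0 at])
    show "((\<lambda>r. v (c * r)) \<longlongrightarrow> 0) (at_right 0)" by (rule filterlim_compose[OF p.v_0 at])
    show "eventually (\<lambda>r. 0 < h (c * r)) (at_right 0)"
      using eventually_compose_filterlim[OF p.h_pos_0 at] .
    fix r :: real assume r: "0 < r"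
    then have cr: "0 < c * r" using c by simp
    have "((\<lambda>r. h (c * r)) has_real_derivative (v (c * r) / (c * r)) * c) (at r)"
      by (rule DERIV_chain2[where f = h and g = "\<lambda>r. c * r", OF p.dh[OF cr]]) (auto intro!: derivative_eq_intros)
    then show "((\<lambda>r. h (c * r)) has_real_derivative v (c * r) / r) (at r)" using c by simp
    show "isCont (\<lambda>r. v (c * r)) r"
      by (rule isCont_o2[of _ "\<lambda>r. c * r" v]) (auto intro!: p.cv cr)
    assume h: "0 \<le> h (c * r)" "h (c * r) \<le> pi"
    have "((\<lambda>r. v (c * r)) has_real_derivative
      (real n ^ 2 * sin (h (c * r)) * cos (h (c * r)) / (c * r) + c * r * (e * om + e * lam * cos (h (c * r))) * sin (h (c * r))) * c) (at r)"
      by (rule DERIV_chain2[where f = v and g = "\<lambda>r. c * r", OF p.dv[OF cr h]]) (auto intro!: derivative_eq_intros)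
    moreover have "(real n ^ 2 * sin (h (c * r)) * cos (h (c * r)) / (c * r) + c * r * (e * om + e * lam * cos (h (c * r))) * sin (h (c * r))) * c
      = real n ^ 2 * sin (h (c * r)) * cos (h (c * r)) / r + (e * c^2) * (r * (om + lam * cos (h (c * r))) * sin (h (c * r)))"
      using c(1) r by (simp add: field_simps power2_eq_square)
    ultimately show "((\<lambda>r. v (c * r)) has_real_derivative
      real n ^ 2 * sin (h (c * r)) * cos (h (c * r)) / r + r * (om + lam * cos (h (c * r))) * sin (h (c * r))) (at r)"
      unfolding c(2) by simp
  qed
  then show ?thesis by (simp add: c_def)
qed

lemma slope_factor_close:
  fixes a b a' b' :: real
  assumes t: "0 \<le> t" "t \<le> r" and ab: "\<bar>a - a'\<bar> \<le> c" "\<bar>b - b'\<bar> \<le> c"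
  shows "\<bar>(real n * a + 2 * t^2 * b) - (real n * a' + 2 * t^2 * b')\<bar> \<le> (real n + 2 * r^2) * c"
proof -
  have t2: "t^2 \<le> r^2" using t by (intro power_mono) auto
  have "(real n * a + 2 * t^2 * b) - (real n * a' + 2 * t^2 * b') = real n * (a - a') + 2 * t^2 * (b - b')"
    by (simp add: algebra_simps)
  also have "\<bar>\<dots>\<bar> \<le> real n * c + 2 * r^2 * c"
  proof (intro order_trans[OF abs_triangle_ineq] add_mono)
    show "\<bar>real n * (a - a')\<bar> \<le> real n * c" using ab by (simp add: abs_mult mult_left_mono)
    have "2 * t^2 * \<bar>b - b'\<bar> \<le> 2 * r^2 * c" using ab t2 by (intro mult_mono) auto
    then show "\<bar>2 * t^2 * (b - b')\<bar> \<le> 2 * r^2 * c" by (simp add: abs_mult)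
  qed
  finally show ?thesis by (simp add: algebra_simps)
qed

text \<open>For \<open>e = 0\<close> the profile is \<open>2 arctan (r ^ n)\<close>.\<close>

lemma turns_back_small:
  assumes n: "1 \<le> n" and lam: "0 < lam" and om: "0 < om" and sub: "real n * om < lam" and e1: "0 < e1"
    and k0: "k 0 0 = 2" and cont: "continuous_on {0..} (k 0)"
    and prof: "\<And>e. 0 \<le> e \<Longrightarrow> e \<le> e1 \<Longrightarrow> profile n (e * lam) (e * om) (ansatz n (k e)) (ansatz_slope n (k e) (p e))"
    and lim: "((\<lambda>r. ansatz n (k 0) r / r ^ n) \<longlongrightarrow> 2) (at_right 0)"
    and vpos: "eventually (\<lambda>r. 0 < ansatz_slope n (k 0) (p 0) r) (at_right 0)"
    and stable: "\<And>R. 0 \<le> R \<Longrightarrow> \<exists>C>0. \<forall>e e' x. 0 \<le> e \<longrightarrow> e \<le> e1 \<longrightarrow> 0 \<le> e' \<longrightarrow> e' \<le> e1 \<longrightarrow> 0 \<le> x \<longrightarrow> x \<le> R \<longrightarrow>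
      \<bar>k e x - k e' x\<bar> \<le> C * \<bar>e - e'\<bar> \<and> \<bar>p e x - p e' x\<bar> \<le> C * \<bar>e - e'\<bar>"
  shows "\<exists>e. 0 < e \<and> e < e1 \<and> (\<exists>r>0. ansatz_slope n (k e) (p e) r < 0 \<and> (\<forall>t. 0 < t \<longrightarrow> t \<le> r \<longrightarrow> ansatz n (k e) t < pi))"
proof -
  interpret z: profile n 0 0 "ansatz n (k 0)" "ansatz_slope n (k 0) (p 0)" using prof[of 0] e1 by simp
  have h0: "ansatz n (k 0) r = 2 * arctan (r ^ n)" "ansatz_slope n (k 0) (p 0) r = real n * sin (ansatz n (k 0) r)"
    "0 < ansatz n (k 0) r" "ansatz n (k 0) r < pi" if "0 < r" for r
    using z.zero_forcing[OF refl refl lim vpos that] by auto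
  \<comment> \<open>As \<open>h\<close> tends to \<open>pi\<close> the forcing tends to
    \<open>om - lam = - 2 \<mu>\<close>; half of it is kept as a margin for the
    perturbation.\<close>
  define \<mu> where "\<mu> = (lam - om) / 2"
  have "om \<le> real n * om" using mult_right_mono[of 1 "real n" om] n om by simp
  then have \<mu>: "0 < \<mu>" using sub by (simp add: \<mu>_def)
  have "filterlim (\<lambda>r::real. r ^ n) at_top at_top" using n by (intro filterlim_pow_at_top filterlim_ident) auto
  then have "((\<lambda>r::real. arctan (r ^ n)) \<longlongrightarrow> pi / 2) at_top"
    by (rule filterlim_compose[OF tendsto_arctan_at_top])
  then have "((\<lambda>r::real. om + lam * cos (2 * arctan (r ^ n))) \<longlongrightarrow> om + lam * cos (2 * (pi / 2))) at_top"
    by (intro tendsto_intros)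
  moreover have "om + lam * cos (2 * (pi / 2)) < - \<mu>" using \<mu> by (simp add: \<mu>_def field_simps)
  ultimately have "eventually (\<lambda>r::real. om + lam * cos (2 * arctan (r ^ n)) < - \<mu>) at_top"
    by (rule order_tendstoD)
  moreover have "eventually (\<lambda>r. 3 * lam / (lam - real n * om) \<le> ln r) at_top"
    using ln_at_top by (simp add: filterlim_at_top)
  ultimately have "eventually (\<lambda>r::real. om + lam * cos (2 * arctan (r ^ n)) < - \<mu> \<and>
      3 * lam / (lam - real n * om) \<le> ln r \<and> 1 \<le> r) at_top"
    using eventually_ge_at_top[of 1] by eventually_elim auto
  then obtain R :: real where R: "om + lam * cos (2 * arctan (R ^ n)) < - \<mu>" "3 * lam / (lam - real n * om) \<le> ln R" "1 \<le> R"
    by (metis (no_types, lifting) eventually_at_top_linorder order_refl)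
  have R0: "0 < R" using R by simp
  have big: "3 * lam \<le> (lam - real n * om) * ln R" using R(2) sub by (simp add: divide_le_eq mult.commute)
  obtain C where C0: "0 < C" and C1: "\<forall>e e' x. 0 \<le> e \<longrightarrow> e \<le> e1 \<longrightarrow> 0 \<le> e' \<longrightarrow> e' \<le> e1 \<longrightarrow> 0 \<le> x \<longrightarrow> x \<le> R^2 \<longrightarrow>
      \<bar>k e x - k e' x\<bar> \<le> C * \<bar>e - e'\<bar> \<and> \<bar>p e x - p e' x\<bar> \<le> C * \<bar>e - e'\<bar>"
    using stable[OF zero_le_power2[of R]] by blast
  have C: "0 < C" "\<And>e x. 0 \<le> e \<Longrightarrow> e \<le> e1 \<Longrightarrow> 0 \<le> x \<Longrightarrow> x \<le> R^2 \<Longrightarrow>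
      \<bar>k e x - k 0 x\<bar> \<le> C * e \<and> \<bar>p e x - p 0 x\<bar> \<le> C * e"
    using C0 C1[rule_format, of _ 0] e1 by simp_all
  define A where "A = C * (1 + R ^ n) * (real n + 2 * R^2)"
  have A: "0 < A" unfolding A_def using C R0 n by (intro mult_pos_pos add_pos_pos) auto
  have close: "\<bar>ansatz n (k e) t - ansatz n (k 0) t\<bar> \<le> A * e \<and> \<bar>ansatz_slope n (k e) (p e) t - ansatz_slope n (k 0) (p 0) t\<bar> \<le> A * e \<and> \<bar>k e (t^2) - k 0 (t^2)\<bar> \<le> A * e"
    if e: "0 \<le> e" "e \<le> e1" and t: "0 \<le> t" "t \<le> R" for e t
  proof -
    have t2: "t^2 \<le> R^2" using t by (intro power_mono) auto
    have K: "\<bar>k e (t^2) - k 0 (t^2)\<bar> \<le> C * e" "\<bar>p e (t^2) - p 0 (t^2)\<bar> \<le> C * e" using C(2)[OF e _ t2] by auto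
    have Ce: "0 \<le> C * e" using C e by simp
    have tn: "0 \<le> t ^ n" "t ^ n \<le> R ^ n" "0 \<le> R ^ n" using t by (auto intro: power_mono)
    have n1: "1 \<le> real n + 2 * R^2" using n by (simp add: add_increasing2)
    have hb: "\<bar>ansatz n (k e) t - ansatz n (k 0) t\<bar> \<le> R ^ n * (C * e)"
    proof -
      have "ansatz n (k e) t - ansatz n (k 0) t = t ^ n * (k e (t^2) - k 0 (t^2))" by (simp add: ansatz_def algebra_simps)
      then have "\<bar>ansatz n (k e) t - ansatz n (k 0) t\<bar> = t ^ n * \<bar>k e (t^2) - k 0 (t^2)\<bar>" using tn by (simp add: abs_mult)
      also have "\<dots> \<le> R ^ n * (C * e)" using K tn by (intro mult_mono) auto
      finally show ?thesis .
    qed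
    have vb: "\<bar>ansatz_slope n (k e) (p e) t - ansatz_slope n (k 0) (p 0) t\<bar> \<le> R ^ n * ((real n + 2 * R^2) * (C * e))"
    proof -
      have "ansatz_slope n (k e) (p e) t - ansatz_slope n (k 0) (p 0) t
        = t ^ n * ((real n * k e (t^2) + 2 * t^2 * p e (t^2)) - (real n * k 0 (t^2) + 2 * t^2 * p 0 (t^2)))"
        unfolding ansatz_slope_def by (simp only: right_diff_distrib)
      then have "\<bar>ansatz_slope n (k e) (p e) t - ansatz_slope n (k 0) (p 0) t\<bar>
        = t ^ n * \<bar>(real n * k e (t^2) + 2 * t^2 * p e (t^2)) - (real n * k 0 (t^2) + 2 * t^2 * p 0 (t^2))\<bar>"
        using tn(1) by (simp only: abs_mult abs_of_nonneg)
      also have "\<dots> \<le> R ^ n * ((real n + 2 * R^2) * (C * e))"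
        using slope_factor_close[OF t K] tn by (intro mult_mono) auto
      finally show ?thesis .
    qed
    have 1: "R ^ n * (C * e) \<le> (1 + R ^ n) * (real n + 2 * R^2) * (C * e)"
      using n1 tn Ce mult_mono[of "R ^ n * 1" "(1 + R ^ n) * (real n + 2 * R^2)" "C * e" "C * e"]
        mult_mono[of "R ^ n" "1 + R ^ n" 1 "real n + 2 * R^2"] by simp
    have 2: "R ^ n * ((real n + 2 * R^2) * (C * e)) \<le> (1 + R ^ n) * (real n + 2 * R^2) * (C * e)"
    proof -
      have "0 \<le> (real n + 2 * R^2) * (C * e)" using n1 by (intro mult_nonneg_nonneg[OF _ Ce]) auto
      moreover have "(1 + R ^ n) * (real n + 2 * R^2) * (C * e)
        = (real n + 2 * R^2) * (C * e) + R ^ n * ((real n + 2 * R^2) * (C * e))" by (simp add: algebra_simps)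
      ultimately show ?thesis by linarith
    qed
    have 3: "1 * (C * e) \<le> (1 + R ^ n) * (real n + 2 * R^2) * (C * e)"
      using n1 tn Ce mult_mono[of 1 "1 + R ^ n" 1 "real n + 2 * R^2"] by (intro mult_right_mono) auto
    have "(1 + R ^ n) * (real n + 2 * R^2) * (C * e) = A * e" by (simp add: A_def mult_ac)
    then show ?thesis using hb vb K(1) 1 2 3 by auto
  qed
  \<comment> \<open>Positivity has to be preserved for \<open>k\<close> and not for
    \<open>h = r^n k\<close>, which has no positive lower bound near 0. The minimum of
    \<open>k 0\<close> is positive, also if attained at 0, where \<open>k 0 0 = 2\<close>.\<close>
  have "continuous_on {0..R^2} (k 0)" by (rule continuous_on_subset[OF cont]) auto
  then obtain x0 where x0: "0 \<le> x0" "\<And>x. 0 \<le> x \<Longrightarrow> x \<le> R^2 \<Longrightarrow> k 0 x0 \<le> k 0 x"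
    using continuous_attains_inf[of "{0..R^2}" "k 0"] by auto
  define g where "g = k 0 x0"
  have g: "0 < g"
  proof (cases "x0 = 0")
    case False
    then have s: "0 < sqrt x0" using x0 by simp
    then have "0 < sqrt x0 ^ n * k 0 x0" using h0(3)[OF s] x0 by (simp add: ansatz_def)
    then show ?thesis using s by (simp add: g_def zero_less_mult_iff)
  qed (simp add: g_def k0)
  define W where "W = R^2 * (om * (real n + 1) + 4 * lam)"
  have W: "0 < W" unfolding W_def using R0 om lam n by (intro mult_pos_pos add_pos_pos) auto
  define Q where "Q = lam / (R ^ (n - 1))^2"
  have Q: "0 < Q" unfolding Q_def using lam R0 by auto
  \<comment> \<open>In this order: the condition \<open>d \<le> 1\<close> of
    \<open>E_negative\<close>, the margin of the forcing at \<open>R\<close>, the positivity of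
    \<open>k\<close>, the distance of \<open>h\<close> from \<open>pi\<close>, and the smallness
    condition of \<open>E_negative\<close>. The halves make the resulting inequalities
    strict.\<close>
  define d where "d = Min {1, \<mu> / lam, g / 2, (pi - ansatz n (k 0) R) / 2, Q / (2 * W)}"
  have d: "0 < d" unfolding d_def using \<mu> lam g h0[OF R0] Q W by (auto)
  have dle: "d \<le> 1" "d \<le> \<mu> / lam" "d \<le> g / 2" "d \<le> (pi - ansatz n (k 0) R) / 2" "d \<le> Q / (2 * W)"
    unfolding d_def by (rule Min_le, simp, simp)+
  define e where "e = min (e1 / 2) (d / A)"
  have e: "0 < e" "e < e1" "e \<le> e1" "A * e \<le> d"
  proof -
    have "A * e \<le> A * (d / A)" unfolding e_def using A by (intro mult_left_mono) auto
    then show "A * e \<le> d" using A by simp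
    show "0 < e" using e1 d A by (simp add: e_def)
    have "e \<le> e1 / 2" unfolding e_def by (rule min.cobounded1)
    then show "e < e1" "e \<le> e1" using e1 by linarith+
  qed
  interpret q: profile n "e * lam" "e * om" "ansatz n (k e)" "ansatz_slope n (k e) (p e)" using e by (intro prof) auto
  have cl: "\<bar>ansatz n (k e) t - ansatz n (k 0) t\<bar> \<le> d" "\<bar>ansatz_slope n (k e) (p e) t - ansatz_slope n (k 0) (p 0) t\<bar> \<le> d" "\<bar>k e (t^2) - k 0 (t^2)\<bar> \<le> d"
    if "0 \<le> t" "t \<le> R" for t
    using close[of e t] that e by auto
  have reg: "0 < ansatz n (k e) t \<and> ansatz n (k e) t < pi" if t: "0 < t" "t \<le> R" for t
  proof
    have "g \<le> k 0 (t^2)" unfolding g_def using t by (intro x0 power_mono) auto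
    then have "0 < k e (t^2)" using cl(3)[OF less_imp_le[OF t(1)] t(2)] dle(3) g by linarith
    then show "0 < ansatz n (k e) t" using t by (simp add: ansatz_def)
    have "t ^ n \<le> R ^ n" using t by (intro power_mono) auto
    then have "ansatz n (k 0) t \<le> ansatz n (k 0) R" unfolding h0(1)[OF t(1)] h0(1)[OF R0] by (simp add: arctan_le_iff)
    moreover have "ansatz n (k e) t - ansatz n (k 0) t \<le> d"
      using cl(1)[OF less_imp_le[OF t(1)] t(2)] by (rule abs_le_D1)
    moreover have "2 * d \<le> pi - ansatz n (k 0) R" using dle(4) by simp
    ultimately show "ansatz n (k e) t < pi" using h0(4)[OF R0] by argo
  qed
  have sl: "\<bar>sin x - sin y\<bar> \<le> \<bar>x - y\<bar>" for x y :: real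
  proof -
    have "\<bar>sin x - sin y\<bar> = 2 * \<bar>sin ((x - y) / 2)\<bar> * \<bar>cos ((x + y) / 2)\<bar>"
      by (simp add: sin_diff_sin abs_mult)
    also have "\<dots> \<le> 2 * \<bar>(x - y) / 2\<bar> * 1"
      using abs_sin_x_le_abs_x[of "(x - y) / 2"] by (intro mult_mono) auto
    finally show ?thesis by simp
  qed
  have clo: "\<bar>sin (ansatz n (k e) t) - sin (2 * arctan (t ^ n))\<bar> \<le> d \<and>
       \<bar>ansatz_slope n (k e) (p e) t - real n * sin (2 * arctan (t ^ n))\<bar> \<le> d" if t: "0 < t" "t \<le> R" for t
    using cl(1,2)[of t] t sl[of "ansatz n (k e) t" "ansatz n (k 0) t"] h0(1,2)[OF t(1)] by auto
  \<comment> \<open>The conditions of \<open>E_negative\<close> are homogeneous in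
    \<open>lam\<close> and \<open>om\<close>: the factor \<open>e\<close> cancels, and only
    \<open>d\<close> has to be small.\<close>
  have "q.E R < 0"
  proof (rule q.E_negative[of R d])
    show "0 < e * lam" "0 < e * om" using e lam om by auto
    show "3 * (e * lam) \<le> (e * lam - real n * (e * om)) * ln R"
      using mult_left_mono[OF big, of e] e by (simp add: algebra_simps)
    have "d * W < Q"
    proof -
      have "d * W \<le> Q / (2 * W) * W" using dle(5) W by (intro mult_right_mono) auto
      then show ?thesis using W Q by simp
    qed
    then have "e * (d * W) < e * Q" using e by simp
    then show "d * (R\<^sup>2 * (e * om * (real n + 1) + 4 * (e * lam))) < e * lam / (R ^ (n - 1))\<^sup>2"
      unfolding W_def Q_def by (simp add: algebra_simps)
    have "e * (real n * om) < e * lam" using sub e by simp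
    then show "real n * (e * om) < e * lam" by (simp add: mult_ac)
  qed (use R d dle clo reg in auto)
  moreover have "e * om + e * lam * cos (ansatz n (k e) R) \<le> 0"
  proof -
    have "\<bar>cos (ansatz n (k e) R) - cos (ansatz n (k 0) R)\<bar> \<le> d"
      using sl[of "pi/2 - ansatz n (k e) R" "pi/2 - ansatz n (k 0) R"] cl(1)[of R] R0 by (simp add: sin_diff cos_diff)
    then have "cos (ansatz n (k e) R) \<le> cos (2 * arctan (R ^ n)) + d" unfolding h0(1)[OF R0] by linarith
    then have "lam * cos (ansatz n (k e) R) \<le> lam * (cos (2 * arctan (R ^ n)) + d)" using lam by (intro mult_left_mono) auto
    moreover have "lam * d \<le> \<mu>" using dle(2) lam by (simp add: field_simps)
    ultimately have "om + lam * cos (ansatz n (k e) R) \<le> 0" using R(1) by (simp add: algebra_simps)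
    then have "e * (om + lam * cos (ansatz n (k e) R)) \<le> 0" using e by (intro mult_nonneg_nonpos) auto
    then show ?thesis by (simp add: algebra_simps)
  qed
  ultimately have "\<exists>r>0. ansatz_slope n (k e) (p e) r < 0 \<and> (\<forall>t. 0 < t \<longrightarrow> t \<le> r \<longrightarrow> ansatz n (k e) t < pi)"
    using e lam om R0 reg by (intro q.turns_back[of R]) auto
  then show ?thesis using e by blast
qed

text \<open>\<open>notT\<close> and \<open>notO\<close> say that neither alternative occurs. If
  \<open>h\<close> reached \<open>pi\<close>, then up to its first arrival \<open>v\<close> would be
  positive by \<open>notT\<close> and \<open>v_strict\<close>, and at the arrival by
  \<open>hits_pi_transversally\<close>; \<open>h\<close> would exceed \<open>pi\<close> with
  \<open>v\<close> still positive, against \<open>notO\<close>. So \<open>h < pi\<close> throughout,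
  and \<open>notT\<close> makes \<open>h\<close> monotone.\<close>

lemma (in profile) solution_from_dichotomy:
  assumes lam: "0 < lam" and om: "0 < om"
    and notT: "\<And>r. 0 < r \<Longrightarrow> v r < 0 \<Longrightarrow> \<exists>t. 0 < t \<and> t \<le> r \<and> pi \<le> h t"
    and notO: "\<And>r. 0 < r \<Longrightarrow> pi < h r \<Longrightarrow> \<exists>t. 0 < t \<and> t \<le> r \<and> v t \<le> 0"
  shows "(\<forall>r>0. 0 < h r \<and> h r < pi) \<and> (h \<longlongrightarrow> pi) at_top"
proof -
  obtain d where d: "0 < d" "\<And>t. 0 < t \<Longrightarrow> t < d \<Longrightarrow> 0 < h t"
    using at_right_0_ex[OF h_pos_0] by blast
  have hp: "0 < h r" if r: "0 < r" and reg: "\<And>t. 0 < t \<Longrightarrow> t < r \<Longrightarrow> 0 \<le> v t" for r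
  proof -
    define s where "s = min (d/2) r"
    have s: "0 < s" "s < d" "s \<le> r" using d(1) r by (auto simp: s_def)
    then have "h s \<le> h r" using reg by (intro h_mono) auto
    then show ?thesis using d(2)[of s] s by auto
  qed
  have vn: "0 \<le> v r" if "0 < r" "\<And>t. 0 < t \<Longrightarrow> t \<le> r \<Longrightarrow> h t < pi" for r
    using notT[of r] that by (meson not_less)
  have lt: "h r < pi" if r: "0 < r" for r
  proof (rule ccontr)
    assume a: "\<not> h r < pi"
    have ev: "eventually (\<lambda>r. 0 < pi - h r) (at_right 0)"
      using h_0 pi_gt_zero by (simp add: order_tendstoD)
    have ci: "isCont (\<lambda>r. pi - h r) s" if "0 < s" for s using that by (intro continuous_intros ch)
    obtain c where c: "0 < c" "c \<le> r" "pi - h c = 0" "\<And>s. 0 < s \<Longrightarrow> s < c \<Longrightarrow> 0 < pi - h s"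
      using first_zero[OF ci ev r] a by auto
    have v0: "0 \<le> v s" if "0 < s" "s < c" for s using vn[of s] c(4) that by force
    have reg: "0 < h s \<and> h s < pi \<and> 0 \<le> v s" if "0 < s" "s < c" for s
      using v0 that hp[of s] c(4)[of s] by auto
    have hc: "h c = pi" using c by simp
    have vpos: "0 < v s" if "0 < s" "s < c" for s
      using reg that by (intro v_strict[OF lam om, of c]) auto
    have vc: "0 < v c" using hits_pi_transversally[OF c(1) reg hc] .
    obtain b where b: "0 < b" "\<And>x. \<bar>x - c\<bar> < b \<Longrightarrow> 0 < v x"
    proof -
      have "eventually (\<lambda>x. 0 < v x) (nhds c)"
        using cv[OF c(1)] vc unfolding isCont_def by (intro order_tendstoD(1)[of v "v c"]) (simp add: tendsto_nhds_iff)
      then show ?thesis using that unfolding eventually_nhds_metric dist_real_def by blast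
    qed
    have "0 < v c / c" using vc c(1) by simp
    from DERIV_pos_inc_right[OF dh[OF c(1)] this] obtain e where
      e: "0 < e" "\<And>x. 0 < x \<Longrightarrow> x < e \<Longrightarrow> h c < h (c + x)" by auto
    define x where "x = min b e / 2"
    have x: "0 < x" "x < b" "x < e" using b(1) e(1) by (auto simp: x_def)
    have "pi < h (c + x)" using e(2)[of x] x hc by simp
    then obtain t where t: "0 < t" "t \<le> c + x" "v t \<le> 0" using notO[of "c + x"] x c(1) by auto
    then show False using vpos[of t] b(2)[of t] x by (cases "t < c") auto
  qed
  have v0: "0 \<le> v r" if "0 < r" for r using vn[of r] lt that by auto
  then have "0 < h r \<and> h r < pi \<and> 0 \<le> v r" if "0 < r" for r using hp lt that by auto
  then show ?thesis using tends_to_pi[OF lam om] by blast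
qed

lemma regular_isCont:
  assumes "regular n k p"
  shows "-1 < x \<Longrightarrow> isCont k x" "isCont p x"
  using assms unfolding regular_def by (blast intro: DERIV_isCont)+

lemma regular_profile_exists:
  assumes n: "1 \<le> n" and lam: "0 < lam" and om: "0 < om" and sub: "real n * om < lam"
  obtains e k p where "0 < e" "regular n k p" "profile n (e * lam) (e * om) (ansatz n k) (ansatz_slope n k p)"
    "\<And>r. 0 < r \<Longrightarrow> 0 < ansatz n k r \<and> ansatz n k r < pi" "(ansatz n k \<longlongrightarrow> pi) at_top"
proof -
  \<comment> \<open>\<open>\<eta>\<close>, \<open>M\<close> and \<open>W\<close> are prepared for
    \<open>overshoots\<close> with the unscaled parameters \<open>lam\<close> and \<open>om\<close>;
    \<open>a0\<close> is a slope that satisfies its condition \<open>small\<close>, as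
    \<open>a0 * W = \<eta> / 2\<close>.\<close>
  define \<eta> where "\<eta> = min (pi / 2) (sqrt (om / (2 * (lam + om))))"
  have \<eta>: "0 < \<eta>" "\<eta> \<le> pi / 2" "(lam + om) * \<eta>^2 \<le> om / 2"
  proof -
    show "0 < \<eta>" using lam om by (simp add: \<eta>_def)
    have "\<eta>^2 \<le> (sqrt (om / (2 * (lam + om))))^2" using \<open>0 < \<eta>\<close> unfolding \<eta>_def by (intro power_mono) auto
    also have "\<dots> = om / (2 * (lam + om))" using lam om by simp
    finally show "(lam + om) * \<eta>^2 \<le> om / 2" using lam om by (simp add: field_simps)
  qed (simp add: \<eta>_def)
  define B where "B = sqrt (real n ^ 2 + lam + 4 * om)"
  define M where "M = max 1 (2 * B * pi / om)"
  have B: "0 \<le> B" using lam om by (simp add: B_def)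
  have M: "1 \<le> M" "B / M * pi \<le> om / 2"
  proof -
    have "2 * B * pi / om \<le> M" by (simp add: M_def)
    then have "2 * B * pi \<le> M * om" using om by (simp add: divide_le_eq)
    moreover have "0 < M" by (simp add: M_def)
    ultimately show "B / M * pi \<le> om / 2" by (simp add: field_simps)
  qed (simp add: M_def)
  define W where "W = M ^ n * exp (sqrt (lam + om) * M)"
  have W: "0 < W" using M by (simp add: W_def)
  define a0 where "a0 = \<eta> / (2 * W)"
  have a0: "0 < a0" using \<eta> W by (simp add: a0_def)
  \<comment> \<open>Scaling \<open>e1\<close> away multiplies the slope 2 by \<open>c^n\<close> with
    \<open>c = 1 / sqrt e1\<close>. The summand 1 gives \<open>c \<le> 1\<close>, hence
    \<open>2 c^n \<le> 2 c \<le> a0\<close>.\<close>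
  define e1 where "e1 = (2 / a0 + 1)^2"
  have s1: "sqrt e1 = 2 / a0 + 1" using a0 by (simp add: e1_def)
  have e1: "0 < e1" using a0 unfolding e1_def by (intro zero_less_power add_pos_pos) auto
  obtain k p where
    reg: "\<And>e. 0 \<le> e \<Longrightarrow> e \<le> e1 \<Longrightarrow> regular n (k e) (p e)" and
    k0: "\<And>e. 0 \<le> e \<Longrightarrow> e \<le> e1 \<Longrightarrow> k e 0 = 2" and
    prof: "\<And>e. 0 \<le> e \<Longrightarrow> e \<le> e1 \<Longrightarrow> profile n (e * lam) (e * om) (ansatz n (k e)) (ansatz_slope n (k e) (p e))" and
    lim: "\<And>e. 0 \<le> e \<Longrightarrow> e \<le> e1 \<Longrightarrow> ((\<lambda>r. ansatz n (k e) r / r ^ n) \<longlongrightarrow> 2) (at_right 0)" and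
    vpos: "\<And>e. 0 \<le> e \<Longrightarrow> e \<le> e1 \<Longrightarrow> eventually (\<lambda>r. 0 < ansatz_slope n (k e) (p e) r) (at_right 0)" and
    stable: "\<And>R. 0 \<le> R \<Longrightarrow> \<exists>C>0. \<forall>e e' x. 0 \<le> e \<longrightarrow> e \<le> e1 \<longrightarrow> 0 \<le> e' \<longrightarrow> e' \<le> e1 \<longrightarrow> 0 \<le> x \<longrightarrow> x \<le> R \<longrightarrow>
      \<bar>k e x - k e' x\<bar> \<le> C * \<bar>e - e'\<bar> \<and> \<bar>p e x - p e' x\<bar> \<le> C * \<bar>e - e'\<bar>"
    using profile_family[OF n lam om e1] by blast
  \<comment> \<open>Truncating the parameter to \<open>[0, e1]\<close> lets the two alternatives be
    open subsets of the whole line.\<close>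
  define cl where "cl e = max 0 (min e e1)" for e
  have cl: "0 \<le> cl e" "cl e \<le> e1" "\<bar>cl e - cl e'\<bar> \<le> \<bar>e - e'\<bar>" "0 \<le> e \<Longrightarrow> e \<le> e1 \<Longrightarrow> cl e = e" for e e'
    using e1 unfolding cl_def by linarith+
  have kc: "continuous_on {0..} (k e)" and pc: "continuous_on S (p e)" if "0 \<le> e" "e \<le> e1" for e S
    using regular_isCont[OF reg[OF that]] by (auto intro!: continuous_at_imp_continuous_on)
  \<comment> \<open>\<open>f\<close> is \<open>v / t^n\<close>, which has the value
    \<open>2 n\<close> at 0, where \<open>v\<close> vanishes. Strict inequalities for
    \<open>v\<close> on \<open>(0, r]\<close> thus become strict inequalities for \<open>f\<close>
    on the compact \<open>[0, r]\<close>, and these survive small changes of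
    \<open>e\<close>.\<close>
  define f where "f e t = real n * k e (t^2) + 2 * t^2 * p e (t^2)" for e t
  have vf: "ansatz_slope n (k e) (p e) t = t ^ n * f e t" for e t by (simp add: ansatz_slope_def f_def)
  have fc: "continuous_on {0..r} (f e)" and k2c: "continuous_on {0..r} (\<lambda>t. k e (t^2))" if e: "0 \<le> e" "e \<le> e1" for e r
  proof -
    show 1: "continuous_on {0..r} (\<lambda>t. k e (t^2))"
      by (rule continuous_on_compose2[OF kc[OF e]]) (auto intro!: continuous_intros)
    have "continuous_on {0..r} (\<lambda>t. p e (t^2))"
      by (rule continuous_on_compose2[OF pc[OF e, of UNIV]]) (auto intro!: continuous_intros)
    then show "continuous_on {0..r} (f e)" unfolding f_def by (intro continuous_intros 1)
  qed
  have near: "\<exists>A>0. \<forall>e e' t. 0 \<le> t \<longrightarrow> t \<le> r \<longrightarrow> \<bar>k (cl e) (t^2) - k (cl e') (t^2)\<bar> \<le> A * \<bar>e - e'\<bar> \<and>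
      \<bar>f (cl e) t - f (cl e') t\<bar> \<le> A * \<bar>e - e'\<bar>" if r: "0 < r" for r
  proof -
    obtain C where C: "0 < C" "\<And>e e' x. 0 \<le> e \<Longrightarrow> e \<le> e1 \<Longrightarrow> 0 \<le> e' \<Longrightarrow> e' \<le> e1 \<Longrightarrow> 0 \<le> x \<Longrightarrow> x \<le> r^2 \<Longrightarrow>
      \<bar>k e x - k e' x\<bar> \<le> C * \<bar>e - e'\<bar> \<and> \<bar>p e x - p e' x\<bar> \<le> C * \<bar>e - e'\<bar>"
      using stable[OF zero_le_power2[of r]] by metis
    define A where "A = C * (real n + 2 * r^2)"
    have A: "0 < A" "C \<le> A" unfolding A_def using C r n
      by (auto intro!: mult_pos_pos add_nonneg_pos simp: mult_le_cancel_left1 add_increasing2)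
    have "\<bar>k (cl e) (t^2) - k (cl e') (t^2)\<bar> \<le> A * \<bar>e - e'\<bar> \<and>
      \<bar>f (cl e) t - f (cl e') t\<bar> \<le> A * \<bar>e - e'\<bar>" if t: "0 \<le> t" "t \<le> r" for e e' t
    proof
      have t2: "t^2 \<le> r^2" using t by (intro power_mono) auto
      have b: "C * \<bar>cl e - cl e'\<bar> \<le> C * \<bar>e - e'\<bar>" using cl(3) C by (intro mult_left_mono) auto
      have K: "\<bar>k (cl e) (t^2) - k (cl e') (t^2)\<bar> \<le> C * \<bar>e - e'\<bar>" "\<bar>p (cl e) (t^2) - p (cl e') (t^2)\<bar> \<le> C * \<bar>e - e'\<bar>"
        using C(2)[OF cl(1,2) cl(1,2) _ t2, of e e'] b by auto
      have "C * \<bar>e - e'\<bar> \<le> A * \<bar>e - e'\<bar>" using A by (intro mult_right_mono) auto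
      then show "\<bar>k (cl e) (t^2) - k (cl e') (t^2)\<bar> \<le> A * \<bar>e - e'\<bar>" using K by linarith
      show "\<bar>f (cl e) t - f (cl e') t\<bar> \<le> A * \<bar>e - e'\<bar>"
        using slope_factor_close[OF t K] unfolding f_def A_def by (simp add: mult_ac)
    qed
    then show ?thesis using A(1) by blast
  qed
  define h where "h e = ansatz n (k (cl e))" for e
  define v where "v e = ansatz_slope n (k (cl e)) (p (cl e))" for e
  have hk: "h e t = t ^ n * k (cl e) (t^2)" for e t by (simp add: h_def ansatz_def)
  have vf': "v e t = t ^ n * f (cl e) t" for e t unfolding v_def vf ..
  define O' where "O' = {e. \<exists>r>0. pi < h e r \<and> (\<forall>t. 0 < t \<longrightarrow> t \<le> r \<longrightarrow> 0 < v e t)}"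
  define T where "T = {e. \<exists>r>0. v e r < 0 \<and> (\<forall>t. 0 < t \<longrightarrow> t \<le> r \<longrightarrow> h e t < pi)}"
  have openO: "open O'"
    unfolding open_dist
  proof
    fix e assume "e \<in> O'"
    then obtain r where r: "0 < r" "pi < h e r" "\<And>t. 0 < t \<Longrightarrow> t \<le> r \<Longrightarrow> 0 < v e t" unfolding O'_def by blast
    obtain A where A: "0 < A" "\<And>e e' t. 0 \<le> t \<Longrightarrow> t \<le> r \<Longrightarrow> \<bar>k (cl e) (t^2) - k (cl e') (t^2)\<bar> \<le> A * \<bar>e - e'\<bar> \<and>
      \<bar>f (cl e) t - f (cl e') t\<bar> \<le> A * \<bar>e - e'\<bar>" using near[OF r(1)] by blast
    obtain x where x: "0 \<le> x" "x \<le> r" "\<And>t. 0 \<le> t \<Longrightarrow> t \<le> r \<Longrightarrow> f (cl e) x \<le> f (cl e) t"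
      using continuous_attains_inf[OF _ _ fc[OF cl(1,2)], of r e] r by auto
    have fx: "0 < f (cl e) x"
    proof (cases "x = 0")
      case True then show ?thesis using n k0[OF cl(1,2)] by (simp add: f_def)
    next
      case False
      then have "0 < x ^ n * f (cl e) x" using r(3)[of x] x by (simp add: vf')
      then show ?thesis using False x by (simp add: zero_less_mult_iff)
    qed
    define d where "d = min (f (cl e) x) ((h e r - pi) / r ^ n) / A"
    have d: "0 < d" unfolding d_def using fx r A by simp
    show "\<exists>d>0. \<forall>e'. dist e' e < d \<longrightarrow> e' \<in> O'"
    proof (intro exI[of _ d] conjI d allI impI)
      fix e' assume e': "dist e' e < d"
      then have Ad: "A * \<bar>e' - e\<bar> < A * d" using A by (simp add: dist_real_def)
      have Ad2: "A * d \<le> f (cl e) x" "A * d \<le> (h e r - pi) / r ^ n" using A unfolding d_def by auto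
      have "\<bar>k (cl e') (r^2) - k (cl e) (r^2)\<bar> < (h e r - pi) / r ^ n"
        using A(2)[OF less_imp_le[OF r(1)] order_refl, of e' e] Ad Ad2 by linarith
      then have "k (cl e) (r^2) - k (cl e') (r^2) < (h e r - pi) / r ^ n" by linarith
      then have "r ^ n * (k (cl e) (r^2) - k (cl e') (r^2)) < h e r - pi" using r by (simp add: field_simps)
      then have "pi < h e' r" by (simp add: hk algebra_simps)
      moreover have "0 < v e' t" if t: "0 < t" "t \<le> r" for t
      proof -
        have "\<bar>f (cl e') t - f (cl e) t\<bar> < f (cl e) x" using A(2)[OF less_imp_le[OF t(1)] t(2), of e' e] Ad Ad2 by linarith
        then have "0 < f (cl e') t" using x(3)[OF less_imp_le[OF t(1)] t(2)] by linarith
        then show ?thesis using t by (simp add: vf')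
      qed
      ultimately show "e' \<in> O'" unfolding O'_def using r(1) by blast
    qed
  qed
  have openT: "open T"
    unfolding open_dist
  proof
    fix e assume "e \<in> T"
    then obtain r where r: "0 < r" "v e r < 0" "\<And>t. 0 < t \<Longrightarrow> t \<le> r \<Longrightarrow> h e t < pi" unfolding T_def by blast
    obtain A where A: "0 < A" "\<And>e e' t. 0 \<le> t \<Longrightarrow> t \<le> r \<Longrightarrow> \<bar>k (cl e) (t^2) - k (cl e') (t^2)\<bar> \<le> A * \<bar>e - e'\<bar> \<and>
      \<bar>f (cl e) t - f (cl e') t\<bar> \<le> A * \<bar>e - e'\<bar>" using near[OF r(1)] by blast
    have "continuous_on {0..r} (h e)" unfolding hk by (intro continuous_intros k2c cl)
    then obtain x where x: "0 \<le> x" "x \<le> r" "\<And>t. 0 \<le> t \<Longrightarrow> t \<le> r \<Longrightarrow> h e t \<le> h e x"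
      using continuous_attains_sup[of "{0..r}" "h e"] r by auto
    have hx: "h e x < pi"
    proof (cases "x = 0")
      case True then show ?thesis using n by (simp add: hk power_0_left)
    qed (use r(3)[of x] x in auto)
    have fr: "f (cl e) r < 0" using r(1,2) by (simp add: vf' mult_less_0_iff)
    define d where "d = min (- f (cl e) r) ((pi - h e x) / r ^ n) / A"
    have d: "0 < d" unfolding d_def using fr hx r A by simp
    show "\<exists>d>0. \<forall>e'. dist e' e < d \<longrightarrow> e' \<in> T"
    proof (intro exI[of _ d] conjI d allI impI)
      fix e' assume e': "dist e' e < d"
      then have Ad: "A * \<bar>e' - e\<bar> < A * d" using A by (simp add: dist_real_def)
      have Ad2: "A * d \<le> - f (cl e) r" "A * d \<le> (pi - h e x) / r ^ n" using A unfolding d_def by auto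
      have "f (cl e') r < 0" using A(2)[OF less_imp_le[OF r(1)] order_refl, of e' e] Ad Ad2 by linarith
      then have "v e' r < 0" using r(1) by (simp add: vf' mult_less_0_iff)
      moreover have "h e' t < pi" if t: "0 < t" "t \<le> r" for t
      proof -
        have "\<bar>k (cl e') (t^2) - k (cl e) (t^2)\<bar> < (pi - h e x) / r ^ n" using A(2)[OF less_imp_le[OF t(1)] t(2), of e' e] Ad Ad2 by linarith
        then have "t ^ n * (k (cl e') (t^2) - k (cl e) (t^2)) \<le> t ^ n * \<bar>k (cl e') (t^2) - k (cl e) (t^2)\<bar>"
          using t by (intro mult_left_mono) auto
        also have "\<dots> \<le> r ^ n * \<bar>k (cl e') (t^2) - k (cl e) (t^2)\<bar>" using t by (intro mult_right_mono power_mono) auto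
        also have "\<dots> < r ^ n * ((pi - h e x) / r ^ n)"
          using r(1) \<open>\<bar>k (cl e') (t^2) - k (cl e) (t^2)\<bar> < (pi - h e x) / r ^ n\<close> by (intro mult_strict_left_mono) auto
        also have "\<dots> = pi - h e x" using r(1) by simp
        finally show ?thesis using x(3)[of t] t by (simp add: hk algebra_simps)
      qed
      ultimately show "e' \<in> T" unfolding T_def using r(1) by blast
    qed
  qed
  \<comment> \<open>Whichever of the two radii comes first contradicts the condition that holds up
    to the other.\<close>
  have disj: "O' \<inter> T = {}"
  proof (rule equals0I)
    fix e assume "e \<in> O' \<inter> T"
    then obtain r s where r: "0 < r" "pi < h e r" "\<And>t. 0 < t \<Longrightarrow> t \<le> r \<Longrightarrow> 0 < v e t"
      and s: "0 < s" "v e s < 0" "\<And>t. 0 < t \<Longrightarrow> t \<le> s \<Longrightarrow> h e t < pi" unfolding O'_def T_def by blast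
    show False
    proof (cases "s \<le> r")
      case True then show ?thesis using r(3)[OF s(1) True] s(2) by simp
    next
      case False then show ?thesis using s(3)[OF r(1)] r(2) by simp
    qed
  qed
  have e1O: "e1 \<in> O'"
  proof -
    have P: "profile n (e1 * lam) (e1 * om) (ansatz n (k e1)) (ansatz_slope n (k e1) (p e1))" using e1 by (intro prof) auto
    define c where "c = 1 / sqrt e1"
    have c: "0 < c" using e1 by (simp add: c_def)
    interpret q: profile n lam om "\<lambda>r. ansatz n (k e1) (r / sqrt e1)" "\<lambda>r. ansatz_slope n (k e1) (p e1) (r / sqrt e1)"
      by (rule profile_scale[OF P e1])
    have at: "filterlim (\<lambda>r. c * r) (at_right 0) (at_right 0)"
      unfolding filterlim_at
    proof
      show "eventually (\<lambda>r. c * r \<in> {0<..} \<and> c * r \<noteq> 0) (at_right 0)"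
        using c unfolding eventually_at_right_field by (intro exI[of _ 1]) auto
    qed (auto intro!: tendsto_eq_intros)
    have "((\<lambda>r. ansatz n (k e1) (c * r) / (c * r) ^ n) \<longlongrightarrow> 2) (at_right 0)"
      using filterlim_compose[OF lim at] e1 by auto
    then have "((\<lambda>r. ansatz n (k e1) (c * r) / (c * r) ^ n * c ^ n) \<longlongrightarrow> 2 * c ^ n) (at_right 0)"
      by (intro tendsto_intros)
    moreover have "(\<lambda>r. ansatz n (k e1) (c * r) / (c * r) ^ n * c ^ n) = (\<lambda>r. ansatz n (k e1) (r / sqrt e1) / r ^ n)"
    proof
      fix r
      have "c * r = r / sqrt e1" by (simp add: c_def)
      moreover have "ansatz n (k e1) (c * r) / (c * r) ^ n * c ^ n = ansatz n (k e1) (c * r) / r ^ n"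
        using c unfolding power_mult_distrib by simp
      ultimately show "ansatz n (k e1) (c * r) / (c * r) ^ n * c ^ n = ansatz n (k e1) (r / sqrt e1) / r ^ n" by simp
    qed
    ultimately have lim': "((\<lambda>r. ansatz n (k e1) (r / sqrt e1) / r ^ n) \<longlongrightarrow> 2 * c ^ n) (at_right 0)" by simp
    have "2 * c ^ n \<le> a0"
    proof -
      have "1 \<le> sqrt e1" unfolding s1 using a0 by simp
      then have "c \<le> 1" by (simp add: c_def)
      then have "c ^ n \<le> c ^ 1" using c n by (intro power_decreasing) auto
      moreover have "2 * c \<le> a0" unfolding c_def s1 using a0 by (simp add: field_simps)
      ultimately show ?thesis by simp
    qed
    then have "2 * c ^ n * W \<le> a0 * W" using W by (intro mult_right_mono) auto
    also have "a0 * W < \<eta>" using W \<eta> by (simp add: a0_def)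
    finally have small: "2 * c ^ n * M ^ n * exp (sqrt (lam + om) * M) < \<eta>" by (simp add: W_def mult_ac)
    obtain r where r: "0 < r" "pi < ansatz n (k e1) (r / sqrt e1)"
      "\<And>t. 0 < t \<Longrightarrow> t \<le> r \<Longrightarrow> 0 < ansatz_slope n (k e1) (p e1) (t / sqrt e1)"
      using q.overshoots[OF lam om lim' M(1) M(2)[unfolded B_def] \<eta> small] c by auto
    have ce: "cl e1 = e1" using cl(4) e1 by simp
    have "\<exists>r>0. pi < h e1 r \<and> (\<forall>t. 0 < t \<longrightarrow> t \<le> r \<longrightarrow> 0 < v e1 t)"
      unfolding h_def v_def ce
    proof (intro exI[of _ "r / sqrt e1"] conjI allI impI)
      fix t assume t: "0 < t" "t \<le> r / sqrt e1"
      then have "0 < t * sqrt e1" "t * sqrt e1 \<le> r" using e1 by (auto simp: pos_le_divide_eq)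
      from r(3)[OF this] show "0 < ansatz_slope n (k e1) (p e1) t" using e1 by simp
    qed (use r e1 in auto)
    then show ?thesis unfolding O'_def by simp
  qed
  have "\<exists>e. 0 < e \<and> e < e1 \<and> (\<exists>r>0. ansatz_slope n (k e) (p e) r < 0 \<and> (\<forall>t. 0 < t \<longrightarrow> t \<le> r \<longrightarrow> ansatz n (k e) t < pi))"
    using e1 by (intro turns_back_small[OF n lam om sub e1] k0 kc prof lim vpos stable) auto
  then obtain e0 where e0: "0 < e0" "e0 < e1" "\<exists>r>0. ansatz_slope n (k e0) (p e0) r < 0 \<and> (\<forall>t. 0 < t \<longrightarrow> t \<le> r \<longrightarrow> ansatz n (k e0) t < pi)" by blast
  then have e0T: "e0 \<in> T" unfolding T_def h_def v_def using cl(4)[of e0] by auto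
  \<comment> \<open>The interval is connected, and each of the two disjoint open sets contains one
    of its end points.\<close>
  have "\<exists>e\<in>{e0..e1}. e \<notin> O' \<and> e \<notin> T"
  proof (rule ccontr)
    assume "\<not> ?thesis"
    then have "{e0..e1} \<subseteq> O' \<union> T" by blast
    then have "O' \<inter> {e0..e1} = {} \<or> T \<inter> {e0..e1} = {}"
      using connectedD[OF connected_Icc[of e0 e1] openO openT] disj by blast
    then show False using e1O e0T e0 by auto
  qed
  then obtain e where e: "e0 \<le> e" "e \<le> e1" "e \<notin> O'" "e \<notin> T" by auto
  have e': "0 < e" "0 \<le> e" using e e0 by auto
  have ce: "cl e = e" using cl(4) e e' by simp
  have he: "h e = ansatz n (k e)" "v e = ansatz_slope n (k e) (p e)" by (simp_all add: h_def v_def ce)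
  interpret q: profile n "e * lam" "e * om" "ansatz n (k e)" "ansatz_slope n (k e) (p e)" using e' e by (intro prof) auto
  have "(\<forall>r>0. 0 < ansatz n (k e) r \<and> ansatz n (k e) r < pi) \<and> (ansatz n (k e) \<longlongrightarrow> pi) at_top"
  proof (rule q.solution_from_dichotomy)
    fix r :: real assume r: "0 < r"
    show "\<exists>t. 0 < t \<and> t \<le> r \<and> pi \<le> ansatz n (k e) t" if "ansatz_slope n (k e) (p e) r < 0"
      using e(4) r that unfolding T_def he mem_Collect_eq by (meson not_less)
    show "\<exists>t. 0 < t \<and> t \<le> r \<and> ansatz_slope n (k e) (p e) t \<le> 0" if "pi < ansatz n (k e) r"
      using e(3) r that unfolding O'_def he mem_Collect_eq by (meson not_less)
  qed (use e' lam om in auto)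
  then show thesis using that[of e "k e" "p e"] e' e reg[of e] prof[of e] by auto
qed

section \<open>From a profile to a solution\<close>

text \<open>The derivative is given as a function, so that \<open>partial_deriv\<close> can be
  rewritten as a whole and then differentiated again.\<close>

definition has_partial :: "(real^'n::finite \<Rightarrow> 'b::real_normed_vector) \<Rightarrow> 'n \<Rightarrow> (real^'n \<Rightarrow> 'b) \<Rightarrow> bool" where
  "has_partial F i D \<longleftrightarrow> (\<forall>x. ((\<lambda>s. F (x + s *\<^sub>R axis i 1)) has_vector_derivative D x) (at 0))"

lemma has_partial_partial_deriv: "has_partial F i D \<Longrightarrow> partial_deriv i F = D"
  unfolding has_partial_def partial_deriv_def by (auto intro!: ext vector_derivative_at)

lemma has_partial_differentiable: "has_partial F i D \<Longrightarrow> partially_differentiable i F"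
  unfolding has_partial_def partially_differentiable_def by (blast intro: differentiableI_vector)

definition C2_with :: "(real^'n::finite \<Rightarrow> 'b::real_normed_vector) \<Rightarrow> ('n \<Rightarrow> real^'n \<Rightarrow> 'b) \<Rightarrow> ('n \<Rightarrow> 'n \<Rightarrow> real^'n \<Rightarrow> 'b) \<Rightarrow> bool" where
  "C2_with F D D2 \<longleftrightarrow> continuous_on UNIV F \<and> (\<forall>i. has_partial F i (D i) \<and> continuous_on UNIV (D i)) \<and>
     (\<forall>i j. has_partial (D i) j (D2 i j) \<and> continuous_on UNIV (D2 i j))"

lemma has_partial_scaleR:
  assumes "has_partial K i DK" "has_partial Z i DZ"
  shows "has_partial (\<lambda>x. K x *\<^sub>R Z x) i (\<lambda>x. K x *\<^sub>R DZ x + DK x *\<^sub>R Z x)"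
  unfolding has_partial_def
proof
  fix x
  have "((\<lambda>s. K (x + s *\<^sub>R axis i 1)) has_field_derivative DK x) (at 0)"
    using assms(1) unfolding has_partial_def by (simp add: has_real_derivative_iff_has_vector_derivative)
  from has_vector_derivative_scaleR[OF this, of "\<lambda>s. Z (x + s *\<^sub>R axis i 1)" "DZ x"] assms(2)
  show "((\<lambda>s. K (x + s *\<^sub>R axis i 1) *\<^sub>R Z (x + s *\<^sub>R axis i 1)) has_vector_derivative K x *\<^sub>R DZ x + DK x *\<^sub>R Z x) (at 0)"
    unfolding has_partial_def by simp
qed

lemma has_partial_add: "has_partial F i D \<Longrightarrow> has_partial F' i D' \<Longrightarrow> has_partial (\<lambda>x. F x + F' x) i (\<lambda>x. D x + D' x)"
  unfolding has_partial_def by (auto intro!: has_vector_derivative_add)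

lemma C2_with_scaleR:
  assumes "C2_with K DK DDK" "C2_with Z DZ DDZ"
  shows "C2_with (\<lambda>x. K x *\<^sub>R Z x) (\<lambda>i x. K x *\<^sub>R DZ i x + DK i x *\<^sub>R Z x)
    (\<lambda>i j x. (K x *\<^sub>R DDZ i j x + DK j x *\<^sub>R DZ i x) + (DK i x *\<^sub>R DZ j x + DDK i j x *\<^sub>R Z x))"
  using assms unfolding C2_with_def
  by (auto intro!: continuous_intros has_partial_scaleR has_partial_add)

text \<open>With \<open>j = \<i>\<close> or \<open>j = - \<i>\<close>, according to the sign of the degree.\<close>

definition cpow :: "complex \<Rightarrow> nat \<Rightarrow> real^2 \<Rightarrow> complex" where
  "cpow j n x = (of_real (x $ 1) + j * of_real (x $ 2)) ^ n"

definition cdir :: "complex \<Rightarrow> 2 \<Rightarrow> complex" where "cdir j i = (if i = 1 then 1 else j)"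

lemma cpow_line: "of_real ((x + s *\<^sub>R axis i 1) $ 1) + j * of_real ((x + s *\<^sub>R axis i 1) $ 2)
  = (of_real (x $ 1) + j * of_real (x $ 2)) + of_real s * cdir j i" for x :: "real^2"
  using exhaust_2[of i] by (auto simp: axis_def cdir_def algebra_simps)

lemma has_partial_cpow: "has_partial (cpow j n) i (\<lambda>x. of_nat n * cdir j i * cpow j (n - 1) x)"
  unfolding has_partial_def
proof
  fix x :: "real^2"
  define c where "c = of_real (x $ 1) + j * of_real (x $ 2)"
  have "((\<lambda>z. (c + z * cdir j i) ^ n) has_field_derivative (of_nat n * cdir j i * c ^ (n - 1))) (at (of_real 0))"
    by (auto intro!: derivative_eq_intros)
  then have "((\<lambda>s. (c + of_real s * cdir j i) ^ n) has_vector_derivative (of_nat n * cdir j i * c ^ (n - 1))) (at 0)"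
    by (rule has_vector_derivative_real_field)
  then show "((\<lambda>s. cpow j n (x + s *\<^sub>R axis i 1)) has_vector_derivative (of_nat n * cdir j i * cpow j (n - 1) x)) (at 0)"
    unfolding cpow_def cpow_line c_def .
qed

lemma has_partial_cmult: "has_partial F i D \<Longrightarrow> has_partial (\<lambda>x. c * F x) i (\<lambda>x. c * D x)" for c :: "'b::real_normed_algebra"
  unfolding has_partial_def by (auto intro!: has_vector_derivative_mult_right)

lemma continuous_cpow: "continuous_on S (cpow j n)"
  unfolding cpow_def by (intro continuous_intros)

lemma C2_with_cpow: "C2_with (cpow j n) (\<lambda>i x. of_nat n * cdir j i * cpow j (n - 1) x)
   (\<lambda>i l x. of_nat n * cdir j i * (of_nat (n - 1) * cdir j l * cpow j (n - 1 - 1) x))"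
  unfolding C2_with_def
  by (intro conjI allI continuous_intros continuous_cpow has_partial_cpow has_partial_cmult)

text \<open>Enough for \<open>f (x \<bullet> x)\<close> to be \<open>C\<^sup>2\<close>: \<open>f1\<close> need not be differentiable at 0, since its
  derivative only enters as \<open>x $ i * x $ j * f2 (x \<bullet> x)\<close>.\<close>

definition radial :: "real \<Rightarrow> (real \<Rightarrow> real) \<Rightarrow> (real \<Rightarrow> real) \<Rightarrow> (real \<Rightarrow> real) \<Rightarrow> bool" where
  "radial \<delta> f f1 f2 \<longleftrightarrow> 0 < \<delta> \<and> (\<forall>x>-\<delta>. (f has_real_derivative f1 x) (at x)) \<and> (\<forall>x>-\<delta>. isCont f1 x) \<and>
     (\<forall>x>0. (f1 has_real_derivative f2 x) (at x)) \<and> (\<forall>x>0. isCont f2 x) \<and> ((\<lambda>x. x * f2 x) \<longlongrightarrow> 0) (at_right 0)"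

lemma radialD:
  assumes "radial \<delta> f f1 f2"
  shows "0 < \<delta>" "-\<delta> < x \<Longrightarrow> (f has_real_derivative f1 x) (at x)" "-\<delta> < x \<Longrightarrow> isCont f x" "-\<delta> < x \<Longrightarrow> isCont f1 x"
    "0 < x \<Longrightarrow> (f1 has_real_derivative f2 x) (at x)" "0 < x \<Longrightarrow> isCont f2 x" "((\<lambda>x. x * f2 x) \<longlongrightarrow> 0) (at_right 0)"
  using assms unfolding radial_def by (blast intro: DERIV_isCont)+

lemma radial_at_0:
  assumes "radial \<delta> f f1 f2"
  shows "(f \<longlongrightarrow> f 0) (at_right 0)" "(f1 \<longlongrightarrow> f1 0) (at_right 0)"
  using radialD(3,4)[OF assms, of 0] radialD(1)[OF assms] by (auto intro: isCont_at_right)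

lemma radial_mult:
  assumes f: "radial \<delta> f f1 f2" and g: "radial \<delta> g g1 g2"
  shows "radial \<delta> (\<lambda>x. f x * g x) (\<lambda>x. f1 x * g x + g1 x * f x) (\<lambda>x. f2 x * g x + 2 * (f1 x * g1 x) + g2 x * f x)"
  unfolding radial_def
proof (intro conjI allI impI)
  have "((\<lambda>x. (x * f2 x) * g x + x * (2 * (f1 x * g1 x)) + (x * g2 x) * f x) \<longlongrightarrow>
     0 * g 0 + 0 * (2 * (f1 0 * g1 0)) + 0 * f 0) (at_right 0)"
    by (intro tendsto_intros radialD(7)[OF f] radialD(7)[OF g] radial_at_0[OF f] radial_at_0[OF g])
  then show "((\<lambda>x. x * (f2 x * g x + 2 * (f1 x * g1 x) + g2 x * f x)) \<longlongrightarrow> 0) (at_right 0)"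
    by (simp add: algebra_simps)
next
  have d: "- \<delta> < x" if "0 < x" for x using radialD(1)[OF f] that by simp
  show "0 < \<delta>" by (rule radialD(1)[OF f])
  show "((\<lambda>x. f x * g x) has_real_derivative f1 x * g x + g1 x * f x) (at x)" if "- \<delta> < x" for x
    by (rule DERIV_mult[OF radialD(2)[OF f that] radialD(2)[OF g that]])
  show "isCont (\<lambda>x. f1 x * g x + g1 x * f x) x" if "- \<delta> < x" for x
    by (intro continuous_intros radialD(3,4)[OF f that] radialD(3,4)[OF g that])
  show "((\<lambda>x. f1 x * g x + g1 x * f x) has_real_derivative f2 x * g x + 2 * (f1 x * g1 x) + g2 x * f x) (at x)" if "0 < x" for x
    using DERIV_add[OF DERIV_mult[OF radialD(5)[OF f that] radialD(2)[OF g d[OF that]]]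
      DERIV_mult[OF radialD(5)[OF g that] radialD(2)[OF f d[OF that]]]] by (simp add: algebra_simps)
  show "isCont (\<lambda>x. f2 x * g x + 2 * (f1 x * g1 x) + g2 x * f x) x" if "0 < x" for x
    by (intro continuous_intros radialD(3,4)[OF f d[OF that]] radialD(3,4)[OF g d[OF that]] radialD(6)[OF f that] radialD(6)[OF g that])
qed

lemma radial_compose:
  assumes f: "radial \<delta> f f1 f2" and \<phi>: "\<And>x. (\<phi> has_real_derivative \<phi>1 x) (at x)" "\<And>x. (\<phi>1 has_real_derivative \<phi>2 x) (at x)"
    "\<And>x. isCont \<phi>2 x"
  shows "radial \<delta> (\<lambda>x. \<phi> (f x)) (\<lambda>x. \<phi>1 (f x) * f1 x) (\<lambda>x. \<phi>2 (f x) * f1 x ^ 2 + \<phi>1 (f x) * f2 x)"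
  unfolding radial_def
proof (intro conjI allI impI)
  have c1: "isCont \<phi>1 x" for x using \<phi>(2) by (rule DERIV_isCont)
  have d: "((\<lambda>x. \<phi> (f x)) has_real_derivative \<phi>1 (f x) * f1 x) (at x)" if "-\<delta> < x" for x
    by (rule DERIV_chain2[where f = \<phi>, OF \<phi>(1) radialD(2)[OF f that]])
  have d1: "((\<lambda>x. \<phi>1 (f x)) has_real_derivative \<phi>2 (f x) * f1 x) (at x)" if "-\<delta> < x" for x
    by (rule DERIV_chain2[where f = \<phi>1, OF \<phi>(2) radialD(2)[OF f that]])
  have cc1: "isCont (\<lambda>x. \<phi>1 (f x)) x" if "-\<delta> < x" for x using d1[OF that] by (rule DERIV_isCont)
  have cc2: "isCont (\<lambda>x. \<phi>2 (f x)) x" if "-\<delta> < x" for x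
    by (rule isCont_o2[OF radialD(3)[OF f that] \<phi>(3)])
  show "((\<lambda>x. \<phi> (f x)) has_real_derivative \<phi>1 (f x) * f1 x) (at x)" if "-\<delta> < x" for x by (rule d[OF that])
  show "isCont (\<lambda>x. \<phi>1 (f x) * f1 x) x" if "-\<delta> < x" for x by (intro continuous_intros cc1 radialD[OF f] that)
  show "((\<lambda>x. \<phi>1 (f x) * f1 x) has_real_derivative \<phi>2 (f x) * f1 x ^ 2 + \<phi>1 (f x) * f2 x) (at x)" if "0 < x" for x
  proof -
    have "- \<delta> < x" using radialD(1)[OF f] that by simp
    from DERIV_mult[OF d1[OF this] radialD(5)[OF f that]] show ?thesis by (simp add: algebra_simps power2_eq_square)
  qed
  show "isCont (\<lambda>x. \<phi>2 (f x) * f1 x ^ 2 + \<phi>1 (f x) * f2 x) x" if "0 < x" for x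
    using that radialD(1)[OF f] by (intro continuous_intros cc1 cc2 radialD[OF f]) auto
  show "0 < \<delta>" by (rule radialD(1)[OF f])
  have "((\<lambda>x. x * (\<phi>2 (f x) * f1 x ^ 2) + \<phi>1 (f x) * (x * f2 x)) \<longlongrightarrow>
     0 * (\<phi>2 (f 0) * f1 0 ^ 2) + \<phi>1 (f 0) * 0) (at_right 0)"
    by (intro tendsto_intros radialD[OF f] radial_at_0[OF f] isCont_at_right cc1 cc2) (use radialD(1)[OF f] in auto)
  then show "((\<lambda>x. x * (\<phi>2 (f x) * f1 x ^ 2 + \<phi>1 (f x) * f2 x)) \<longlongrightarrow> 0) (at_right 0)"
    by (simp add: algebra_simps)
qed

lemma radial_ent:
  assumes f: "radial \<delta> f f1 f2" and c: "entire c"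
  shows "\<exists>g1 g2. radial \<delta> (\<lambda>x. power_series c (f x)) g1 g2"
proof -
  have "isCont (power_series (diffs (diffs c))) x" for x
    using power_series_DERIV[OF entire_diffs[OF entire_diffs[OF c]]] by (rule DERIV_isCont)
  from radial_compose[OF f power_series_DERIV[OF c] power_series_DERIV[OF entire_diffs[OF c]] this] show ?thesis by blast
qed

lemma radial_power: "0 < \<delta> \<Longrightarrow> radial \<delta> (\<lambda>x. x ^ n) (\<lambda>x. real n * x ^ (n - 1)) (\<lambda>x. real n * (real (n - 1) * x ^ (n - 1 - 1)))"
  unfolding radial_def
proof (intro conjI allI impI)
  have "isCont (\<lambda>x::real. x * (real n * (real (n - 1) * x ^ (n - 1 - 1)))) 0" by (intro continuous_intros)
  from isCont_at_right[OF this]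
  show "((\<lambda>x::real. x * (real n * (real (n - 1) * x ^ (n - 1 - 1)))) \<longlongrightarrow> 0) (at_right 0)" by simp
qed (auto intro!: derivative_eq_intros continuous_intros)

lemma radial_scale:
  assumes f: "radial \<delta> f f1 f2" and b: "0 < b"
  shows "radial (\<delta> / b) (\<lambda>x. a * f (b * x)) (\<lambda>x. a * b * f1 (b * x)) (\<lambda>x. a * b^2 * f2 (b * x))"
  unfolding radial_def
proof (intro conjI allI impI)
  have bx: "- \<delta> < b * x" if "- (\<delta> / b) < x" for x
    using that b by (simp add: pos_minus_divide_less_eq mult.commute flip: minus_divide_left)
  show "0 < \<delta> / b" using radialD(1)[OF f] b by simp
  show "((\<lambda>x. a * f (b * x)) has_real_derivative a * b * f1 (b * x)) (at x)" if "- (\<delta> / b) < x" for x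
  proof -
    have "((\<lambda>x. f (b * x)) has_real_derivative f1 (b * x) * b) (at x)"
      by (rule DERIV_chain2[where f = f and g = "\<lambda>x. b * x", OF radialD(2)[OF f bx[OF that]]]) (auto intro!: derivative_eq_intros)
    from DERIV_cmult[OF this, of a] show ?thesis by (simp add: mult_ac)
  qed
  show "isCont (\<lambda>x. a * b * f1 (b * x)) x" if "- (\<delta> / b) < x" for x
  proof -
    have "isCont (\<lambda>x. f1 (b * x)) x"
      by (rule isCont_o2[where f = "\<lambda>x. b * x" and g = f1, OF _ radialD(4)[OF f bx[OF that]]]) (intro continuous_intros)
    then show ?thesis by (intro continuous_intros)
  qed
  show "((\<lambda>x. a * b * f1 (b * x)) has_real_derivative a * b^2 * f2 (b * x)) (at x)" if "0 < x" for x
  proof -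
    have "0 < b * x" using b that by simp
    then have "((\<lambda>x. f1 (b * x)) has_real_derivative f2 (b * x) * b) (at x)"
      by (intro DERIV_chain2[where f = f1 and g = "\<lambda>x. b * x", OF radialD(5)[OF f]]) (auto intro!: derivative_eq_intros)
    from DERIV_cmult[OF this, of "a * b"] show ?thesis by (simp add: mult_ac power2_eq_square)
  qed
  show "isCont (\<lambda>x. a * b^2 * f2 (b * x)) x" if "0 < x" for x
  proof -
    have "0 < b * x" using b that by simp
    then have "isCont (\<lambda>x. f2 (b * x)) x"
      by (intro isCont_o2[where f = "\<lambda>x. b * x" and g = f2, OF _ radialD(6)[OF f]] continuous_intros)
    then show ?thesis by (intro continuous_intros)
  qed
  have "filterlim (\<lambda>x. b * x) (at_right 0) (at_right 0)"
    unfolding filterlim_at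
  proof
    show "eventually (\<lambda>x. b * x \<in> {0<..} \<and> b * x \<noteq> 0) (at_right 0)"
      using b unfolding eventually_at_right_field by (intro exI[of _ 1]) auto
  qed (auto intro!: tendsto_eq_intros)
  from tendsto_mult_right[OF filterlim_compose[OF radialD(7)[OF f] this], of "a * b"]
  show "((\<lambda>x. x * (a * b^2 * f2 (b * x))) \<longlongrightarrow> 0) (at_right 0)"
    by (simp add: mult_ac power2_eq_square)
qed

lemma radial_regular:
  assumes "regular n k p"
  shows "\<exists>q. radial 1 k p q"
proof -
  obtain g where g: "continuous_on {0..} g" "p 0 = g 0 / real (n + 1)"
     "\<And>x. 0 < x \<Longrightarrow> (p has_real_derivative (g x - real (n + 1) * p x) / x) (at x)"
     and k: "\<And>x. -1 < x \<Longrightarrow> (k has_real_derivative p x) (at x)" and cp: "\<And>x. isCont p x"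
    using assms unfolding regular_def by blast
  have cg: "isCont g x" if "0 < x" for x
    using continuous_on_interior[OF g(1)] that by (simp add: interior_Ici)
  have "radial 1 k p (\<lambda>x. (g x - real (n + 1) * p x) / x)"
    unfolding radial_def
  proof (intro conjI allI impI)
    have "(g \<longlongrightarrow> g 0) (at_right 0)"
      using g(1)[unfolded continuous_on_def, rule_format, of 0] by (simp add: at_within_Ici_at_right)
    then have "((\<lambda>x. g x - real (n + 1) * p x) \<longlongrightarrow> g 0 - real (n + 1) * p 0) (at_right 0)"
      using isCont_at_right[OF cp] by (intro tendsto_intros)
    then have "((\<lambda>x. g x - real (n + 1) * p x) \<longlongrightarrow> 0) (at_right 0)" using g(2) by simp
    then show "((\<lambda>x. x * ((g x - real (n + 1) * p x) / x)) \<longlongrightarrow> 0) (at_right 0)"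
      by (rule Lim_transform_eventually) (auto simp: eventually_at_right_field intro!: exI[of _ 1])
  qed (use g(3) in \<open>auto intro!: continuous_intros k cp cg\<close>)
  then show ?thesis by blast
qed

lemma norm_sq_line: "(x + s *\<^sub>R axis i 1) \<bullet> (x + s *\<^sub>R axis i 1) = x \<bullet> x + 2 * s * x $ i + s^2" for x :: "real^'n::finite"
  by (simp add: inner_add_left inner_add_right inner_axis inner_axis' inner_axis_axis power2_eq_square algebra_simps)

lemma C2_with_radial:
  fixes f f1 f2 :: "real \<Rightarrow> real"
  assumes f: "radial \<delta> f f1 f2"
  shows "C2_with (\<lambda>x::real^'n::finite. f (x \<bullet> x)) (\<lambda>i x. 2 * x $ i * f1 (x \<bullet> x))
    (\<lambda>i j x. (if i = j then 2 else 0) * f1 (x \<bullet> x) + 4 * x $ i * x $ j * f2 (x \<bullet> x))"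
  unfolding C2_with_def
proof (intro conjI allI)
  have m1: "-\<delta> < x \<bullet> x" for x :: "real^'n" 
  proof (rule less_le_trans[of _ 0])
    show "- \<delta> < 0" using radialD(1)[OF f] by simp
  qed simp
  have dl: "((\<lambda>s. (x + s *\<^sub>R axis i 1) \<bullet> (x + s *\<^sub>R axis i 1)) has_real_derivative 2 * x $ i) (at 0)" for x :: "real^'n" and i
    unfolding norm_sq_line by (auto intro!: derivative_eq_intros)
  have cf: "continuous_on UNIV (\<lambda>x::real^'n. g (x \<bullet> x))" if "\<And>x. -\<delta> < x \<Longrightarrow> isCont g x" for g :: "real \<Rightarrow> real"
  proof (intro continuous_at_imp_continuous_on ballI)
    fix x :: "real^'n"
    have "isCont (\<lambda>x::real^'n. x \<bullet> x) x" by (intro continuous_intros)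
    then show "isCont (\<lambda>x::real^'n. g (x \<bullet> x)) x" by (rule isCont_o2[where f = "\<lambda>x. x \<bullet> x" and g = g, OF _ that[OF m1]])
  qed
  show "continuous_on UNIV (\<lambda>x::real^'n. f (x \<bullet> x))" by (rule cf) (rule radialD(3)[OF f])
  have cf1: "continuous_on UNIV (\<lambda>x::real^'n. f1 (x \<bullet> x))" by (rule cf) (rule radialD(4)[OF f])
  then show "continuous_on UNIV (\<lambda>x::real^'n. 2 * x $ i * f1 (x \<bullet> x))" for i by (intro continuous_intros)
  show "has_partial (\<lambda>x::real^'n. f (x \<bullet> x)) i (\<lambda>x. 2 * x $ i * f1 (x \<bullet> x))" for i
    unfolding has_partial_def has_real_derivative_iff_has_vector_derivative[symmetric]
  proof
    fix x :: "real^'n"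
    have "((\<lambda>s. f ((x + s *\<^sub>R axis i 1) \<bullet> (x + s *\<^sub>R axis i 1))) has_real_derivative f1 (x \<bullet> x) * (2 * x $ i)) (at 0)"
      by (rule DERIV_chain2[where f = f, OF _ dl]) (use radialD(2)[OF f m1[of x]] in simp)
    then show "((\<lambda>s. f ((x + s *\<^sub>R axis i 1) \<bullet> (x + s *\<^sub>R axis i 1))) has_real_derivative 2 * x $ i * f1 (x \<bullet> x)) (at 0)"
      by (simp add: mult_ac)
  qed
  fix i j :: 'n
  show "has_partial (\<lambda>x::real^'n. 2 * x $ i * f1 (x \<bullet> x)) j
      (\<lambda>x. (if i = j then 2 else 0) * f1 (x \<bullet> x) + 4 * x $ i * x $ j * f2 (x \<bullet> x))"
    unfolding has_partial_def has_real_derivative_iff_has_vector_derivative[symmetric]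
  proof
    fix x :: "real^'n"
    have comp: "((\<lambda>s. 2 * (x + s *\<^sub>R axis j 1) $ i) has_real_derivative (if i = j then 2 else 0)) (at 0)"
      by (auto intro!: derivative_eq_intros simp: axis_def)
    show "((\<lambda>s. 2 * (x + s *\<^sub>R axis j 1) $ i * f1 ((x + s *\<^sub>R axis j 1) \<bullet> (x + s *\<^sub>R axis j 1))) has_real_derivative
       (if i = j then 2 else 0) * f1 (x \<bullet> x) + 4 * x $ i * x $ j * f2 (x \<bullet> x)) (at 0)"
    proof (cases "x = 0")
      case False
      then have "0 < x \<bullet> x" by simp
      then have "((\<lambda>s. f1 ((x + s *\<^sub>R axis j 1) \<bullet> (x + s *\<^sub>R axis j 1))) has_real_derivative f2 (x \<bullet> x) * (2 * x $ j)) (at 0)"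
        by (intro DERIV_chain2[where f = f1, OF _ dl]) (use radialD(5)[OF f] in simp)
      from DERIV_mult[OF comp this] show ?thesis by (simp add: algebra_simps)
    next
      case True
      \<comment> \<open>At the origin \<open>f1\<close> need not be differentiable; the difference
        quotient of \<open>2 s f1 (s^2)\<close> is computed directly and requires only the
        continuity of \<open>f1\<close>.\<close>
      have "isCont (\<lambda>s::real. f1 (s^2)) 0"
        by (rule isCont_o2[where g = f1]) (auto intro!: continuous_intros radialD[OF f])
      then have "((\<lambda>s::real. f1 (s^2)) \<longlongrightarrow> f1 0) (at 0)" by (simp add: isCont_def)
      then have "((\<lambda>s::real. (if i = j then 2 else 0) * f1 (s^2)) \<longlongrightarrow> (if i = j then 2 else 0) * f1 0) (at 0)"
        by (intro tendsto_intros)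
      moreover have "eventually (\<lambda>s::real. (if i = j then 2 else 0) * f1 (s^2) = (2 * (s * (if i = j then 1 else 0)) * f1 (s^2)) / s) (at 0)"
        by (auto simp: eventually_at_filter)
      ultimately have "((\<lambda>s::real. (2 * (s * (if i = j then 1 else 0)) * f1 (s^2)) / s) \<longlongrightarrow> (if i = j then 2 else 0) * f1 0) (at 0)"
        by (rule Lim_transform_eventually)
      then have D: "((\<lambda>s. 2 * (s * (if i = j then 1 else 0)) * f1 (s^2)) has_real_derivative (if i = j then 2 else 0) * f1 0) (at 0)"
        unfolding DERIV_def by simp
      have eq: "(\<lambda>s. 2 * (x + s *\<^sub>R axis j 1) $ i * f1 ((x + s *\<^sub>R axis j 1) \<bullet> (x + s *\<^sub>R axis j 1)))
          = (\<lambda>s. 2 * (s * (if i = j then 1 else 0)) * f1 (s^2))"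
        unfolding norm_sq_line True by (auto simp: fun_eq_iff axis_def)
      have "(if i = j then 2 else 0) * f1 (x \<bullet> x) + 4 * x $ i * x $ j * f2 (x \<bullet> x) = (if i = j then 2 else 0) * f1 0"
        by (simp add: True)
      then show ?thesis using D unfolding eq by (simp only:)
    qed
  qed
  show "continuous_on UNIV (\<lambda>x::real^'n. (if i = j then 2 else 0) * f1 (x \<bullet> x) + 4 * x $ i * x $ j * f2 (x \<bullet> x))"
  proof (intro continuous_on_add continuous_on_mult_left cf1)
    have "isCont (\<lambda>x::real^'n. 4 * x $ i * x $ j * f2 (x \<bullet> x)) x" for x :: "real^'n"
    proof (cases "x = 0")
      case False
      then have "isCont (\<lambda>x::real^'n. f2 (x \<bullet> x)) x"
        by (intro isCont_o2[where f = "\<lambda>x. x \<bullet> x" and g = f2, OF _ radialD(6)[OF f]]) (auto intro!: continuous_intros)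
      then show ?thesis by (intro continuous_intros)
    next
      case True
      \<comment> \<open>At the origin \<open>|x $ i * x $ j| \<le> x \<bullet> x\<close> reduces
        continuity to the limit of \<open>x * f2 x\<close> at 0.\<close>
      have nn: "filterlim (\<lambda>x::real^'n. x \<bullet> x) (at_right 0) (at 0)"
        unfolding filterlim_at
      proof
        show "eventually (\<lambda>x::real^'n. x \<bullet> x \<in> {0<..} \<and> x \<bullet> x \<noteq> 0) (at 0)"
          by (auto simp: eventually_at_filter)
        show "((\<lambda>x::real^'n. x \<bullet> x) \<longlongrightarrow> 0) (at 0)" by (rule tendsto_eq_intros refl | simp)+
      qed
      have "((\<lambda>x::real^'n. 4 * \<bar>(x \<bullet> x) * f2 (x \<bullet> x)\<bar>) \<longlongrightarrow> 4 * \<bar>0\<bar>) (at 0)"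
        by (intro tendsto_intros filterlim_compose[OF radialD(7)[OF f] nn])
      then have l: "((\<lambda>x::real^'n. 4 * \<bar>(x \<bullet> x) * f2 (x \<bullet> x)\<bar>) \<longlongrightarrow> 0) (at 0)" by simp
      have "((\<lambda>x::real^'n. 4 * x $ i * x $ j * f2 (x \<bullet> x)) \<longlongrightarrow> 0) (at 0)"
      proof (rule Lim_null_comparison[OF always_eventually l], rule allI)
        fix x :: "real^'n"
        have "\<bar>x $ i * x $ j\<bar> \<le> norm x * norm x"
          unfolding abs_mult by (intro mult_mono component_le_norm_cart) auto
        then have "\<bar>x $ i * x $ j\<bar> \<le> x \<bullet> x" by (simp add: dot_square_norm power2_eq_square)
        then have "\<bar>x $ i * x $ j\<bar> * \<bar>f2 (x \<bullet> x)\<bar> \<le> (x \<bullet> x) * \<bar>f2 (x \<bullet> x)\<bar>" by (intro mult_right_mono) auto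
        then show "norm (4 * x $ i * x $ j * f2 (x \<bullet> x)) \<le> 4 * \<bar>(x \<bullet> x) * f2 (x \<bullet> x)\<bar>"
          by (simp add: abs_mult)
      qed
      then show ?thesis by (simp add: isCont_def True)
    qed
    then show "continuous_on UNIV (\<lambda>x::real^'n. 4 * x $ i * x $ j * f2 (x \<bullet> x))"
      by (intro continuous_at_imp_continuous_on) auto
  qed
qed

section \<open>The rotating map in complex notation\<close>

definition embed :: "complex \<times> real \<Rightarrow> real^3" where
  "embed p = vector [Re (fst p), Im (fst p), snd p]"

lemma bounded_linear_embed: "bounded_linear embed"
  unfolding linear_conv_bounded_linear[symmetric] embed_def
  by (rule linearI) (auto simp: vec_eq_iff forall_3)

lemma embed_nth [simp]: "embed p $ 1 = Re (fst p)" "embed p $ 2 = Im (fst p)" "embed p $ 3 = snd p"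
  by (auto simp: embed_def)

lemma norm_embed: "norm (embed (w, c)) ^ 2 = norm w ^ 2 + c ^ 2"
  by (simp add: norm_vec_def L2_set_def sum_3 cmod_def)

lemma has_partial_embed:
  assumes "has_partial F i D" "has_partial f i d"
  shows "has_partial (\<lambda>x. embed (c * F x, f x)) i (\<lambda>x. embed (c * D x, d x))"
  unfolding has_partial_def
proof
  fix x
  show "((\<lambda>s. embed (c * F (x + s *\<^sub>R axis i 1), f (x + s *\<^sub>R axis i 1))) has_vector_derivative embed (c * D x, d x)) (at 0)"
    using assms unfolding has_partial_def
    by (intro bounded_linear.has_vector_derivative[OF bounded_linear_embed] has_vector_derivative_Pair has_vector_derivative_mult_right) auto
qed

lemma continuous_on_embed:
  assumes "continuous_on UNIV F" "continuous_on UNIV f"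
  shows "continuous_on UNIV (\<lambda>(x, t). embed (cis (om * t) * F x, f x))"
proof -
  have "continuous_on UNIV (\<lambda>z. F (fst z))" "continuous_on UNIV (\<lambda>z. f (fst z))"
    by (auto intro!: continuous_on_compose2[OF assms(1)] continuous_on_compose2[OF assms(2)] continuous_intros)
  then show ?thesis unfolding split_beta
    by (intro bounded_linear.continuous_on[OF bounded_linear_embed] continuous_intros)
qed

definition rotating :: "real \<Rightarrow> (real^2 \<Rightarrow> complex) \<Rightarrow> (real^2 \<Rightarrow> real) \<Rightarrow> real^2 \<Rightarrow> real \<Rightarrow> real^3" where
  "rotating om F f x t = embed (cis (om * t) * F x, f x)"

lemma rotating_C2:
  assumes F: "C2_with F D DD" and f: "C2_with f d dd"
  shows "spatially_C2 (rotating om F f)"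
    and "laplacian (\<lambda>y. rotating om F f y t) x = embed (cis (om * t) * (\<Sum>i\<in>UNIV. DD i i x), \<Sum>i\<in>UNIV. dd i i x)"
proof -
  have p: "has_partial (\<lambda>y. rotating om F f y t) i (\<lambda>x. embed (cis (om * t) * D i x, d i x))" for t i
    using F f unfolding rotating_def C2_with_def by (intro has_partial_embed) auto
  have p2: "has_partial (\<lambda>x. embed (cis (om * t) * D i x, d i x)) j (\<lambda>x. embed (cis (om * t) * DD i j x, dd i j x))" for t i j
    using F f unfolding C2_with_def by (intro has_partial_embed) auto
  note pe = has_partial_partial_deriv[OF p] and pe2 = has_partial_partial_deriv[OF p2]
  show "spatially_C2 (rotating om F f)"
    unfolding spatially_C2_def pe pe2
    using F f has_partial_differentiable[OF p] has_partial_differentiable[OF p2] unfolding rotating_def C2_with_def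
    by (auto intro!: continuous_on_embed)
  have "bounded_linear embed" by (rule bounded_linear_embed)
  then interpret bounded_linear embed .
  show "laplacian (\<lambda>y. rotating om F f y t) x = embed (cis (om * t) * (\<Sum>i\<in>UNIV. DD i i x), \<Sum>i\<in>UNIV. dd i i x)"
    unfolding laplacian_def pe pe2 by (simp add: sum[symmetric] sum_prod sum_distrib_left)
qed

lemma rotating_time_derivative:
  "((\<lambda>s. rotating om F f x s) has_vector_derivative embed (\<i> * of_real om * cis (om * t) * F x, 0)) (at t)"
proof -
  have "((\<lambda>z. exp (\<i> * of_real om * z)) has_field_derivative \<i> * of_real om * exp (\<i> * of_real om * of_real t)) (at (of_real t))"
    by (auto intro!: derivative_eq_intros)
  from has_vector_derivative_real_field[OF this]
  have "((\<lambda>s. cis (om * s)) has_vector_derivative \<i> * of_real om * cis (om * t)) (at t)"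
    by (simp add: cis_conv_exp mult.assoc)
  then show ?thesis unfolding rotating_def
    by (intro bounded_linear.has_vector_derivative[OF bounded_linear_embed] has_vector_derivative_Pair
      has_vector_derivative_mult_left has_vector_derivative_const)
qed

text \<open>The map and its Laplacian have horizontal parts that are real multiples of the same
  \<open>z\<close>. Their cross product then points along \<open>\<i> * z\<close>, the direction of
  the rotation, and the equation becomes a single real identity.\<close>

lemma cross_embed:
  "cross3 (embed (of_real S * z, C)) (embed (of_real L * z, M)) = embed (of_real (C * L - S * M) * (\<i> * z), 0)"
  by (simp add: vec_eq_iff forall_3 cross3_simps algebra_simps)

section \<open>The solution belonging to a profile\<close>

context
  fixes n :: nat and lam om \<delta> :: real and k p :: "real \<Rightarrow> real" and j :: complex
  assumes reg: "\<exists>q. radial \<delta> k p q" and prof: "profile n lam om (ansatz n k) (ansatz_slope n k p)"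
    and range: "\<And>r. 0 < r \<Longrightarrow> 0 < ansatz n k r \<and> ansatz n k r < pi" and j: "j = \<i> \<or> j = - \<i>"
begin

interpretation profile n lam om "ansatz n k" "ansatz_slope n k p" by (rule prof)

text \<open>\<open>amplitude\<close> and \<open>height\<close> are \<open>sin h / r^n\<close> and
  \<open>cos h\<close> as functions of \<open>x = r^2\<close>, in a form that remains smooth across
  \<open>x = 0\<close> as far as \<open>k\<close> is. The factor \<open>r^n\<close> is returned by
  the polynomial \<open>cpow\<close>.\<close>

definition amplitude :: "real \<Rightarrow> real" where "amplitude x = k x * power_series sin_c (x ^ n * (k x * k x))"
definition height :: "real \<Rightarrow> real" where "height x = power_series cos_c (x ^ n * (k x * k x))"

lemma amplitude_height: "0 \<le> r \<Longrightarrow> r ^ n * amplitude (r^2) = sin (ansatz n k r)" "height (r^2) = cos (ansatz n k r)"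
proof -
  have e: "(r^2) ^ n * (k (r^2) * k (r^2)) = (ansatz n k r)^2"
    by (simp add: ansatz_def power2_eq_square power_mult_distrib)
  show "height (r^2) = cos (ansatz n k r)" unfolding height_def e power_series_cos ..
  show "r ^ n * amplitude (r^2) = sin (ansatz n k r)" unfolding amplitude_def e power_series_sin[symmetric] by (simp add: ansatz_def)
qed

lemma amplitude_height_radial: "\<exists>S1 S2 C1 C2. radial \<delta> amplitude S1 S2 \<and> radial \<delta> height C1 C2"
proof -
  obtain q where q: "radial \<delta> k p q" using reg by blast
  obtain g1 g2 where g: "radial \<delta> (\<lambda>x. x ^ n * (k x * k x)) g1 g2"
    using radial_mult[OF radial_power[OF radialD(1)[OF q]] radial_mult[OF q q]] by blast
  obtain a1 a2 where a: "radial \<delta> (\<lambda>x. power_series sin_c (x ^ n * (k x * k x))) a1 a2"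
    using radial_ent[OF g entire_sin_c] by blast
  obtain b1 b2 where b: "radial \<delta> (\<lambda>x. power_series cos_c (x ^ n * (k x * k x))) b1 b2"
    using radial_ent[OF g entire_cos_c] by blast
  show ?thesis unfolding amplitude_def height_def using radial_mult[OF q a] b by blast
qed

text \<open>\<open>4 x S2 + 4 (n + 1) S1\<close> is the factor of \<open>cpow\<close> in the
  Laplacian of \<open>amplitude\<close> times \<open>cpow\<close>, and \<open>4 x C2 + 4 C1\<close>
  is the Laplacian of \<open>height\<close>. The identity is the one that \<open>cross_embed\<close>
  leaves over, and for \<open>x > 0\<close> it is the profile equation in the variable
  \<open>x = r^2\<close>.\<close>

lemma radial_ode:
  assumes S: "radial \<delta> amplitude S1 S2" and C: "radial \<delta> height C1 C2" and x: "0 < x"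
  shows "height x * (4 * x * S2 x + 4 * (real n + 1) * S1 x) - amplitude x * (4 * x * C2 x + 4 * C1 x + lam * height x) = om * amplitude x"
proof -
  define y where "y x = ansatz n k (sqrt x)" for x
  define V where "V x = ansatz_slope n k p (sqrt x)" for x
  \<comment> \<open>\<open>\<Phi>\<close> is \<open>r v'\<close>. As
    \<open>d/dx = (1 / (2 r)) d/dr\<close>, the derivatives of \<open>y\<close> and \<open>V\<close>
    in \<open>x\<close> are \<open>V / (2 x)\<close> and \<open>\<Phi> / (2 x)\<close>.\<close>
  define \<Phi> where "\<Phi> x = real n ^ 2 * sin (y x) * cos (y x) + x * (om + lam * cos (y x)) * sin (y x)" for x
  define q where "q x = 1 / sqrt x ^ n" for x :: real
  have dy: "(y has_real_derivative V t / (2 * t)) (at t)" if t: "0 < t" for t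
  proof -
    have "(y has_real_derivative (ansatz_slope n k p (sqrt t) / sqrt t) * (inverse (sqrt t) / 2)) (at t)"
      unfolding y_def by (rule DERIV_chain2[where f = "ansatz n k" and g = sqrt, OF dh DERIV_real_sqrt]) (use t in auto)
    moreover have "(ansatz_slope n k p (sqrt t) / sqrt t) * (inverse (sqrt t) / 2) = V t / (2 * t)"
      using t by (simp add: V_def field_simps)
    ultimately show ?thesis by metis
  qed
  have dV: "(V has_real_derivative \<Phi> t / (2 * t)) (at t)" if t: "0 < t" for t
  proof -
    have st: "0 < sqrt t" using t by simp
    define D where "D = real n ^ 2 * sin (y t) * cos (y t) / sqrt t + sqrt t * (om + lam * cos (y t)) * sin (y t)"
    have "(V has_real_derivative D * (inverse (sqrt t) / 2)) (at t)"
      unfolding V_def D_def y_def using range[OF st] t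
      by (intro DERIV_chain2[where f = "ansatz_slope n k p" and g = sqrt] dv DERIV_real_sqrt) auto
    moreover have "D * (inverse (sqrt t) / 2) = \<Phi> t / (2 * t)"
      using t by (simp add: D_def \<Phi>_def field_simps)
    ultimately show ?thesis by metis
  qed
  have dq: "(q has_real_derivative - (real n / (2 * t)) * q t) (at t)" if t: "0 < t" for t
  proof -
    have st: "0 < sqrt t" using t by simp
    define s where "s = sqrt t"
    have s: "0 < s" "t = s * s" using t by (auto simp: s_def)
    have "(q has_real_derivative - (real n * s ^ (n - 1) * (inverse s / 2)) / (s ^ n * s ^ n)) (at t)"
      unfolding q_def s_def using t st by (auto intro!: derivative_eq_intros)
    moreover have "- (real n * s ^ (n - 1) * (inverse s / 2)) / (s ^ n * s ^ n) = - (real n / (2 * t)) * q t"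
    proof -
      obtain m where "n = Suc m" using n by (cases n) auto
      then show ?thesis using s unfolding q_def s_def[symmetric] by (simp add: field_simps)
    qed
    ultimately show ?thesis by metis
  qed
  have Sy: "amplitude t = sin (y t) * q t" and Cy: "height t = cos (y t)" if t: "0 < t" for t
    using amplitude_height[of "sqrt t"] t by (simp_all add: y_def q_def field_simps)
  define N where "N t = cos (y t) * V t - real n * sin (y t)" for t
  have S1: "S1 t = q t * N t / (2 * t)" if t: "0 < t" for t
  proof -
    have "((\<lambda>t. sin (y t) * q t) has_real_derivative q t * N t / (2 * t)) (at t)"
      using t by (auto intro!: derivative_eq_intros dy dq simp: N_def field_simps)
    then have "(amplitude has_real_derivative q t * N t / (2 * t)) (at t)"
      by (rule has_field_derivative_transform_within_open[of _ _ _ "{0<..}"]) (use t Sy in auto)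
    then show ?thesis using radialD(2)[OF S, of t] radialD(1)[OF S] t by (auto intro: DERIV_unique)
  qed
  have C1: "C1 t = - sin (y t) * V t / (2 * t)" if t: "0 < t" for t
  proof -
    have "((\<lambda>t. cos (y t)) has_real_derivative - sin (y t) * V t / (2 * t)) (at t)"
      using t by (auto intro!: derivative_eq_intros dy)
    then have "(height has_real_derivative - sin (y t) * V t / (2 * t)) (at t)"
      by (rule has_field_derivative_transform_within_open[of _ _ _ "{0<..}"]) (use t Cy in auto)
    then show ?thesis using radialD(2)[OF C, of t] radialD(1)[OF C] t by (auto intro: DERIV_unique)
  qed
  define N' where "N' = (- sin (y x) * V x ^ 2 + cos (y x) * \<Phi> x - real n * cos (y x) * V x) / (2 * x)"
  have dN: "(N has_real_derivative N') (at x)"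
    unfolding N_def N'_def using x
    by (auto intro!: derivative_eq_intros dy dV simp: field_simps power2_eq_square)
  have S2: "S2 x = (- (real n / (2 * x)) * q x * N x + q x * N') / (2 * x) - q x * N x / (2 * x^2)"
  proof -
    have "((\<lambda>t. q t * N t / (2 * t)) has_real_derivative
      ((- (real n / (2 * x)) * q x * N x + N' * q x) * (2 * x) - q x * N x * 2) / (2 * x * (2 * x))) (at x)"
      using x by (auto intro!: derivative_eq_intros dq dN)
    then have "(S1 has_real_derivative
      ((- (real n / (2 * x)) * q x * N x + N' * q x) * (2 * x) - q x * N x * 2) / (2 * x * (2 * x))) (at x)"
      by (rule has_field_derivative_transform_within_open[of _ _ _ "{0<..}"]) (use x S1 in auto)
    then have "S2 x = ((- (real n / (2 * x)) * q x * N x + N' * q x) * (2 * x) - q x * N x * 2) / (2 * x * (2 * x))"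
      using radialD(5)[OF S x] by (auto intro: DERIV_unique)
    also have "\<dots> = (- (real n / (2 * x)) * q x * N x + q x * N') / (2 * x) - q x * N x / (2 * x^2)"
      using x by (simp add: field_simps power2_eq_square)
    finally show ?thesis .
  qed
  have C2: "C2 x = (- cos (y x) * V x ^ 2 - sin (y x) * \<Phi> x) / (2 * x) / (2 * x) + sin (y x) * V x / (2 * x^2)"
  proof -
    have "((\<lambda>t. - sin (y t) * V t / (2 * t)) has_real_derivative
      ((- (cos (y x) * (V x / (2 * x))) * V x + \<Phi> x / (2 * x) * - sin (y x)) * (2 * x) - (- sin (y x) * V x) * 2) / (2 * x * (2 * x))) (at x)"
      using x by (auto intro!: derivative_eq_intros dy dV simp: field_simps)
    then have "(C1 has_real_derivative
      ((- (cos (y x) * (V x / (2 * x))) * V x + \<Phi> x / (2 * x) * - sin (y x)) * (2 * x) - (- sin (y x) * V x) * 2) / (2 * x * (2 * x))) (at x)"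
      by (rule has_field_derivative_transform_within_open[of _ _ _ "{0<..}"]) (use x C1 in auto)
    then have "C2 x = ((- (cos (y x) * (V x / (2 * x))) * V x + \<Phi> x / (2 * x) * - sin (y x)) * (2 * x) - (- sin (y x) * V x) * 2) / (2 * x * (2 * x))"
      using radialD(5)[OF C x] by (auto intro: DERIV_unique)
    also have "\<dots> = (- cos (y x) * V x ^ 2 - sin (y x) * \<Phi> x) / (2 * x) / (2 * x) + sin (y x) * V x / (2 * x^2)"
      using x by (simp add: field_simps power2_eq_square)
    finally show ?thesis .
  qed
  have L: "4 * x * S2 x + 4 * (real n + 1) * S1 x = q x / x * (cos (y x) * \<Phi> x - sin (y x) * V x ^ 2 - real n ^ 2 * sin (y x))"
    unfolding S2 S1[OF x] N'_def N_def using x by (simp add: field_simps power2_eq_square)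
  have M: "4 * x * C2 x + 4 * C1 x = - (cos (y x) * V x ^ 2 + sin (y x) * \<Phi> x) / x"
    unfolding C2 C1[OF x] using x by (simp add: field_simps power2_eq_square)
  define s c where "s = sin (y x)" and "c = cos (y x)"
  have sc: "c * c = 1 - s * s" using sin_cos_squared_add[of "y x"] by (simp add: s_def c_def power2_eq_square)
  have "height x * (4 * x * S2 x + 4 * (real n + 1) * S1 x) - amplitude x * (4 * x * C2 x + 4 * C1 x + lam * height x)
    = q x / x * ((c * c + s * s) * \<Phi> x - real n ^ 2 * (s * c)) - lam * q x * s * c"
    unfolding L M Sy[OF x] Cy[OF x] s_def[symmetric] c_def[symmetric] using x
    by (simp add: field_simps power2_eq_square)
  also have "\<dots> = om * (s * q x)"
    unfolding sc \<Phi>_def s_def[symmetric] c_def[symmetric] using x by (simp add: field_simps power2_eq_square)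
  finally show ?thesis unfolding Sy[OF x] s_def .
qed

lemma solution:
  defines "u \<equiv> rotating om (\<lambda>x. amplitude (x \<bullet> x) *\<^sub>R cpow j n x) (\<lambda>x. height (x \<bullet> x))"
  shows "landau_lifshitz_solution lam u"
proof -
  have jj: "j * j = -1" using j by auto
  obtain S1 S2 C1 C2 where S: "radial \<delta> amplitude S1 S2" and C: "radial \<delta> height C1 C2" using amplitude_height_radial by blast
  note CS = C2_with_scaleR[OF C2_with_radial[OF S] C2_with_cpow[of j n]]
  note CCC = C2_with_radial[OF C, where 'n = 2]
  have nc: "norm (cpow j n x) = norm x ^ n" for x :: "real^2"
  proof -
    have "norm (of_real (x $ 1) + j * of_real (x $ 2)) = sqrt ((x $ 1)^2 + (x $ 2)^2)"
      using j by (auto simp: cmod_def)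
    also have "\<dots> = norm x" by (simp add: norm_eq_sqrt_inner inner_vec_def sum_2 power2_eq_square)
    finally show ?thesis by (simp add: cpow_def norm_power)
  qed
  \<comment> \<open>The terms with an undifferentiated \<open>amplitude\<close> carry the factor
    \<open>1 + j * j = 0\<close>: \<open>cpow\<close> is harmonic.\<close>
  have lapS: "(\<Sum>i\<in>UNIV. ((amplitude (x \<bullet> x) *\<^sub>R (of_nat n * cdir j i * (of_nat (n - 1) * cdir j i * cpow j (n - 1 - 1) x))
        + (2 * x $ i * S1 (x \<bullet> x)) *\<^sub>R (of_nat n * cdir j i * cpow j (n - 1) x))
      + ((2 * x $ i * S1 (x \<bullet> x)) *\<^sub>R (of_nat n * cdir j i * cpow j (n - 1) x)
        + ((if i = i then 2 else 0) * S1 (x \<bullet> x) + 4 * x $ i * x $ i * S2 (x \<bullet> x)) *\<^sub>R cpow j n x)))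
    = of_real (4 * (x \<bullet> x) * S2 (x \<bullet> x) + 4 * (real n + 1) * S1 (x \<bullet> x)) * cpow j n x" for x :: "real^2"
  proof -
    have xx: "x \<bullet> x = x $ 1 * x $ 1 + x $ 2 * x $ 2" by (simp add: inner_vec_def sum_2)
    have cn: "cpow j n x = (of_real (x $ 1) + j * of_real (x $ 2)) * cpow j (n - 1) x"
      using n by (cases n) (auto simp: cpow_def)
    define z w where "z = cpow j (n - 1) x" and "w = cpow j (n - 1 - 1) x"
    define s1 s2 s0 where "s1 = S1 (x \<bullet> x)" and "s2 = S2 (x \<bullet> x)" and "s0 = amplitude (x \<bullet> x)"
    define a b where "a = complex_of_real (x $ 1)" and "b = complex_of_real (x $ 2)"
    have "of_real s0 * (of_nat n * (of_nat (n - 1) * w)) + of_real (2 * x $ 1 * s1) * (of_nat n * z)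
       + (of_real (2 * x $ 1 * s1) * (of_nat n * z) + of_real (2 * s1 + 4 * x $ 1 * x $ 1 * s2) * ((a + j * b) * z))
       + (of_real s0 * (of_nat n * j * (of_nat (n - 1) * j * w)) + of_real (2 * x $ 2 * s1) * (of_nat n * j * z)
       + (of_real (2 * x $ 2 * s1) * (of_nat n * j * z) + of_real (2 * s1 + 4 * x $ 2 * x $ 2 * s2) * ((a + j * b) * z)))
      = of_real s0 * of_nat n * of_nat (n - 1) * w * (1 + j * j) + of_real (4 * (x \<bullet> x) * s2 + 4 * (real n + 1) * s1) * ((a + j * b) * z)"
      unfolding xx a_def b_def by (simp add: algebra_simps)
    also have "1 + j * j = 0" using jj by simp
    finally show ?thesis
      unfolding sum_2 cn s1_def[symmetric] s2_def[symmetric] s0_def[symmetric] z_def[symmetric] w_def[symmetric]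
        a_def[symmetric] b_def[symmetric] by (simp add: cdir_def scaleR_conv_of_real)
  qed
  have lapC: "(\<Sum>i\<in>UNIV. (if i = i then 2 else 0) * C1 (x \<bullet> x) + 4 * x $ i * x $ i * C2 (x \<bullet> x))
     = 4 * (x \<bullet> x) * C2 (x \<bullet> x) + 4 * C1 (x \<bullet> x)" for x :: "real^2"
    by (simp add: sum_2 inner_vec_def algebra_simps)
  show ?thesis
    unfolding landau_lifshitz_solution_def
  proof (intro conjI allI)
    show "spatially_C2 u" unfolding u_def by (rule rotating_C2(1)[OF CS CCC])
    fix x t
    define z where "z = cis (om * t) * cpow j n x"
    have u: "u x t = embed (of_real (amplitude (x \<bullet> x)) * z, height (x \<bullet> x))"
      by (simp add: u_def rotating_def z_def scaleR_conv_of_real mult_ac)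
    have nz: "norm z = norm x ^ n" by (simp add: z_def norm_mult nc)
    have xx: "x \<bullet> x = norm x ^ 2" by (simp add: dot_square_norm)
    have "norm (u x t) ^ 2 = (norm (of_real (amplitude (x \<bullet> x)) * z))^2 + height (x \<bullet> x)^2"
      unfolding u by (rule norm_embed)
    also have "norm (of_real (amplitude (x \<bullet> x)) * z) = \<bar>sin (ansatz n k (norm x))\<bar>"
      unfolding norm_mult nz xx amplitude_height(1)[OF norm_ge_zero, symmetric] by (simp add: abs_mult)
    also have "\<bar>sin (ansatz n k (norm x))\<bar>^2 + height (x \<bullet> x)^2 = 1" unfolding xx amplitude_height(2) by simp
    finally show "u x t \<in> sphere 0 1" using power2_eq_imp_eq[of "norm (u x t)" 1] by simp
    define L M where "L = 4 * (x \<bullet> x) * S2 (x \<bullet> x) + 4 * (real n + 1) * S1 (x \<bullet> x)"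
      and "M = 4 * (x \<bullet> x) * C2 (x \<bullet> x) + 4 * C1 (x \<bullet> x)"
    have lap: "laplacian (\<lambda>y. u y t) x = embed (of_real L * z, M)"
      unfolding u_def rotating_C2(2)[OF CS CCC] lapS lapC by (simp add: L_def M_def z_def mult_ac)
    have "embed (of_real L * z, M) + (lam * u x t $ 3) *\<^sub>R vector [0, 0, 1] = embed (of_real L * z, M + lam * height (x \<bullet> x))"
      unfolding u by (simp add: vec_eq_iff forall_3)
    then have "cross3 (u x t) (laplacian (\<lambda>y. u y t) x + (lam * u x t $ 3) *\<^sub>R vector [0, 0, 1])
      = embed (of_real (height (x \<bullet> x) * L - amplitude (x \<bullet> x) * (M + lam * height (x \<bullet> x))) * (\<i> * z), 0)"
      unfolding lap using u by (simp only: cross_embed)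
    also have "of_real (height (x \<bullet> x) * L - amplitude (x \<bullet> x) * (M + lam * height (x \<bullet> x))) * (\<i> * z)
      = of_real (om * amplitude (x \<bullet> x)) * (\<i> * z)"
    \<comment> \<open>The scalar identity is available for \<open>0 < x \<bullet> x\<close>; at the
      origin both sides vanish because \<open>z\<close> does, as \<open>n \<ge> 1\<close>.\<close>
    proof (cases "x = 0")
      case True
      then have "z = 0" using nz n by (simp add: power_0_left)
      then show ?thesis by simp
    next
      case False
      then have "0 < x \<bullet> x" by simp
      from radial_ode[OF S C this] show ?thesis unfolding L_def M_def by (simp only:)
    qed
    also have "of_real (om * amplitude (x \<bullet> x)) * (\<i> * z) = \<i> * of_real om * cis (om * t) * (amplitude (x \<bullet> x) *\<^sub>R cpow j n x)"
      by (simp add: z_def scaleR_conv_of_real mult_ac)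
    finally show "((\<lambda>s. u x s) has_vector_derivative
        cross3 (u x t) (laplacian (\<lambda>y. u y t) x + (lam * u x t $ 3) *\<^sub>R vector [0, 0, 1])) (at t)"
      using rotating_time_derivative[of om "\<lambda>x. amplitude (x \<bullet> x) *\<^sub>R cpow j n x" "\<lambda>x. height (x \<bullet> x)" x t]
      unfolding u_def by (simp only:)
  qed
qed

lemma equivariant:
  assumes m: "m = (if j = \<i> then int n else - int n)"
  shows "equivariant_rotating m om (ansatz n k) (rotating om (\<lambda>x. amplitude (x \<bullet> x) *\<^sub>R cpow j n x) (\<lambda>x. height (x \<bullet> x)))"
  unfolding equivariant_rotating_def
proof (intro allI impI)
  fix r \<theta> t :: real assume r: "0 \<le> r"
  define x :: "real^2" where "x = vector [r * cos \<theta>, r * sin \<theta>]"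
  have x: "x $ 1 = r * cos \<theta>" "x $ 2 = r * sin \<theta>" by (simp_all add: x_def)
  have "x \<bullet> x = (r * cos \<theta>)^2 + (r * sin \<theta>)^2"
    by (simp add: inner_vec_def sum_2 x power2_eq_square)
  also have "\<dots> = r^2 * (cos \<theta> ^ 2 + sin \<theta> ^ 2)" by (simp only: power_mult_distrib distrib_left)
  finally have "x \<bullet> x = r^2 * (cos \<theta> ^ 2 + sin \<theta> ^ 2)" .
  then have xx: "x \<bullet> x = r^2" by simp
  have "of_real (x $ 1) + j * of_real (x $ 2) = of_real r * cis (if j = \<i> then \<theta> else - \<theta>)"
    using j by (auto simp: x complex_eq_iff)
  then have "cpow j n x = of_real (r ^ n) * cis (of_int m * \<theta>)"
    unfolding cpow_def by (cases "j = \<i>") (simp_all add: power_mult_distrib Complex.DeMoivre m)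
  then have "cis (om * t) * (amplitude (x \<bullet> x) *\<^sub>R cpow j n x) = of_real (r ^ n * amplitude (r^2)) * (cis (of_int m * \<theta>) * cis (om * t))"
    unfolding xx by (simp add: scaleR_conv_of_real mult_ac)
  then have "cis (om * t) * (amplitude (x \<bullet> x) *\<^sub>R cpow j n x) = of_real (r ^ n * amplitude (r^2)) * cis (of_int m * \<theta> + om * t)"
    unfolding cis_mult .
  then have "rotating om (\<lambda>x. amplitude (x \<bullet> x) *\<^sub>R cpow j n x) (\<lambda>x. height (x \<bullet> x)) x t
    = embed (of_real (sin (ansatz n k r)) * cis (of_int m * \<theta> + om * t), cos (ansatz n k r))"
    unfolding rotating_def xx amplitude_height(1)[OF r] amplitude_height(2) by simp
  then show "rotating om (\<lambda>x. amplitude (x \<bullet> x) *\<^sub>R cpow j n x) (\<lambda>x. height (x \<bullet> x)) (vector [r * cos \<theta>, r * sin \<theta>]) t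
    = vector [sin (ansatz n k r) * cos (of_int m * \<theta> + om * t), sin (ansatz n k r) * sin (of_int m * \<theta> + om * t), cos (ansatz n k r)]"
    unfolding x_def[symmetric] by (simp add: embed_def)
qed

end

lemma existence:
  fixes lam om :: real and m :: int
  assumes lam: "0 < lam" and m: "m \<noteq> 0" and om: "0 < om" "om < lam / \<bar>real_of_int m\<bar>"
  shows "\<exists>u h. landau_lifshitz_solution lam u \<and> equivariant_rotating m om h u \<and>
            h 0 = 0 \<and> (h \<longlongrightarrow> pi) at_top \<and> (\<forall>r>0. 0 < h r \<and> h r < pi)"
proof -
  define n where "n = nat \<bar>m\<bar>"
  have n: "1 \<le> n" using m by (simp add: n_def)
  have mn: "\<bar>real_of_int m\<bar> = real n" by (simp add: n_def)
  have sub: "real n * om < lam" using om n unfolding mn by (simp add: field_simps)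
  obtain e k p where e: "0 < e" and reg: "regular n k p" and prof: "profile n (e * lam) (e * om) (ansatz n k) (ansatz_slope n k p)"
    and range: "\<And>r. 0 < r \<Longrightarrow> 0 < ansatz n k r \<and> ansatz n k r < pi" and lim: "(ansatz n k \<longlongrightarrow> pi) at_top"
    using regular_profile_exists[OF n lam om(1) sub] by blast
  define c where "c = 1 / sqrt e"
  have c: "0 < c" using e by (simp add: c_def)
  \<comment> \<open>Since \<open>h (c r) = r^n c^n k (c^2 r^2)\<close>, scaling in \<open>r\<close>
    acts on \<open>k\<close> in this way; it leads from the parameters \<open>e * lam\<close>,
    \<open>e * om\<close> back to \<open>lam\<close>, \<open>om\<close>.\<close>
  define k' p' where "k' x = c ^ n * k (c^2 * x)" and "p' x = c ^ n * c^2 * p (c^2 * x)" for x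
  have h': "ansatz n k' r = ansatz n k (c * r)" for r
    by (simp add: ansatz_def k'_def power_mult_distrib)
  have v': "ansatz_slope n k' p' r = ansatz_slope n k p (c * r)" for r
    by (simp add: ansatz_slope_def k'_def p'_def power_mult_distrib algebra_simps)
  obtain q where q: "radial 1 k p q" using radial_regular[OF reg] by blast
  have rad: "\<exists>q. radial (1 / c^2) k' p' q"
    using radial_scale[OF q, of "c^2" "c ^ n"] c unfolding k'_def p'_def by auto
  have prof': "profile n lam om (ansatz n k') (ansatz_slope n k' p')"
    using profile_scale[OF prof e] unfolding h' v' c_def by (simp add: h'[abs_def] v'[abs_def] c_def)
  have range': "0 < ansatz n k' r \<and> ansatz n k' r < pi" if "0 < r" for r
    unfolding h' using range[of "c * r"] that c by simp
  have lim': "(ansatz n k' \<longlongrightarrow> pi) at_top"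
  proof -
    have "filterlim (\<lambda>r. c * r) at_top at_top"
      using c by (intro filterlim_tendsto_pos_mult_at_top[OF tendsto_const]) (auto intro: filterlim_ident)
    from filterlim_compose[OF lim this] show ?thesis unfolding h'[abs_def] .
  qed
  define j where "j = (if 0 < m then \<i> else - \<i>)"
  have j: "j = \<i> \<or> j = - \<i>" by (simp add: j_def)
  have "\<i> \<noteq> - \<i>" by (simp add: complex_eq_iff)
  then have mj: "m = (if j = \<i> then int n else - int n)" using m by (auto simp: j_def n_def)
  have "ansatz n k' 0 = 0" using n by (simp add: ansatz_def power_0_left)
  then show ?thesis
    using solution[OF rad prof' range' j] equivariant[OF rad prof' range' j mj] range' lim' by blast
qed

theorem theorem6p3:
  fixes lam om :: real and m :: int
  assumes "0 < lam" and "m \<noteq> 0"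
  shows "(\<exists>u h. landau_lifshitz_solution lam u \<and> equivariant_rotating m om h u \<and>
            h 0 = 0 \<and> (h \<longlongrightarrow> pi) at_top \<and> (\<forall>r>0. 0 < h r \<and> h r < pi))
         \<longleftrightarrow> 0 < om \<and> om < lam / \<bar>real_of_int m\<bar>"
proof
  assume "\<exists>u h. landau_lifshitz_solution lam u \<and> equivariant_rotating m om h u \<and>
            h 0 = 0 \<and> (h \<longlongrightarrow> pi) at_top \<and> (\<forall>r>0. 0 < h r \<and> h r < pi)"
  then show "0 < om \<and> om < lam / \<bar>real_of_int m\<bar>"
    using necessity[OF assms] by blast
next
  assume "0 < om \<and> om < lam / \<bar>real_of_int m\<bar>"
  then show "\<exists>u h. landau_lifshitz_solution lam u \<and> equivariant_rotating m om h u \<and>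
            h 0 = 0 \<and> (h \<longlongrightarrow> pi) at_top \<and> (\<forall>r>0. 0 < h r \<and> h r < pi)"
    using existence[OF assms] by blast
qed

end
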